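(* Let $K$ be a field and let $P=K[a_1,\dots,a_m,x_1,\dots,x_{n-m}]$ (with $0\le m\le n-1$) be non-negatively $\mathbb{Z}$-graded by $W$ such that $\deg_W(a_i)=0$ for all $i$ and $\deg_W(x_j)>0$ for all $j$. Let $X^{+}=(x_1,\dots,x_{n-m})$. Let $I$ be a $W$-homogeneous ideal in $P$ such that $I\cap P_0=\{0\}$. (a) The scheme $\mathrm{Spec}(P/I)$ is connected. (b) If $P/I$ is a regular ring, then $I$ is a prime ideal. (c) If $P/I$ is a regular ring, then for every $\Gamma\in K^m$ the fiber $K[X^{+}]/I_\Gamma$ has dimension $\dim(P/I)-m$.
   Context: $P_0=K[a_1,\dots,a_m]$ is the degree-$0$ component of $P$. For $\Gamma=(c_1,\dots,c_m)\in K^m$, the fiber ideal $I_\Gamma\subseteq K[X^{+}]$ is the image of $I$ under the substitutions $a_i\mapsto c_i$ for $i=1,\dots,m$. *)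

theory Defs
  imports
    "HOL-Algebra.Algebra"
    "HOL-Analysis.Abstract_Topology"
    "HOL-Library.Poly_Mapping"
    "HOL-Library.Extended_Real"
begin

section \<open>Spectrum and Krull dimension\<close>

definition Spec :: "('a, 'b) ring_scheme \<Rightarrow> 'a set set"
  where "Spec R = {p. primeideal p R}"

definition vanishing_set :: "('a, 'b) ring_scheme \<Rightarrow> 'a set \<Rightarrow> 'a set set"
  where "vanishing_set R A = {p \<in> Spec R. A \<subseteq> p}"

definition zariski_topology :: "('a, 'b) ring_scheme \<Rightarrow> 'a set topology"
  where "zariski_topology R =
    topology (\<lambda>U. \<exists>A \<subseteq> carrier R. U = Spec R - vanishing_set R A)"

lemma vanishing_set_Un:
  assumes "cring R" "A \<subseteq> carrier R" "B \<subseteq> carrier R"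
  shows "vanishing_set R A \<union> vanishing_set R B
    = vanishing_set R {a \<otimes>\<^bsub>R\<^esub> b | a b. a \<in> A \<and> b \<in> B}"
proof -
  interpret cring R by fact
  have "A \<subseteq> p \<or> B \<subseteq> p \<longleftrightarrow> {a \<otimes>\<^bsub>R\<^esub> b | a b. a \<in> A \<and> b \<in> B} \<subseteq> p"
    if "primeideal p R" for p
  proof -
    interpret primeideal p R by fact
    show ?thesis
    proof
      assume "A \<subseteq> p \<or> B \<subseteq> p"
      then show "{a \<otimes>\<^bsub>R\<^esub> b | a b. a \<in> A \<and> b \<in> B} \<subseteq> p"
        using assms(2,3) by (auto intro: I_l_closed I_r_closed)
    next
      assume *: "{a \<otimes>\<^bsub>R\<^esub> b | a b. a \<in> A \<and> b \<in> B} \<subseteq> p"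
      show "A \<subseteq> p \<or> B \<subseteq> p"
      proof (rule ccontr)
        assume "\<not> (A \<subseteq> p \<or> B \<subseteq> p)"
        then obtain a b where "a \<in> A" "a \<notin> p" "b \<in> B" "b \<notin> p" by blast
        moreover from this have "a \<otimes>\<^bsub>R\<^esub> b \<in> p" using * by blast
        ultimately show False using assms(2,3) I_prime by blast
      qed
    qed
  qed
  then show ?thesis unfolding vanishing_set_def Spec_def by blast
qed

lemma istopology_zariski:
  assumes "cring R"
  shows "istopology (\<lambda>U. \<exists>A \<subseteq> carrier R. U = Spec R - vanishing_set R A)"
  unfolding istopology_def
proof (intro conjI allI impI)
  fix U V
  assume "\<exists>A \<subseteq> carrier R. U = Spec R - vanishing_set R A"
    and "\<exists>A \<subseteq> carrier R. V = Spec R - vanishing_set R A"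
  then obtain A B where AB: "A \<subseteq> carrier R" "B \<subseteq> carrier R"
    and U: "U = Spec R - vanishing_set R A" and V: "V = Spec R - vanishing_set R B"
    by blast
  interpret cring R by fact
  have "{a \<otimes>\<^bsub>R\<^esub> b | a b. a \<in> A \<and> b \<in> B} \<subseteq> carrier R" using AB by auto
  moreover have "U \<inter> V = Spec R - vanishing_set R {a \<otimes>\<^bsub>R\<^esub> b | a b. a \<in> A \<and> b \<in> B}"
    unfolding U V vanishing_set_Un[OF assms AB, symmetric] by blast
  ultimately show "\<exists>A \<subseteq> carrier R. U \<inter> V = Spec R - vanishing_set R A" by blast
next
  fix \<U>
  assume "\<forall>U\<in>\<U>. \<exists>A \<subseteq> carrier R. U = Spec R - vanishing_set R A"
  then obtain A where A: "A U \<subseteq> carrier R" "U = Spec R - vanishing_set R (A U)"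
    if "U \<in> \<U>" for U
    by metis
  have "\<Union>\<U> = Spec R - vanishing_set R (\<Union>U\<in>\<U>. A U)"
    using A(2) unfolding vanishing_set_def by blast
  moreover have "(\<Union>U\<in>\<U>. A U) \<subseteq> carrier R" using A(1) by blast
  ultimately show "\<exists>A \<subseteq> carrier R. \<Union>\<U> = Spec R - vanishing_set R A" by blast
qed

lemma openin_zariski:
  assumes "cring R"
  shows "openin (zariski_topology R) U
    \<longleftrightarrow> (\<exists>A \<subseteq> carrier R. U = Spec R - vanishing_set R A)"
  unfolding zariski_topology_def by (simp add: topology_inverse'[OF istopology_zariski[OF assms]])

lemma topspace_zariski:
  assumes "cring R"
  shows "topspace (zariski_topology R) = Spec R"
proof -
  interpret cring R by fact
  have "\<one>\<^bsub>R\<^esub> \<notin> p" if "primeideal p R" for p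
    using ideal.one_imp_carrier[OF primeideal.axioms(1)[OF that]] primeideal.I_notcarr[OF that]
    by blast
  then have "Spec R = Spec R - vanishing_set R {\<one>\<^bsub>R\<^esub>}"
    unfolding vanishing_set_def Spec_def by blast
  then have "openin (zariski_topology R) (Spec R)"
    unfolding openin_zariski[OF assms] by (intro exI[of _ "{\<one>\<^bsub>R\<^esub>}"]) simp
  then have "Spec R \<subseteq> topspace (zariski_topology R)"
    by (rule openin_subset)
  moreover have "topspace (zariski_topology R) \<subseteq> Spec R"
    using openin_topspace[of "zariski_topology R"] unfolding openin_zariski[OF assms] by blast
  ultimately show ?thesis by blast
qed

(* A connected scheme is nonempty, whereas connected_space also holds of the empty space. *)
definition connected_Spec :: "('a, 'b) ring_scheme \<Rightarrow> bool"
  where "connected_Spec R \<longleftrightarrow> Spec R \<noteq> {} \<and> connected_space (zariski_topology R)"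

(* The supremum of the lengths l of chains p 0 < ... < p l of prime ideals.
   Extended reals give dimension \<open>-\<infinity>\<close> to the zero ring, and untruncated subtraction. *)
definition krull_dim :: "('a, 'b) ring_scheme \<Rightarrow> ereal"
  where "krull_dim R = Sup {ereal (real l) | l.
    \<exists>p :: nat \<Rightarrow> 'a set. (\<forall>i\<le>l. p i \<in> Spec R) \<and> (\<forall>i<l. p i \<subset> p (Suc i))}"


section \<open>Localization\<close>

definition loc_rel :: "('a, 'b) ring_scheme \<Rightarrow> 'a set \<Rightarrow> (('a \<times> 'a) \<times> ('a \<times> 'a)) set"
  where "loc_rel R S = {((r, s), (r', s')).
    r \<in> carrier R \<and> s \<in> S \<and> r' \<in> carrier R \<and> s' \<in> S \<and>
    (\<exists>t\<in>S. t \<otimes>\<^bsub>R\<^esub> (s' \<otimes>\<^bsub>R\<^esub> r \<ominus>\<^bsub>R\<^esub> s \<otimes>\<^bsub>R\<^esub> r') = \<zero>\<^bsub>R\<^esub>)}"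

definition loc_frac :: "('a, 'b) ring_scheme \<Rightarrow> 'a set \<Rightarrow> 'a \<Rightarrow> 'a \<Rightarrow> ('a \<times> 'a) set"
  where "loc_frac R S r s = loc_rel R S `` {(r, s)}"

(* In the sums and products below all members of the union are the same class;
   see mult_loc_frac and add_loc_frac. *)
definition localization :: "('a, 'b) ring_scheme \<Rightarrow> 'a set \<Rightarrow> ('a \<times> 'a) set ring"
  where "localization R S = \<lparr>
    carrier = {loc_frac R S r s | r s. r \<in> carrier R \<and> s \<in> S},
    monoid.mult = (\<lambda>x y. \<Union>(r, s)\<in>x. \<Union>(r', s')\<in>y. loc_frac R S (r \<otimes>\<^bsub>R\<^esub> r') (s \<otimes>\<^bsub>R\<^esub> s')),
    monoid.one = loc_frac R S \<one>\<^bsub>R\<^esub> \<one>\<^bsub>R\<^esub>,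
    ring.zero = loc_frac R S \<zero>\<^bsub>R\<^esub> \<one>\<^bsub>R\<^esub>,
    ring.add = (\<lambda>x y. \<Union>(r, s)\<in>x. \<Union>(r', s')\<in>y.
      loc_frac R S (s' \<otimes>\<^bsub>R\<^esub> r \<oplus>\<^bsub>R\<^esub> s \<otimes>\<^bsub>R\<^esub> r') (s \<otimes>\<^bsub>R\<^esub> s'))\<rparr>"

definition localization_at :: "('a, 'b) ring_scheme \<Rightarrow> 'a set \<Rightarrow> ('a \<times> 'a) set ring"
  where "localization_at R p = localization R (carrier R - p)"

lemma UN_UN_const:
  assumes "p \<in> A" "q \<in> B"
    and "\<And>a u b v. \<lbrakk>(a, u) \<in> A; (b, v) \<in> B\<rbrakk> \<Longrightarrow> F a u b v = C"
  shows "(\<Union>(a, u)\<in>A. \<Union>(b, v)\<in>B. F a u b v) = C"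
proof -
  have "(\<Union>(a, u)\<in>A. \<Union>(b, v)\<in>B. F a u b v) = (\<Union>x\<in>A. \<Union>y\<in>B. C)"
    using assms(3) by (intro SUP_cong refl) (auto intro!: SUP_cong)
  also have "\<dots> = C" using assms(1,2) by blast
  finally show ?thesis .
qed

locale mult_subset = cring R for R :: "('a, 'b) ring_scheme" (structure) +
  fixes S :: "'a set"
  assumes S_carrier: "S \<subseteq> carrier R"
    and S_one: "\<one> \<in> S"
    and S_mult: "\<lbrakk>s \<in> S; t \<in> S\<rbrakk> \<Longrightarrow> s \<otimes> t \<in> S"
begin

lemma S_closed [simp, intro]: "s \<in> S \<Longrightarrow> s \<in> carrier R"
  using S_carrier by blast

lemma loc_relI:
  assumes "r \<in> carrier R" "s \<in> S" "r' \<in> carrier R" "s' \<in> S" "t \<in> S"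
    and "t \<otimes> (s' \<otimes> r) = t \<otimes> (s \<otimes> r')"
  shows "((r, s), (r', s')) \<in> loc_rel R S"
proof -
  have "t \<otimes> (s' \<otimes> r \<ominus> s \<otimes> r') = t \<otimes> (s' \<otimes> r) \<ominus> t \<otimes> (s \<otimes> r')"
    using assms S_closed by algebra
  also have "\<dots> = \<zero>" using assms by (simp add: r_right_minus_eq)
  finally show ?thesis using assms unfolding loc_rel_def by blast
qed

lemma loc_relE:
  assumes "((r, s), (r', s')) \<in> loc_rel R S"
  obtains t where "r \<in> carrier R" "s \<in> S" "r' \<in> carrier R" "s' \<in> S" "t \<in> S"
    and "t \<otimes> (s' \<otimes> r) = t \<otimes> (s \<otimes> r')"
proof -
  obtain t where t: "r \<in> carrier R" "s \<in> S" "r' \<in> carrier R" "s' \<in> S" "t \<in> S"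
    and eq: "t \<otimes> (s' \<otimes> r \<ominus> s \<otimes> r') = \<zero>"
    using assms unfolding loc_rel_def by blast
  have "t \<otimes> (s' \<otimes> r) \<ominus> t \<otimes> (s \<otimes> r') = t \<otimes> (s' \<otimes> r \<ominus> s \<otimes> r')"
    using t S_closed by algebra
  with eq have "t \<otimes> (s' \<otimes> r) = t \<otimes> (s \<otimes> r')"
    using t by (simp add: r_right_minus_eq)
  with t that show thesis by blast
qed

lemma equiv_loc_rel: "equiv (carrier R \<times> S) (loc_rel R S)"
proof (rule equivI)
  show "loc_rel R S \<subseteq> (carrier R \<times> S) \<times> (carrier R \<times> S)"
    unfolding loc_rel_def by auto
  show "refl_on (carrier R \<times> S) (loc_rel R S)"
    by (auto simp: refl_on_def intro: loc_relI[OF _ _ _ _ S_one])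
  show "sym (loc_rel R S)"
    by (auto simp: sym_def elim!: loc_relE intro: loc_relI[OF _ _ _ _ _ sym])
  show "trans (loc_rel R S)"
  proof (rule transI, clarify)
    fix a s b t c u
    assume "((a, s), (b, t)) \<in> loc_rel R S" "((b, t), (c, u)) \<in> loc_rel R S"
    then obtain v w where v: "a \<in> carrier R" "s \<in> S" "b \<in> carrier R" "t \<in> S" "v \<in> S"
        and e1: "v \<otimes> (t \<otimes> a) = v \<otimes> (s \<otimes> b)"
        and w: "c \<in> carrier R" "u \<in> S" "w \<in> S" and e2: "w \<otimes> (u \<otimes> b) = w \<otimes> (t \<otimes> c)"
      by (elim loc_relE) blast
    note S = v(2,4,5)[THEN S_closed] w(2,3)[THEN S_closed] v(1,3) w(1)
    have "v \<otimes> w \<otimes> t \<otimes> (u \<otimes> a) = w \<otimes> u \<otimes> (v \<otimes> (t \<otimes> a))" using S by algebra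
    also have "\<dots> = v \<otimes> s \<otimes> (w \<otimes> (u \<otimes> b))" unfolding e1 using S by algebra
    also have "\<dots> = v \<otimes> w \<otimes> t \<otimes> (s \<otimes> c)" unfolding e2 using S by algebra
    finally show "((a, s), (c, u)) \<in> loc_rel R S"
      using v w by (intro loc_relI[of _ _ _ _ "v \<otimes> w \<otimes> t"]) (auto intro: S_mult)
  qed
qed

lemma loc_frac_eq_iff:
  assumes "r \<in> carrier R" "s \<in> S" "r' \<in> carrier R" "s' \<in> S"
  shows "loc_frac R S r s = loc_frac R S r' s'
    \<longleftrightarrow> (\<exists>t\<in>S. t \<otimes> (s' \<otimes> r) = t \<otimes> (s \<otimes> r'))"
  unfolding loc_frac_def
  using eq_equiv_class_iff[OF equiv_loc_rel, of "(r, s)" "(r', s')"] assms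
  by (auto elim!: loc_relE intro: loc_relI)

lemma loc_frac_eqI:
  assumes "r \<in> carrier R" "s \<in> S" "r' \<in> carrier R" "s' \<in> S" "s' \<otimes> r = s \<otimes> r'"
  shows "loc_frac R S r s = loc_frac R S r' s'"
  using assms S_one by (auto simp: loc_frac_eq_iff)

lemma mem_loc_frac:
  assumes "(r', s') \<in> loc_frac R S r s"
  obtains t where "r \<in> carrier R" "s \<in> S" "r' \<in> carrier R" "s' \<in> S" "t \<in> S"
    "t \<otimes> (s' \<otimes> r) = t \<otimes> (s \<otimes> r')"
  using assms unfolding loc_frac_def by (auto elim: loc_relE)

lemma loc_frac_self: "\<lbrakk>r \<in> carrier R; s \<in> S\<rbrakk> \<Longrightarrow> (r, s) \<in> loc_frac R S r s"
  unfolding loc_frac_def by (auto intro: loc_relI[OF _ _ _ _ S_one])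

lemma mult_loc_frac:
  assumes "r \<in> carrier R" "s \<in> S" "r' \<in> carrier R" "s' \<in> S"
  shows "loc_frac R S r s \<otimes>\<^bsub>localization R S\<^esub> loc_frac R S r' s'
    = loc_frac R S (r \<otimes> r') (s \<otimes> s')"
proof -
  have "loc_frac R S (a \<otimes> b) (u \<otimes> v) = loc_frac R S (r \<otimes> r') (s \<otimes> s')"
    if rep: "(a, u) \<in> loc_frac R S r s" "(b, v) \<in> loc_frac R S r' s'" for a u b v
  proof -
    obtain x where x: "a \<in> carrier R" "u \<in> S" "x \<in> S" "x \<otimes> (u \<otimes> r) = x \<otimes> (s \<otimes> a)"
      using mem_loc_frac[OF rep(1)] by blast
    obtain y where y: "b \<in> carrier R" "v \<in> S" "y \<in> S" "y \<otimes> (v \<otimes> r') = y \<otimes> (s' \<otimes> b)"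
      using mem_loc_frac[OF rep(2)] by blast
    note S = assms(1,3) assms(2,4)[THEN S_closed] x(1) y(1) x(2,3)[THEN S_closed] y(2,3)[THEN S_closed]
    have "x \<otimes> y \<otimes> (s \<otimes> s' \<otimes> (a \<otimes> b)) = (x \<otimes> (s \<otimes> a)) \<otimes> (y \<otimes> (s' \<otimes> b))"
      using S by algebra
    also have "\<dots> = x \<otimes> y \<otimes> (u \<otimes> v \<otimes> (r \<otimes> r'))"
      unfolding x(4)[symmetric] y(4)[symmetric] using S by algebra
    finally show ?thesis
      using assms x y by (subst loc_frac_eq_iff) (auto intro: S_mult)
  qed
  then show ?thesis
    unfolding localization_def monoid.simps ring.simps
    by (intro UN_UN_const[OF loc_frac_self[OF assms(1,2)] loc_frac_self[OF assms(3,4)]])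
qed

lemma add_loc_frac:
  assumes "r \<in> carrier R" "s \<in> S" "r' \<in> carrier R" "s' \<in> S"
  shows "loc_frac R S r s \<oplus>\<^bsub>localization R S\<^esub> loc_frac R S r' s'
    = loc_frac R S (s' \<otimes> r \<oplus> s \<otimes> r') (s \<otimes> s')"
proof -
  have "loc_frac R S (v \<otimes> a \<oplus> u \<otimes> b) (u \<otimes> v)
      = loc_frac R S (s' \<otimes> r \<oplus> s \<otimes> r') (s \<otimes> s')"
    if rep: "(a, u) \<in> loc_frac R S r s" "(b, v) \<in> loc_frac R S r' s'" for a u b v
  proof -
    obtain x where x: "a \<in> carrier R" "u \<in> S" "x \<in> S" "x \<otimes> (u \<otimes> r) = x \<otimes> (s \<otimes> a)"
      using mem_loc_frac[OF rep(1)] by blast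
    obtain y where y: "b \<in> carrier R" "v \<in> S" "y \<in> S" "y \<otimes> (v \<otimes> r') = y \<otimes> (s' \<otimes> b)"
      using mem_loc_frac[OF rep(2)] by blast
    note S = assms(1,3) assms(2,4)[THEN S_closed] x(1) y(1) x(2,3)[THEN S_closed] y(2,3)[THEN S_closed]
    have "x \<otimes> y \<otimes> (s \<otimes> s' \<otimes> (v \<otimes> a \<oplus> u \<otimes> b))
        = y \<otimes> s' \<otimes> v \<otimes> (x \<otimes> (s \<otimes> a)) \<oplus> x \<otimes> s \<otimes> u \<otimes> (y \<otimes> (s' \<otimes> b))"
      using S by algebra
    also have "\<dots> = x \<otimes> y \<otimes> (u \<otimes> v \<otimes> (s' \<otimes> r \<oplus> s \<otimes> r'))"
      unfolding x(4)[symmetric] y(4)[symmetric] using S by algebra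
    finally show ?thesis
      using assms x y by (subst loc_frac_eq_iff) (auto intro: S_mult)
  qed
  then show ?thesis
    unfolding localization_def monoid.simps ring.simps
    by (intro UN_UN_const[OF loc_frac_self[OF assms(1,2)] loc_frac_self[OF assms(3,4)]])
qed

lemma cring_localization: "cring (localization R S)"
proof -
  let ?L = "localization R S"
  have carr: "carrier ?L = {loc_frac R S r s | r s. r \<in> carrier R \<and> s \<in> S}"
    and L_one: "\<one>\<^bsub>?L\<^esub> = loc_frac R S \<one> \<one>" and L_zero: "\<zero>\<^bsub>?L\<^esub> = loc_frac R S \<zero> \<one>"
    by (simp_all add: localization_def)
  show ?thesis
  proof (rule cringI)
    show "abelian_group ?L"
    proof (rule abelian_groupI)
      show "\<exists>y\<in>carrier ?L. y \<oplus>\<^bsub>?L\<^esub> x = \<zero>\<^bsub>?L\<^esub>" if mem: "x \<in> carrier ?L" for x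
      proof -
        obtain r s where x: "r \<in> carrier R" "s \<in> S" "x = loc_frac R S r s"
          using mem unfolding carr by blast
        have "s \<otimes> (\<ominus> r) \<oplus> s \<otimes> r = \<zero>" using x S_closed[of s] by algebra
        then have "loc_frac R S (\<ominus> r) s \<oplus>\<^bsub>?L\<^esub> x = \<zero>\<^bsub>?L\<^esub>"
          using x S_one S_mult[of s s]
          by (simp add: add_loc_frac L_zero) (rule loc_frac_eqI; simp)
        then show ?thesis using x carr by blast
      qed
    next
      show "x \<oplus>\<^bsub>?L\<^esub> y \<in> carrier ?L" if mem: "x \<in> carrier ?L" "y \<in> carrier ?L" for x y
      proof -
        obtain a s b t where xy: "x = loc_frac R S a s" "y = loc_frac R S b t"
          and ac: "a \<in> carrier R" "b \<in> carrier R" and S: "s \<in> S" "t \<in> S"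
          using mem unfolding carr by blast
        then have "t \<otimes> a \<oplus> s \<otimes> b \<in> carrier R" "s \<otimes> t \<in> S" by (simp_all add: S_mult)
        then show ?thesis unfolding carr xy add_loc_frac[OF ac(1) S(1) ac(2) S(2)] by blast
      qed
    next
      show "\<zero>\<^bsub>?L\<^esub> \<in> carrier ?L" unfolding carr L_zero using S_one by blast
    next
      show "(x \<oplus>\<^bsub>?L\<^esub> y) \<oplus>\<^bsub>?L\<^esub> z = x \<oplus>\<^bsub>?L\<^esub> (y \<oplus>\<^bsub>?L\<^esub> z)"
        if mem: "x \<in> carrier ?L" "y \<in> carrier ?L" "z \<in> carrier ?L" for x y z
      proof -
        obtain a s b t c u where xyz: "x = loc_frac R S a s" "y = loc_frac R S b t" "z = loc_frac R S c u"
          and ac: "a \<in> carrier R" "b \<in> carrier R" "c \<in> carrier R" and S: "s \<in> S" "t \<in> S" "u \<in> S"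
          using mem unfolding carr by blast
        have "u \<otimes> (t \<otimes> a \<oplus> s \<otimes> b) \<oplus> s \<otimes> t \<otimes> c = t \<otimes> u \<otimes> a \<oplus> s \<otimes> (u \<otimes> b \<oplus> t \<otimes> c)"
          "s \<otimes> t \<otimes> u = s \<otimes> (t \<otimes> u)"
          using ac S[THEN S_closed] by algebra+
        then show ?thesis using ac S by (simp add: xyz add_loc_frac S_mult)
      qed
    next
      show "x \<oplus>\<^bsub>?L\<^esub> y = y \<oplus>\<^bsub>?L\<^esub> x" if mem: "x \<in> carrier ?L" "y \<in> carrier ?L" for x y
      proof -
        obtain a s b t where xy: "x = loc_frac R S a s" "y = loc_frac R S b t"
          and ac: "a \<in> carrier R" "b \<in> carrier R" and S: "s \<in> S" "t \<in> S"
          using mem unfolding carr by blast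
        have "t \<otimes> a \<oplus> s \<otimes> b = s \<otimes> b \<oplus> t \<otimes> a" "s \<otimes> t = t \<otimes> s"
          using ac S[THEN S_closed] by algebra+
        then show ?thesis using ac S by (simp add: xy add_loc_frac)
      qed
    next
      show "\<zero>\<^bsub>?L\<^esub> \<oplus>\<^bsub>?L\<^esub> x = x" if mem: "x \<in> carrier ?L" for x
        using mem S_one by (auto simp: carr L_zero add_loc_frac)
    qed
    show "comm_monoid ?L"
    proof (rule comm_monoidI)
      show "x \<otimes>\<^bsub>?L\<^esub> y \<in> carrier ?L" if mem: "x \<in> carrier ?L" "y \<in> carrier ?L" for x y
      proof -
        obtain a s b t where xy: "x = loc_frac R S a s" "y = loc_frac R S b t"
          and ac: "a \<in> carrier R" "b \<in> carrier R" and S: "s \<in> S" "t \<in> S"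
          using mem unfolding carr by blast
        then have "a \<otimes> b \<in> carrier R" "s \<otimes> t \<in> S" by (simp_all add: S_mult)
        then show ?thesis unfolding carr xy mult_loc_frac[OF ac(1) S(1) ac(2) S(2)] by blast
      qed
    next
      show "\<one>\<^bsub>?L\<^esub> \<in> carrier ?L" unfolding carr L_one using S_one by blast
    next
      show "(x \<otimes>\<^bsub>?L\<^esub> y) \<otimes>\<^bsub>?L\<^esub> z = x \<otimes>\<^bsub>?L\<^esub> (y \<otimes>\<^bsub>?L\<^esub> z)"
        if mem: "x \<in> carrier ?L" "y \<in> carrier ?L" "z \<in> carrier ?L" for x y z
        using mem by (auto simp: carr mult_loc_frac S_mult m_assoc)
    next
      show "\<one>\<^bsub>?L\<^esub> \<otimes>\<^bsub>?L\<^esub> x = x" if mem: "x \<in> carrier ?L" for x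
        using mem S_one by (auto simp: carr L_one mult_loc_frac)
    next
      show "x \<otimes>\<^bsub>?L\<^esub> y = y \<otimes>\<^bsub>?L\<^esub> x" if mem: "x \<in> carrier ?L" "y \<in> carrier ?L" for x y
        using mem by (auto simp: carr mult_loc_frac m_comm)
    qed
    show "(x \<oplus>\<^bsub>?L\<^esub> y) \<otimes>\<^bsub>?L\<^esub> z = x \<otimes>\<^bsub>?L\<^esub> z \<oplus>\<^bsub>?L\<^esub> y \<otimes>\<^bsub>?L\<^esub> z"
      if mem: "x \<in> carrier ?L" "y \<in> carrier ?L" "z \<in> carrier ?L" for x y z
    proof -
      obtain a s b t c u where xyz: "x = loc_frac R S a s" "y = loc_frac R S b t" "z = loc_frac R S c u"
        and ac: "a \<in> carrier R" "b \<in> carrier R" "c \<in> carrier R" and S: "s \<in> S" "t \<in> S" "u \<in> S"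
        using mem unfolding carr by blast
      have "s \<otimes> u \<otimes> (t \<otimes> u) \<otimes> ((t \<otimes> a \<oplus> s \<otimes> b) \<otimes> c)
          = s \<otimes> t \<otimes> u \<otimes> (t \<otimes> u \<otimes> (a \<otimes> c) \<oplus> s \<otimes> u \<otimes> (b \<otimes> c))"
        using ac S[THEN S_closed] by algebra
      then show ?thesis
        using ac S by (simp add: xyz mult_loc_frac add_loc_frac S_mult) (rule loc_frac_eqI; simp add: S_mult)
    qed
  qed
qed

end

lemma mult_subset_prime_complement:
  assumes "primeideal p R"
  shows "mult_subset R (carrier R - p)"
proof -
  interpret primeideal p R by fact
  show ?thesis
    by unfold_locales (use I_prime one_imp_carrier I_notcarr in auto)
qed


section \<open>Regular rings\<close>

(* The maximal ideal is generated by dim R elements. *)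
definition regular_local_ring :: "('a, 'b) ring_scheme \<Rightarrow> bool"
  where "regular_local_ring R \<longleftrightarrow> cring R \<and> noetherian_ring R \<and>
    (\<exists>!M. maximalideal M R) \<and>
    (\<exists>A \<subseteq> carrier R. finite A \<and> ereal (real (card A)) = krull_dim R \<and>
      maximalideal (Idl\<^bsub>R\<^esub> A) R)"

definition regular_ring :: "('a, 'b) ring_scheme \<Rightarrow> bool"
  where "regular_ring R \<longleftrightarrow> cring R \<and> noetherian_ring R \<and>
    (\<forall>p. primeideal p R \<longrightarrow> regular_local_ring (localization_at R p))"


section \<open>Polynomial rings\<close>

(* Power products are the finitely supported exponent vectors \<open>nat \<Rightarrow>\<^sub>0 nat\<close>. *)
type_synonym 'k mpoly = "(nat \<Rightarrow>\<^sub>0 nat) \<Rightarrow>\<^sub>0 'k"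

(* The polynomial ring over 'k in the indeterminates with index in V. *)
definition mpoly_ring :: "nat set \<Rightarrow> 'k::field mpoly ring"
  where "mpoly_ring V = \<lparr>
    carrier = {f. \<forall>t\<in>Poly_Mapping.keys f. Poly_Mapping.keys t \<subseteq> V},
    monoid.mult = (*), monoid.one = 1, ring.zero = 0, ring.add = (+)\<rparr>"

definition mpoly_const :: "'k::field \<Rightarrow> 'k mpoly"
  where "mpoly_const c = Poly_Mapping.single 0 c"

definition mpoly_var :: "nat \<Rightarrow> 'k::field mpoly"
  where "mpoly_var i = Poly_Mapping.single (Poly_Mapping.single i 1) 1"

lemma cring_mpoly_ring: "cring (mpoly_ring V)"
proof (rule cringI)
  let ?C = "{f :: 'a mpoly. \<forall>t\<in>Poly_Mapping.keys f. Poly_Mapping.keys t \<subseteq> V}"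
  have add: "f + g \<in> ?C" if "f \<in> ?C" "g \<in> ?C" for f g
    using that Poly_Mapping.keys_add[of f g] by blast
  have mult: "f * g \<in> ?C" if "f \<in> ?C" "g \<in> ?C" for f g
  proof (clarsimp, rule ccontr)
    fix t i
    assume "t \<in> Poly_Mapping.keys (f * g)" and i: "i \<in> Poly_Mapping.keys t" "i \<notin> V"
    then obtain u v where "t = u + v" "u \<in> Poly_Mapping.keys f" "v \<in> Poly_Mapping.keys g"
      using keys_mult[of f g] by blast
    with i that Poly_Mapping.keys_add[of u v] show False by blast
  qed
  have uminus: "- f \<in> ?C" if "f \<in> ?C" for f
    using that by (simp add: keys.rep_eq)
  have simps: "carrier (mpoly_ring V :: 'a mpoly ring) = ?C"
    "monoid.mult (mpoly_ring V) = ((*) :: 'a mpoly \<Rightarrow> _)" "monoid.one (mpoly_ring V) = (1 :: 'a mpoly)"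
    "ring.zero (mpoly_ring V) = (0 :: 'a mpoly)" "ring.add (mpoly_ring V) = ((+) :: 'a mpoly \<Rightarrow> _)"
    by (simp_all only: mpoly_ring_def partial_object.simps monoid.simps ring.simps)
  have zero: "0 \<in> ?C" and one: "1 \<in> ?C" by auto
  have minus: "\<exists>g\<in>?C. g + f = 0" if "f \<in> ?C" for f
    using uminus[OF that] left_minus[of f] by (rule bexI[rotated])
  show "abelian_group (mpoly_ring V :: 'a mpoly ring)"
    by (rule abelian_groupI; unfold simps)
      (rule add zero minus add.assoc add_0_left add.commute; assumption)+
  show "comm_monoid (mpoly_ring V :: 'a mpoly ring)"
    by (rule comm_monoidI; unfold simps)
      (rule mult one mult.assoc mult_1_left mult.commute; assumption)+
qed (simp only: mpoly_ring_def monoid.simps ring.simps distrib_right)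

definition weighted_degree :: "(nat \<Rightarrow> int) \<Rightarrow> (nat \<Rightarrow>\<^sub>0 nat) \<Rightarrow> int"
  where "weighted_degree W t =
    (\<Sum>i\<in>Poly_Mapping.keys t. W i * int (Poly_Mapping.lookup t i))"

definition homogeneous_component :: "(nat \<Rightarrow> int) \<Rightarrow> int \<Rightarrow> 'k::field mpoly \<Rightarrow> 'k mpoly"
  where "homogeneous_component W d f =
    (\<Sum>t\<in>{t \<in> Poly_Mapping.keys f. weighted_degree W t = d}.
      Poly_Mapping.single t (Poly_Mapping.lookup f t))"

definition homogeneous_ideal :: "(nat \<Rightarrow> int) \<Rightarrow> 'k::field mpoly ring \<Rightarrow> 'k mpoly set \<Rightarrow> bool"
  where "homogeneous_ideal W P I \<longleftrightarrow>
    ideal I P \<and> (\<forall>f\<in>I. \<forall>d. homogeneous_component W d f \<in> I)"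

definition mpoly_subst :: "(nat \<Rightarrow> 'k::field mpoly) \<Rightarrow> 'k mpoly \<Rightarrow> 'k mpoly"
  where "mpoly_subst \<phi> f = (\<Sum>t\<in>Poly_Mapping.keys f.
    mpoly_const (Poly_Mapping.lookup f t)
      * (\<Prod>i\<in>Poly_Mapping.keys t. \<phi> i ^ Poly_Mapping.lookup t i))"

(* Only \<open>\<Gamma> 0, ..., \<Gamma> (m - 1)\<close> matter.  The indeterminates a_1, ..., a_m have the indices 0, ..., m - 1; all others are kept. *)
definition fiber_ideal :: "nat \<Rightarrow> (nat \<Rightarrow> 'k::field) \<Rightarrow> 'k mpoly set \<Rightarrow> 'k mpoly set"
  where "fiber_ideal m \<Gamma> I =
    mpoly_subst (\<lambda>i. if i < m then mpoly_const (\<Gamma> i) else mpoly_var i) ` I"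

end

theory Submission
  imports Defs "HOL-Computational_Algebra.Polynomial"
begin

text \<open>
  Homogeneous elements of \<open>I\<close> lie in the ideal generated by the indeterminates \<open>x\<close> of positive weight, so a
  prime \<open>q\<close> of \<open>P\<^sub>0 = K[a]\<close> yields the prime \<open>Q = q P + (x)\<close> over \<open>I\<close>.  Every prime over \<open>I\<close> specializes and
  generizes to such a \<open>Q\<close> through its homogeneous part, and all of these contain \<open>(x)\<close>: this is (a).

  For (b) and (c), choose a maximal set \<open>J\<close> of indeterminates \<open>x\<^sub>j\<close> such that \<open>I\<close> contains elements whose
  coefficients of the linear terms \<open>x\<^sub>j\<close>, \<open>j \<in> J\<close>, form a diagonal matrix that is invertible modulo \<open>q\<close>.  Solving
  these equations by induction on the weight shows that, up to inverting elements of \<open>P\<^sub>0 - q\<close>, \<open>P/I\<close> is a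
  quotient of the polynomial ring \<open>B\<close> in the indeterminates \<open>V\<close> outside \<open>J\<close>, and by maximality \<open>I \<inter> B\<close> lies
  locally in the square of the prime \<open>Q \<inter> B\<close>.  Hence the regular local ring of \<open>P/I\<close> at \<open>Q\<close> has the embedding
  dimension of \<open>B\<close> at \<open>Q \<inter> B\<close>, which bounds the height of \<open>Q \<inter> B\<close>.  A nonzero element of \<open>I \<inter> B\<close> would allow a
  longer chain of primes in \<open>B\<close>, so \<open>I \<inter> B = 0\<close>: locally on \<open>Spec P\<^sub>0\<close>, \<open>P/I\<close> is a polynomial ring.  Varying
  \<open>q\<close>, \<open>P/I\<close> is torsion-free over \<open>P\<^sub>0\<close> and thus a domain, and for \<open>q = (a - \<Gamma>)\<close> the fiber is the polynomial
  ring in the indeterminates \<open>V\<close> other than \<open>a\<close>.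
\<close>

section \<open>Prime ideals of subrings\<close>

text \<open>Regularity speaks of local rings of the quotient \<open>P/I\<close>, whereas the pivots
  live in \<open>P\<close>. Subrings and ideals are therefore plain subsets of one commutative ring
  and localization means denominators outside a prime; ring records appear only where spectrum,
  dimension and regularity are translated. The core is a squeeze at \<open>Q\<close>. For a suitable
  set \<open>T\<close> of indeterminates from \<open>V\<close> that are independent modulo
  \<open>Q \<inter> B\<close>, the number \<open>card (V - T)\<close> bounds the length of chains of
  primes in \<open>B\<close> ending in \<open>Q \<inter> B\<close>, and it is also the number of
  local generators of \<open>Q \<inter> B\<close> that are independent modulo its square. Regularity
  supplies a chain of at least this length between \<open>I\<close> and \<open>Q\<close>. It stays
  strict in \<open>B\<close>, because every element of \<open>P\<close> agrees with one of
  \<open>B\<close> modulo \<open>I\<close>, up to a denominator outside \<open>Q\<close>. The bound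
  is thus attained above \<open>I \<inter> B\<close>, which leaves no room for the prime 0 strictly
  below. The dimension of \<open>P/I\<close> also requires a bound for chains that do not end in
  \<open>Q\<close>; it comes from algebraic dependence over a common denominator, once
  \<open>I\<close> is known to be prime.\<close>

locale subring_of =
  fixes R :: "'r::comm_ring_1 set"
  assumes one_closed: "1 \<in> R"
    and diff_closed: "\<lbrakk>x \<in> R; y \<in> R\<rbrakk> \<Longrightarrow> x - y \<in> R"
    and mult_closed: "\<lbrakk>x \<in> R; y \<in> R\<rbrakk> \<Longrightarrow> x * y \<in> R"
begin

lemma zero_closed: "0 \<in> R"
  using diff_closed[OF one_closed one_closed] by simp

lemma uminus_closed: "x \<in> R \<Longrightarrow> - x \<in> R"
  using diff_closed[OF zero_closed] by simp

lemma add_closed: "\<lbrakk>x \<in> R; y \<in> R\<rbrakk> \<Longrightarrow> x + y \<in> R"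
  using diff_closed[of x "- y"] uminus_closed by simp

lemma sum_closed: "(\<And>a. a \<in> A \<Longrightarrow> f a \<in> R) \<Longrightarrow> (\<Sum>a\<in>A. f a) \<in> R"
  by (induction A rule: infinite_finite_induct) (auto intro: zero_closed add_closed)

lemma prod_closed: "(\<And>a. a \<in> A \<Longrightarrow> f a \<in> R) \<Longrightarrow> (\<Prod>a\<in>A. f a) \<in> R"
  by (induction A rule: infinite_finite_induct) (auto intro: one_closed mult_closed)

lemma power_closed: "x \<in> R \<Longrightarrow> x ^ k \<in> R"
  by (induction k) (auto intro: one_closed mult_closed)

lemmas closed = zero_closed one_closed uminus_closed add_closed diff_closed mult_closed
  sum_closed prod_closed power_closed

lemma coeff_mult_closed:
  assumes "\<And>k. coeff F k \<in> R" "\<And>k. coeff G k \<in> R"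
  shows "coeff (F * G) k \<in> R"
  unfolding coeff_mult using assms by (intro sum_closed mult_closed)

end

locale ideal_in = subring_of R for R :: "'r::comm_ring_1 set" +
  fixes I :: "'r set"
  assumes I_subset: "I \<subseteq> R"
    and I_zero: "0 \<in> I"
    and I_diff: "\<lbrakk>x \<in> I; y \<in> I\<rbrakk> \<Longrightarrow> x - y \<in> I"
    and I_mult: "\<lbrakk>r \<in> R; x \<in> I\<rbrakk> \<Longrightarrow> r * x \<in> I"
begin

lemma I_uminus: "x \<in> I \<Longrightarrow> - x \<in> I"
  using I_diff[OF I_zero] by simp

lemma I_add: "\<lbrakk>x \<in> I; y \<in> I\<rbrakk> \<Longrightarrow> x + y \<in> I"
  using I_diff[of x "- y"] I_uminus by simp

lemma I_mult_right: "\<lbrakk>x \<in> I; r \<in> R\<rbrakk> \<Longrightarrow> x * r \<in> I"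
  using I_mult[of r x] by (simp add: mult.commute)

lemma I_sum: "(\<And>a. a \<in> A \<Longrightarrow> f a \<in> I) \<Longrightarrow> (\<Sum>a\<in>A. f a) \<in> I"
  by (induction A rule: infinite_finite_induct) (auto intro: I_zero I_add)

lemma I_in_R: "x \<in> I \<Longrightarrow> x \<in> R"
  using I_subset by blast

end

locale prime_in = ideal_in R p for R p :: "'r::comm_ring_1 set" +
  assumes p_one: "1 \<notin> p"
    and p_prime: "\<lbrakk>x \<in> R; y \<in> R; x * y \<in> p\<rbrakk> \<Longrightarrow> x \<in> p \<or> y \<in> p"
begin

lemmas p_subset = I_subset and p_zero = I_zero and p_diff = I_diff and p_mult = I_mult
  and p_mult_right = I_mult_right and p_uminus = I_uminus and p_add = I_add and p_sum = I_sum
  and in_R = I_in_R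

lemma p_add_iff: "y \<in> p \<Longrightarrow> x + y \<in> p \<longleftrightarrow> x \<in> p"
  using p_add[of x y] p_diff[of "x + y" y] by auto

lemma notin_mult: "\<lbrakk>x \<in> R - p; y \<in> R - p\<rbrakk> \<Longrightarrow> x * y \<in> R - p"
  using p_prime mult_closed by blast

lemma notin_one: "1 \<in> R - p"
  using p_one one_closed by blast

lemma notin_prod: "(\<And>a. a \<in> A \<Longrightarrow> f a \<in> R - p) \<Longrightarrow> (\<Prod>a\<in>A. f a) \<in> R - p"
  by (induction A rule: infinite_finite_induct) (use notin_one notin_mult in auto)

lemma notin_power: "x \<in> R - p \<Longrightarrow> x ^ k \<in> R - p"
  by (induction k) (use notin_one notin_mult in auto)

text \<open>Over the fraction field of \<open>R\<close> modulo \<open>p\<close> this says that a homogeneous linear system with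
  more unknowns than equations has a nontrivial solution.\<close>

lemma linear_system:
  assumes "finite B" "finite A" "card B < card A"
    and "\<And>a b. \<lbrakk>a \<in> A; b \<in> B\<rbrakk> \<Longrightarrow> C a b \<in> R"
  shows "\<exists>w. (\<forall>a\<in>A. w a \<in> R) \<and> (\<exists>a\<in>A. w a \<notin> p) \<and> (\<forall>b\<in>B. (\<Sum>a\<in>A. w a * C a b) \<in> p)"
  using assms
proof (induction B arbitrary: A C rule: finite_induct)
  case empty
  then obtain a where "a \<in> A" by (metis card_gt_0_iff card.empty ex_in_conv)
  then show ?case using p_one one_closed by (intro exI[of _ "\<lambda>_. 1"]) auto
next
  case (insert b B)
  then have card: "card B < card A" by simp
  show ?case
  proof (cases "\<forall>a\<in>A. C a b \<in> p")
    case True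
    obtain w where w: "\<forall>a\<in>A. w a \<in> R" "\<exists>a\<in>A. w a \<notin> p" "\<forall>b\<in>B. (\<Sum>a\<in>A. w a * C a b) \<in> p"
      using insert.IH[of A C] insert.prems card by blast
    have "(\<Sum>a\<in>A. w a * C a b) \<in> p" using True w(1) by (intro p_sum p_mult) auto
    with w show ?thesis by (intro exI[of _ w]) auto
  next
    case False
    then obtain a0 where a0: "a0 \<in> A" "C a0 b \<notin> p" by blast
    define A' where "A' = A - {a0}"
    have A': "finite A'" "A = insert a0 A'" "a0 \<notin> A'" using a0 insert.prems by (auto simp: A'_def)
    \<comment> \<open>Elimination without division: the pivot \<open>C a0 b\<close> is outside
      \<open>p\<close> but need not be invertible, so rows are cross-multiplied. The column
      \<open>b\<close> of \<open>C'\<close> vanishes identically, and \<open>v\<close> lifts a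
      solution \<open>w\<close> of the smaller system, the entry \<open>v a0\<close> compensating
      for the subtracted multiples of the row \<open>a0\<close>.\<close>
    define C' where "C' a k = C a0 b * C a k - C a b * C a0 k" for a k
    have "card B < card A'" using insert.prems insert.hyps A' by simp
    moreover have "C' a k \<in> R" if "a \<in> A'" "k \<in> B" for a k
      unfolding C'_def using insert.prems(3) that a0 A' by (intro diff_closed mult_closed) auto
    ultimately obtain w where w: "\<forall>a\<in>A'. w a \<in> R" "\<exists>a\<in>A'. w a \<notin> p"
        "\<forall>b\<in>B. (\<Sum>a\<in>A'. w a * C' a b) \<in> p"
      using insert.IH[of A' C'] A'(1) by blast
    define v where "v a = (if a = a0 then - (\<Sum>a\<in>A'. w a * C a b) else C a0 b * w a)" for a
    have v: "(\<Sum>a\<in>A. v a * C a k) = (\<Sum>a\<in>A'. w a * C' a k)" for k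
    proof -
      have "(\<Sum>a\<in>A. v a * C a k) = v a0 * C a0 k + (\<Sum>a\<in>A'. v a * C a k)"
        using A' by simp
      also have "(\<Sum>a\<in>A'. v a * C a k) = (\<Sum>a\<in>A'. C a0 b * w a * C a k)"
        using A' by (intro sum.cong) (auto simp: v_def)
      also have "v a0 * C a0 k = (\<Sum>a\<in>A'. - (w a * C a b * C a0 k))"
        by (simp add: v_def sum_distrib_right sum_negf)
      also have "\<dots> + (\<Sum>a\<in>A'. C a0 b * w a * C a k) = (\<Sum>a\<in>A'. w a * C' a k)"
        by (simp add: sum.distrib[symmetric] C'_def algebra_simps)
      finally show ?thesis .
    qed
    have "(\<Sum>a\<in>A'. w a * C' a b) = 0" by (simp add: C'_def mult.commute)
    then have "\<forall>k\<in>insert b B. (\<Sum>a\<in>A. v a * C a k) \<in> p"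
      using v w(3) p_zero by auto
    moreover have "\<forall>a\<in>A. v a \<in> R"
      unfolding v_def using w(1) insert.prems(3) A' a0 by (auto intro!: closed)
    moreover obtain a where "a \<in> A'" "w a \<notin> p" using w(2) by blast
    then have "v a \<notin> p" "a \<in> A"
      using A' a0 p_prime[of "C a0 b" "w a"] w(1) insert.prems(3) by (auto simp: v_def)
    ultimately show ?thesis by blast
  qed
qed

text \<open>Gaussian elimination in place of the inverse of a matrix that is diagonal and invertible
  modulo \<open>p\<close>. Cross-multiplication with a pivot row changes a diagonal entry, apart
  from a factor outside \<open>p\<close>, only by an element of \<open>p\<close>, so the smaller
  matrix has the same shape. \<open>S\<close> acts as a submodule in which factors outside
  \<open>p\<close> can be cancelled.\<close>

lemma elimination:
  assumes "finite J"
    and S: "0 \<in> S" "\<And>x y. \<lbrakk>x \<in> S; y \<in> S\<rbrakk> \<Longrightarrow> x - y \<in> S" "\<And>r x. \<lbrakk>r \<in> R; x \<in> S\<rbrakk> \<Longrightarrow> r * x \<in> S"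
      "\<And>r x. \<lbrakk>r \<in> R - p; r * x \<in> S\<rbrakk> \<Longrightarrow> x \<in> S"
    and "\<And>j k. \<lbrakk>j \<in> J; k \<in> J\<rbrakk> \<Longrightarrow> c j k \<in> R" "\<And>j. j \<in> J \<Longrightarrow> c j j \<notin> p"
      "\<And>j k. \<lbrakk>j \<in> J; k \<in> J; j \<noteq> k\<rbrakk> \<Longrightarrow> c j k \<in> p"
      "\<And>j. j \<in> J \<Longrightarrow> (\<Sum>k\<in>J. c j k * x k) \<in> S"
    and "j \<in> J"
  shows "x j \<in> S"
proof -
  have "\<forall>j\<in>J. x j \<in> S" using assms(1,6-9)
  proof (induction J arbitrary: c rule: finite_induct)
    case empty
    then show ?case by simp
  next
    case (insert j0 J)
    define c' where "c' j k = c j0 j0 * c j k - c j j0 * c j0 k" for j k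
    have "\<forall>j\<in>J. x j \<in> S"
    proof (rule insert.IH[of c'])
      fix j assume j: "j \<in> J"
      show "c' j k \<in> R" if "k \<in> J" for k
        unfolding c'_def using insert.prems(1) j that by (intro diff_closed mult_closed) auto
      show "c' j k \<in> p" if "k \<in> J" "j \<noteq> k" for k
        unfolding c'_def
        by (intro p_diff p_mult[of "c j0 j0"] p_mult_right[of "c j j0"] insert.prems(1,3))
          (use insert.hyps j that in auto)
      have "c j0 j0 * c j j \<notin> p"
        using p_prime[of "c j0 j0" "c j j"] insert.prems(1,2) j by auto
      moreover have "c j j0 * c j0 j \<in> p"
        by (intro p_mult insert.prems(1,3)) (use insert.hyps j in auto)
      ultimately show "c' j j \<notin> p"
        using p_add_iff[of "c j j0 * c j0 j" "c' j j"] by (simp add: c'_def)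
      have "(\<Sum>k\<in>J. c' j k * x k)
          = c j0 j0 * (\<Sum>k\<in>insert j0 J. c j k * x k) - c j j0 * (\<Sum>k\<in>insert j0 J. c j0 k * x k)"
        using insert.hyps by (simp add: c'_def sum_distrib_left sum_subtractf algebra_simps)
      also have "\<dots> \<in> S" by (intro S(2) S(3) insert.prems(1,4)) (use j in auto)
      finally show "(\<Sum>k\<in>J. c' j k * x k) \<in> S" .
    qed
    moreover have "x j0 \<in> S"
    proof -
      have S_add: "y + z \<in> S" if "y \<in> S" "z \<in> S" for y z
        using S(2)[OF that(1) S(2)[OF S(1) that(2)]] by simp
      have sum: "(\<Sum>k\<in>J. c j0 k * x k) \<in> S"
      proof -
        have "(\<Sum>k\<in>B. c j0 k * x k) \<in> S" if "B \<subseteq> J" for B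
          using finite_subset[OF that insert.hyps(1)] that
          by (induction B rule: finite_induct)
            (use S(1,3) S_add calculation insert.prems(1) in auto)
        then show ?thesis by blast
      qed
      have "c j0 j0 * x j0 = (\<Sum>k\<in>insert j0 J. c j0 k * x k) - (\<Sum>k\<in>J. c j0 k * x k)"
        using insert.hyps by simp
      also have "\<dots> \<in> S" using sum by (intro S(2) insert.prems(4)) auto
      finally show ?thesis using S(4)[of "c j0 j0"] insert.prems(1,2) by auto
    qed
    ultimately show ?case by simp
  qed
  then show ?thesis using assms by blast
qed

text \<open>If the family \<open>h\<close> represents linearly independent elements of the cotangent space of \<open>R\<close>
  localized at \<open>p\<close> and the family \<open>y\<close> generates it, then \<open>y\<close> is not shorter than \<open>h\<close>.\<close>

lemma card_le_generators:
  assumes "finite A" "finite B"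
    and h_R: "\<And>a. a \<in> A \<Longrightarrow> h a \<in> R"
    and h: "\<And>g. \<lbrakk>\<And>a. a \<in> A \<Longrightarrow> g a \<in> R; (\<Sum>a\<in>A. g a * h a) = 0\<rbrakk> \<Longrightarrow> \<forall>a\<in>A. g a \<in> p"
    and y: "\<And>b. b \<in> B \<Longrightarrow> \<exists>v\<in>R - p. \<exists>G. (\<forall>a\<in>A. G a \<in> R) \<and> v * y b = (\<Sum>a\<in>A. G a * h a)"
    and hy: "\<And>a. a \<in> A \<Longrightarrow> \<exists>u\<in>R - p. \<exists>C E. (\<forall>b\<in>B. C b \<in> R) \<and> (\<forall>a\<in>A. E a \<in> p)
        \<and> u * h a = (\<Sum>b\<in>B. C b * y b) + (\<Sum>a\<in>A. E a * h a)"
  shows "card A \<le> card B"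
proof (rule ccontr)
  assume "\<not> card A \<le> card B"
  then have card: "card B < card A" by simp
  have "\<forall>b\<in>B. \<exists>vG. fst vG \<in> R - p \<and> (\<forall>a\<in>A. snd vG a \<in> R) \<and> fst vG * y b = (\<Sum>a\<in>A. snd vG a * h a)"
  proof
    fix b assume "b \<in> B"
    from y[OF this] obtain v G where "v \<in> R - p" "\<forall>a\<in>A. G a \<in> R" "v * y b = (\<Sum>a\<in>A. G a * h a)"
      by blast
    then show "\<exists>vG. fst vG \<in> R - p \<and> (\<forall>a\<in>A. snd vG a \<in> R) \<and> fst vG * y b = (\<Sum>a\<in>A. snd vG a * h a)"
      by (intro exI[of _ "(v, G)"]) simp
  qed
  from bchoice[OF this] obtain vG where vG: "\<forall>b\<in>B. fst (vG b) \<in> R - p \<and> (\<forall>a\<in>A. snd (vG b) a \<in> R)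
      \<and> fst (vG b) * y b = (\<Sum>a\<in>A. snd (vG b) a * h a)"
    by (elim exE)
  define v G where "v b = fst (vG b)" and "G b = snd (vG b)" for b
  have v: "\<And>b. b \<in> B \<Longrightarrow> v b \<in> R - p"
    and G: "\<And>b a. \<lbrakk>b \<in> B; a \<in> A\<rbrakk> \<Longrightarrow> G b a \<in> R"
    and vy: "\<And>b. b \<in> B \<Longrightarrow> v b * y b = (\<Sum>a\<in>A. G b a * h a)"
    using vG by (simp_all add: v_def G_def)
  have "\<forall>a\<in>A. \<exists>uCE. fst uCE \<in> R - p \<and> (\<forall>b\<in>B. fst (snd uCE) b \<in> R) \<and> (\<forall>a\<in>A. snd (snd uCE) a \<in> p)
        \<and> fst uCE * h a = (\<Sum>b\<in>B. fst (snd uCE) b * y b) + (\<Sum>a\<in>A. snd (snd uCE) a * h a)"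
  proof
    fix a assume "a \<in> A"
    from hy[OF this] obtain u C E where "u \<in> R - p" "\<forall>b\<in>B. C b \<in> R" "\<forall>a\<in>A. E a \<in> p"
      "u * h a = (\<Sum>b\<in>B. C b * y b) + (\<Sum>a\<in>A. E a * h a)" by blast
    then show "\<exists>uCE. fst uCE \<in> R - p \<and> (\<forall>b\<in>B. fst (snd uCE) b \<in> R) \<and> (\<forall>a\<in>A. snd (snd uCE) a \<in> p)
        \<and> fst uCE * h a = (\<Sum>b\<in>B. fst (snd uCE) b * y b) + (\<Sum>a\<in>A. snd (snd uCE) a * h a)"
      by (intro exI[of _ "(u, C, E)"]) simp
  qed
  from bchoice[OF this] obtain uCE where uCE: "\<forall>a\<in>A. fst (uCE a) \<in> R - p \<and> (\<forall>b\<in>B. fst (snd (uCE a)) b \<in> R)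
        \<and> (\<forall>a'\<in>A. snd (snd (uCE a)) a' \<in> p)
        \<and> fst (uCE a) * h a = (\<Sum>b\<in>B. fst (snd (uCE a)) b * y b) + (\<Sum>a'\<in>A. snd (snd (uCE a)) a' * h a')"
    by (elim exE)
  define u C E where "u a = fst (uCE a)" and "C a = fst (snd (uCE a))" and "E a = snd (snd (uCE a))" for a
  have u: "\<And>a. a \<in> A \<Longrightarrow> u a \<in> R - p"
    and C: "\<And>b a. \<lbrakk>b \<in> B; a \<in> A\<rbrakk> \<Longrightarrow> C a b \<in> R"
    and E: "\<And>a a'. \<lbrakk>a \<in> A; a' \<in> A\<rbrakk> \<Longrightarrow> E a a' \<in> p"
    and uh: "\<And>a. a \<in> A \<Longrightarrow> u a * h a = (\<Sum>b\<in>B. C a b * y b) + (\<Sum>a'\<in>A. E a a' * h a')"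
    using uCE by (simp_all add: u_def C_def E_def)
  \<comment> \<open>If \<open>y\<close> were shorter than \<open>h\<close>, some combination
    \<open>w\<close> of the given equations, not zero modulo \<open>p\<close>, would have its
    coefficients at all \<open>y b\<close> in \<open>p\<close>. Writing the \<open>y b\<close> by
    \<open>h\<close> over the common denominator \<open>v'\<close> turns the right side into a
    combination of \<open>h\<close> with coefficients \<open>r a\<close> in \<open>p\<close>, and
    independence then forces every \<open>w a\<close> into \<open>p\<close>.\<close>
  obtain w where w: "\<And>a. a \<in> A \<Longrightarrow> w a \<in> R" "\<exists>a\<in>A. w a \<notin> p"
      "\<And>b. b \<in> B \<Longrightarrow> (\<Sum>a\<in>A. w a * C a b) \<in> p"
    using linear_system[OF assms(2,1) card, of C] C by metis
  define v' where "v' = (\<Prod>b\<in>B. v b)"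
  define G' where "G' b a = (\<Prod>b'\<in>B - {b}. v b') * G b a" for b a
  have G': "G' b a \<in> R" if "b \<in> B" "a \<in> A" for b a
    unfolding G'_def using v G that by (intro mult_closed prod_closed) auto
  have v'y: "v' * y b = (\<Sum>a\<in>A. G' b a * h a)" if "b \<in> B" for b
  proof -
    have "v' = (\<Prod>b'\<in>B - {b}. v b') * v b"
      unfolding v'_def using prod.remove[OF assms(2) that, of v] by (simp add: mult.commute)
    then have "v' * y b = (\<Prod>b'\<in>B - {b}. v b') * (v b * y b)" by (simp add: mult.assoc)
    then show ?thesis by (simp only: vy[OF that] G'_def sum_distrib_left mult.assoc)
  qed
  have v': "v' \<in> R - p" unfolding v'_def by (rule notin_prod) (rule v)
  define s where "s b = (\<Sum>a\<in>A. w a * C a b)" for b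
  define e where "e a' = (\<Sum>a\<in>A. w a * E a a')" for a'
  have e: "e a' \<in> p" if "a' \<in> A" for a'
    unfolding e_def using w E that by (intro p_sum p_mult) auto
  have s: "s b \<in> p" if "b \<in> B" for b
    unfolding s_def using w that by auto
  define r where "r a = (\<Sum>b\<in>B. s b * G' b a) + v' * e a" for a
  have r: "r a \<in> p" if "a \<in> A" for a
    unfolding r_def using s e G' v' that by (intro p_add p_sum p_mult_right p_mult) auto
  have "(\<Sum>a\<in>A. w a * (u a * h a)) = (\<Sum>b\<in>B. s b * y b) + (\<Sum>a'\<in>A. e a' * h a')"
  proof -
    have "(\<Sum>a\<in>A. w a * (u a * h a))
        = (\<Sum>a\<in>A. \<Sum>b\<in>B. w a * C a b * y b) + (\<Sum>a\<in>A. \<Sum>a'\<in>A. w a * E a a' * h a')"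
      by (simp add: uh distrib_left sum.distrib sum_distrib_left mult.assoc)
    also have "\<dots> = (\<Sum>b\<in>B. \<Sum>a\<in>A. w a * C a b * y b) + (\<Sum>a'\<in>A. \<Sum>a\<in>A. w a * E a a' * h a')"
      by (subst (1 2) sum.swap) simp
    finally show ?thesis by (simp add: s_def e_def sum_distrib_right)
  qed
  then have "(\<Sum>a\<in>A. v' * (w a * u a) * h a) = (\<Sum>b\<in>B. s b * (v' * y b)) + (\<Sum>a\<in>A. v' * e a * h a)"
    by (simp add: sum_distrib_left distrib_left algebra_simps flip: sum_distrib_left)
  also have "(\<Sum>b\<in>B. s b * (v' * y b)) = (\<Sum>b\<in>B. \<Sum>a\<in>A. s b * G' b a * h a)"
    by (simp add: v'y sum_distrib_left mult.assoc)
  also have "\<dots> = (\<Sum>a\<in>A. (\<Sum>b\<in>B. s b * G' b a) * h a)"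
    by (subst sum.swap) (simp add: sum_distrib_right)
  also have "\<dots> + (\<Sum>a\<in>A. v' * e a * h a) = (\<Sum>a\<in>A. r a * h a)"
    by (simp add: r_def distrib_right sum.distrib)
  finally have "(\<Sum>a\<in>A. (v' * (w a * u a) - r a) * h a) = 0"
    by (simp add: left_diff_distrib sum_subtractf)
  then have "\<forall>a\<in>A. v' * (w a * u a) - r a \<in> p"
    by (intro h) (use v' w u r in_R in \<open>auto intro!: diff_closed mult_closed\<close>)
  then have "v' * (w a * u a) \<in> p" if "a \<in> A" for a
    using p_add[OF _ r[OF that], of "v' * (w a * u a) - r a"] that by simp
  then have "w a \<in> p" if "a \<in> A" for a
    using p_prime[of v' "w a * u a"] p_prime[of "w a" "u a"] w(1) u v' that mult_closed by blast
  with w(2) show False by blast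
qed

text \<open>Gauss's argument: if neither factor has all coefficients in \<open>p\<close>, let
  \<open>i\<close> and \<open>j\<close> be the least indices of coefficients outside
  \<open>p\<close>. In the coefficient of the product at \<open>i + j\<close> all summands but one
  lie in \<open>p\<close>.\<close>

lemma prime_in_poly:
  "prime_in {F. \<forall>k. coeff F k \<in> R} {F. \<forall>k. coeff F k \<in> p}"
proof
  show "1 \<in> {F. \<forall>k. coeff F k \<in> R}" by (simp add: zero_closed one_closed)
  show "x - y \<in> {F. \<forall>k. coeff F k \<in> R}" "x * y \<in> {F. \<forall>k. coeff F k \<in> R}"
    if "x \<in> {F. \<forall>k. coeff F k \<in> R}" "y \<in> {F. \<forall>k. coeff F k \<in> R}" for x y
    using that by (auto intro: diff_closed coeff_mult_closed)
  show "{F. \<forall>k. coeff F k \<in> p} \<subseteq> {F. \<forall>k. coeff F k \<in> R}" using p_subset by auto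
  show "0 \<in> {F. \<forall>k. coeff F k \<in> p}" by (simp add: p_zero)
  show "x - y \<in> {F. \<forall>k. coeff F k \<in> p}"
    if "x \<in> {F. \<forall>k. coeff F k \<in> p}" "y \<in> {F. \<forall>k. coeff F k \<in> p}" for x y
    using that by (auto intro: p_diff)
  show "r * x \<in> {F. \<forall>k. coeff F k \<in> p}"
    if "r \<in> {F. \<forall>k. coeff F k \<in> R}" "x \<in> {F. \<forall>k. coeff F k \<in> p}" for r x
    using that by (auto simp: coeff_mult intro!: p_sum p_mult)
  show "1 \<notin> {F. \<forall>k. coeff F k \<in> p}"
    using p_one by (auto intro!: exI[of _ 0])
  fix F G :: "'r poly"
  assume F: "F \<in> {F. \<forall>k. coeff F k \<in> R}" and G: "G \<in> {F. \<forall>k. coeff F k \<in> R}"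
    and FG: "F * G \<in> {F. \<forall>k. coeff F k \<in> p}"
  show "F \<in> {F. \<forall>k. coeff F k \<in> p} \<or> G \<in> {F. \<forall>k. coeff F k \<in> p}"
  proof (rule ccontr)
    assume neg: "\<not> ?thesis"
    define i where "i = (LEAST i. coeff F i \<notin> p)"
    define j where "j = (LEAST j. coeff G j \<notin> p)"
    have i: "coeff F i \<notin> p" and j: "coeff G j \<notin> p"
      unfolding i_def j_def
      using neg LeastI_ex[of "\<lambda>i. coeff F i \<notin> p"] LeastI_ex[of "\<lambda>j. coeff G j \<notin> p"] by auto
    have less: "coeff F k \<in> p" if "k < i" for k using not_less_Least[OF that[unfolded i_def]] by simp
    have less': "coeff G k \<in> p" if "k < j" for k using not_less_Least[OF that[unfolded j_def]] by simp
    have "coeff (F * G) (i + j) = (\<Sum>k\<le>i + j. coeff F k * coeff G (i + j - k))"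
      by (simp add: coeff_mult)
    also have "\<dots> = coeff F i * coeff G j + (\<Sum>k\<in>{..i + j} - {i}. coeff F k * coeff G (i + j - k))"
      by (subst sum.remove[of _ i]) auto
    finally have eq: "coeff (F * G) (i + j)
      = coeff F i * coeff G j + (\<Sum>k\<in>{..i + j} - {i}. coeff F k * coeff G (i + j - k))" .
    have "(\<Sum>k\<in>{..i + j} - {i}. coeff F k * coeff G (i + j - k)) \<in> p"
    proof (rule p_sum)
      fix k assume k: "k \<in> {..i + j} - {i}"
      show "coeff F k * coeff G (i + j - k) \<in> p"
      proof (cases "k < i")
        case True
        then show ?thesis using less G by (intro p_mult_right) auto
      next
        case False
        then have "i + j - k < j" using k by auto
        then show ?thesis using less' F by (intro p_mult) auto
      qed
    qed
    then have "coeff F i * coeff G j \<in> p"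
      using FG p_add_iff eq by (metis (mono_tags, lifting) mem_Collect_eq)
    then show False using p_prime i j F G by blast
  qed
qed

end

text \<open>Most explicit primes below are preimages: along evaluation at a point, along
  \<open>const_part\<close>, and, together with \<open>prime_in_poly\<close>, along the
  homomorphisms into \<open>poly\<close> that record the weight or one indeterminate.\<close>

lemma prime_in_vimage:
  assumes "prime_in S q" "subring_of R"
    and "\<And>x. x \<in> R \<Longrightarrow> f x \<in> S" "f 1 = 1" "\<And>x y. f (x - y) = f x - f y" "\<And>x y. f (x * y) = f x * f y"
  shows "prime_in R {x \<in> R. f x \<in> q}"
proof -
  interpret q: prime_in S q by fact
  interpret subring_of R by fact
  have f0: "f 0 = 0" using assms(5)[of 0 0] by simp
  show ?thesis
    by unfold_locales
      (use assms(3-6) q.p_one q.p_prime in \<open>auto simp: f0 intro: closed q.p_zero q.p_diff q.p_mult\<close>)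
qed

lemma prime_in_Int:
  assumes "prime_in S q" "subring_of R" "R \<subseteq> S"
  shows "prime_in R (q \<inter> R)"
proof -
  have "q \<inter> R = {x \<in> R. x \<in> q}" by blast
  with prime_in_vimage[OF assms(1,2), of "\<lambda>x. x"] assms(3) show ?thesis by auto
qed

section \<open>Congruences modulo an ideal, and a prime over a proper ideal\<close>

context ideal_in
begin

lemma cong_mult:
  assumes "x \<in> R" "x' \<in> R" "y \<in> R" "y' \<in> R" "x - x' \<in> I" "y - y' \<in> I"
  shows "x * y - x' * y' \<in> I"
proof -
  have "x * y - x' * y' = y * (x - x') + x' * (y - y')" by (simp add: algebra_simps)
  then show ?thesis using assms by (simp only:) (intro I_add I_mult)
qed

lemma cong_power:
  assumes "x \<in> R" "x' \<in> R" "x - x' \<in> I"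
  shows "x ^ k - x' ^ k \<in> I"
proof (induction k)
  case (Suc k)
  then show ?case unfolding power_Suc using assms by (intro cong_mult power_closed)
qed (simp add: I_zero)

lemma cong_prod:
  assumes "\<And>a. a \<in> A \<Longrightarrow> x a \<in> R" "\<And>a. a \<in> A \<Longrightarrow> x' a \<in> R" "\<And>a. a \<in> A \<Longrightarrow> x a - x' a \<in> I"
  shows "(\<Prod>a\<in>A. x a) - (\<Prod>a\<in>A. x' a) \<in> I"
  using assms
proof (induction A rule: infinite_finite_induct)
  case (insert a A)
  have "x a * prod x A - x' a * prod x' A \<in> I"
    using insert by (intro cong_mult prod_closed) auto
  then show ?case using insert.hyps by simp
qed (simp_all add: I_zero)

text \<open>A maximal ideal over \<open>I\<close> by Zorn's lemma. The application is to an
  annihilator in \<open>K[a]\<close>: it yields a prime at which the elimination of indeterminates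
  is carried out.\<close>

lemma ex_prime_in:
  assumes "1 \<notin> I"
  shows "\<exists>p. prime_in R p \<and> I \<subseteq> p"
proof -
  define A where "A = {J. ideal_in R J \<and> I \<subseteq> J \<and> 1 \<notin> J}"
  have "I \<in> A" using assms ideal_in_axioms by (simp add: A_def)
  moreover have "\<Union>C \<in> A" if C: "C \<noteq> {}" "subset.chain A C" for C
  proof -
    have CA: "ideal_in R J" "I \<subseteq> J" "1 \<notin> J" if "J \<in> C" for J
      using C(2) that by (auto simp: subset.chain_def A_def)
    have "ideal_in R (\<Union>C)"
    proof (rule ideal_in.intro[OF subring_of_axioms], unfold_locales)
      show "\<Union>C \<subseteq> R" using CA ideal_in.I_subset by blast
      show "0 \<in> \<Union>C" using C(1) CA ideal_in.I_zero by blast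
      show "r * x \<in> \<Union>C" if "r \<in> R" "x \<in> \<Union>C" for r x
        using that CA ideal_in.I_mult by blast
      show "x - y \<in> \<Union>C" if xy: "x \<in> \<Union>C" "y \<in> \<Union>C" for x y
      proof -
        obtain J J' where J: "J \<in> C" "x \<in> J" "J' \<in> C" "y \<in> J'" using xy by blast
        then have "J \<subseteq> J' \<or> J' \<subseteq> J" using C(2) by (auto simp: subset.chain_def)
        then show ?thesis using J CA(1) ideal_in.I_diff by blast
      qed
    qed
    moreover have "I \<subseteq> \<Union>C" using C(1) CA(2) by blast
    ultimately show ?thesis using CA(3) by (auto simp: A_def)
  qed
  ultimately obtain M where M: "M \<in> A" "\<And>J. \<lbrakk>J \<in> A; M \<subseteq> J\<rbrakk> \<Longrightarrow> J = M"
    using subset_Zorn_nonempty[of A] by blast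
  interpret M: ideal_in R M using M(1) by (simp add: A_def)
  have one: "\<exists>a\<in>M. \<exists>r\<in>R. 1 = a + r * x" if x: "x \<in> R" "x \<notin> M" for x
  proof -
    define J where "J = {a + r * x | a r. a \<in> M \<and> r \<in> R}"
    have "ideal_in R J"
    proof (rule ideal_in.intro[OF subring_of_axioms], unfold_locales)
      show "J \<subseteq> R" unfolding J_def using x M.I_in_R by (auto intro!: closed)
      show "0 \<in> J" unfolding J_def using M.I_zero zero_closed by force
      show "y - z \<in> J" if yz: "y \<in> J" "z \<in> J" for y z
      proof -
        obtain a r b s where *: "y = a + r * x" "z = b + s * x" "a \<in> M" "r \<in> R" "b \<in> M" "s \<in> R"
          using yz unfolding J_def by blast
        then have "y - z = (a - b) + (r - s) * x" by (simp add: algebra_simps)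
        then show ?thesis unfolding J_def using * M.I_diff diff_closed by blast
      qed
      show "s * y \<in> J" if sy: "s \<in> R" "y \<in> J" for s y
      proof -
        obtain a r where *: "y = a + r * x" "a \<in> M" "r \<in> R" using sy unfolding J_def by blast
        then have "s * y = s * a + (s * r) * x" by (simp add: algebra_simps)
        then show ?thesis unfolding J_def using * sy M.I_mult mult_closed by blast
      qed
    qed
    moreover have MJ: "M \<subseteq> J" unfolding J_def using zero_closed by force
    moreover have "x \<in> J" unfolding J_def using M.I_zero one_closed by force
    ultimately have "J \<notin> A" using M(2)[of J] x by blast
    then have "1 \<in> J" using \<open>ideal_in R J\<close> MJ M(1) by (auto simp: A_def)
    then show ?thesis by (auto simp: J_def)
  qed
  have "prime_in R M"
  proof (intro prime_in.intro ideal_in.intro subring_of_axioms, unfold_locales)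
    show "M \<subseteq> R" "0 \<in> M" "1 \<notin> M" using M.I_subset M.I_zero M(1) by (auto simp: A_def)
    show "x - y \<in> M" if "x \<in> M" "y \<in> M" for x y using that by (rule M.I_diff)
    show "r * x \<in> M" if "r \<in> R" "x \<in> M" for r x using that by (rule M.I_mult)
    show "x \<in> M \<or> y \<in> M" if xy: "x \<in> R" "y \<in> R" "x * y \<in> M" for x y
    proof (rule ccontr)
      assume neg: "\<not> (x \<in> M \<or> y \<in> M)"
      obtain a r where ar: "a \<in> M" "r \<in> R" "1 = a + r * x" using one[of x] xy neg by blast
      obtain b s where bs: "b \<in> M" "s \<in> R" "1 = b + s * y" using one[of y] xy neg by blast
      have "1 = (a + r * x) * (b + s * y)" by (simp flip: ar(3) bs(3))
      also have "\<dots> = (b + s * y) * a + (r * x) * b + (r * s) * (x * y)" by (simp add: algebra_simps)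
      also have "\<dots> \<in> M"
        by (intro M.I_add M.I_mult[OF _ ar(1)] M.I_mult[OF _ bs(1)] M.I_mult[OF _ xy(3)])
          (use ar bs xy M.I_in_R in \<open>auto intro!: closed\<close>)
      finally show False using M(1) by (simp add: A_def)
    qed
  qed
  then show ?thesis using M(1) by (auto simp: A_def)
qed

end

section \<open>Evaluation of polynomials\<close>

abbreviation (input) keys where "keys \<equiv> Poly_Mapping.keys"

abbreviation (input) lookup where "lookup \<equiv> Poly_Mapping.lookup"

abbreviation (input) single where "single \<equiv> Poly_Mapping.single"

abbreviation polys :: "nat set \<Rightarrow> 'k::field mpoly set"
  where "polys V \<equiv> carrier (mpoly_ring V)"

lemma polys_iff: "f \<in> polys V \<longleftrightarrow> (\<forall>t\<in>keys f. keys t \<subseteq> V)"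
  by (simp add: mpoly_ring_def)

lemma mpoly_ring_simps:
  "x \<otimes>\<^bsub>mpoly_ring V\<^esub> y = x * y" "x \<oplus>\<^bsub>mpoly_ring V\<^esub> y = x + y"
  "\<one>\<^bsub>mpoly_ring V\<^esub> = 1" "\<zero>\<^bsub>mpoly_ring V\<^esub> = 0"
  by (simp_all add: mpoly_ring_def)

lemma mpoly_ring_uminus:
  assumes "x \<in> polys V"
  shows "\<ominus>\<^bsub>mpoly_ring V\<^esub> x = - x"
proof -
  interpret cring "mpoly_ring V :: 'a mpoly ring" by (rule cring_mpoly_ring)
  have "\<ominus>\<^bsub>mpoly_ring V\<^esub> x \<oplus>\<^bsub>mpoly_ring V\<^esub> x = \<zero>\<^bsub>mpoly_ring V\<^esub>" using assms by (rule l_neg)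
  then show ?thesis by (simp add: mpoly_ring_simps eq_neg_iff_add_eq_0)
qed

lemma mpoly_ring_diff:
  assumes "x \<in> polys V" "y \<in> polys V"
  shows "x \<ominus>\<^bsub>mpoly_ring V\<^esub> y = x - y"
  using assms by (simp add: a_minus_def mpoly_ring_uminus mpoly_ring_simps)

lemma subring_of_polys: "subring_of (polys V :: 'k::field mpoly set)"
proof
  interpret cring "mpoly_ring V :: 'k mpoly ring" by (rule cring_mpoly_ring)
  show "1 \<in> (polys V :: 'k mpoly set)" using one_closed by (simp add: mpoly_ring_simps)
  fix x y :: "'k mpoly" assume xy: "x \<in> polys V" "y \<in> polys V"
  show "x * y \<in> polys V" using m_closed[OF xy] by (simp add: mpoly_ring_simps)
  show "x - y \<in> polys V" using minus_closed[OF xy] mpoly_ring_diff[OF xy] by simp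
qed

lemmas polys_closed = subring_of.closed[OF subring_of_polys]

lemma prime_in_polys_iff: "prime_in (polys V) p \<longleftrightarrow> primeideal p (mpoly_ring V)"
proof
  assume "primeideal p (mpoly_ring V)"
  then interpret primeideal p "mpoly_ring V" .
  interpret subring_of "polys V" by (rule subring_of_polys)
  show "prime_in (polys V) p"
  proof
    show "p \<subseteq> polys V" by (rule a_subset)
    show "0 \<in> p" using additive_subgroup.zero_closed[OF additive_subgroup_axioms] by (simp add: mpoly_ring_simps)
    show "x - y \<in> p" if "x \<in> p" "y \<in> p" for x y
    proof -
      have "x \<ominus>\<^bsub>mpoly_ring V\<^esub> y \<in> p"
        using that unfolding a_minus_def
        by (intro additive_subgroup.a_closed additive_subgroup.a_inv_closed additive_subgroup_axioms)
      then show ?thesis using mpoly_ring_diff[OF a_Hcarr[OF that(1)] a_Hcarr[OF that(2)]] by simp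
    qed
    show "r * x \<in> p" if "r \<in> polys V" "x \<in> p" for r x
      using I_l_closed[OF that(2,1)] by (simp add: mpoly_ring_simps)
    show "1 \<notin> p" using one_imp_carrier I_notcarr by (auto simp: mpoly_ring_simps)
    show "x \<in> p \<or> y \<in> p" if "x \<in> polys V" "y \<in> polys V" "x * y \<in> p" for x y
      using I_prime[OF that(1,2)] that(3) by (simp add: mpoly_ring_simps)
  qed
next
  assume "prime_in (polys V) p"
  then interpret prime_in "polys V" p .
  interpret P: cring "mpoly_ring V" by (rule cring_mpoly_ring)
  show "primeideal p (mpoly_ring V)"
  proof (rule primeidealI)
    show "ideal p (mpoly_ring V)"
    proof (rule idealI)
      show "ring (mpoly_ring V)" by (rule P.ring_axioms)
      show "subgroup p (add_monoid (mpoly_ring V))"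
      proof (rule P.add.subgroupI)
        show "p \<subseteq> polys V" "p \<noteq> {}" using p_subset p_zero by auto
        show "\<ominus>\<^bsub>mpoly_ring V\<^esub> a \<in> p" if "a \<in> p" for a
          using that p_uminus in_R by (simp add: mpoly_ring_uminus)
        show "a \<oplus>\<^bsub>mpoly_ring V\<^esub> b \<in> p" if "a \<in> p" "b \<in> p" for a b
          using that p_add by (simp add: mpoly_ring_simps)
      qed
      show "x \<otimes>\<^bsub>mpoly_ring V\<^esub> a \<in> p" "a \<otimes>\<^bsub>mpoly_ring V\<^esub> x \<in> p"
        if "a \<in> p" "x \<in> polys V" for a x
        using that p_mult p_mult_right by (simp_all add: mpoly_ring_simps)
    qed
    show "cring (mpoly_ring V)" by (rule P.cring_axioms)
    show "polys V \<noteq> p" using p_one one_closed by blast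
    show "a \<in> p \<or> b \<in> p" if "a \<in> polys V" "b \<in> polys V" "a \<otimes>\<^bsub>mpoly_ring V\<^esub> b \<in> p" for a b
      using that p_prime by (simp add: mpoly_ring_simps)
  qed
qed

lemma polys_mono: "U \<subseteq> V \<Longrightarrow> polys U \<subseteq> polys V"
  unfolding polys_iff subset_iff by blast

lemma const_in_polys [simp]: "mpoly_const c \<in> polys V"
  by (auto simp: polys_iff mpoly_const_def)

lemma var_in_polys_iff [simp]: "(mpoly_var i :: 'k::field mpoly) \<in> polys V \<longleftrightarrow> i \<in> V"
  by (auto simp: polys_iff mpoly_var_def)

lemma single_in_polys: "keys t \<subseteq> V \<Longrightarrow> single t c \<in> polys V"
  by (auto simp: polys_iff split: if_splits)

text \<open>The coefficient map is a parameter so that one evaluation covers substitutions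
  (\<open>mpoly_const\<close>), values in the field (the identity) and homomorphisms into univariate
  polynomials over \<open>mpoly\<close> (\<open>[:mpoly_const c:]\<close>).\<close>

locale coeff_hom =
  fixes \<kappa> :: "'k::field \<Rightarrow> 'r::comm_ring_1"
  assumes coeff_hom_zero: "\<kappa> 0 = 0"
    and coeff_hom_one: "\<kappa> 1 = 1"
    and coeff_hom_add: "\<kappa> (a + b) = \<kappa> a + \<kappa> b"
    and coeff_hom_mult: "\<kappa> (a * b) = \<kappa> a * \<kappa> b"

definition mp_eval :: "('k::field \<Rightarrow> 'r::comm_ring_1) \<Rightarrow> (nat \<Rightarrow> 'r) \<Rightarrow> 'k mpoly \<Rightarrow> 'r"
  where "mp_eval \<kappa> \<xi> f = (\<Sum>t\<in>keys f.
    \<kappa> (lookup f t) * (\<Prod>i\<in>keys t. \<xi> i ^ lookup t i))"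

lemma mpoly_subst_eq_mp_eval: "mpoly_subst = mp_eval mpoly_const"
  by (intro ext) (simp add: mpoly_subst_def mp_eval_def)

lemma poly_mapping_sum_monomials:
  fixes f :: "'a \<Rightarrow>\<^sub>0 'b::comm_monoid_add"
  shows "(\<Sum>t\<in>keys f. single t (lookup f t)) = f"
  by (rule poly_mapping_eqI)
    (simp add: lookup_sum lookup_single when_def in_keys_iff)

lemma prod_keys_superset:
  fixes \<xi> :: "'i \<Rightarrow> 'r::comm_ring_1"
  assumes "finite A" "keys t \<subseteq> A"
  shows "(\<Prod>i\<in>keys t. \<xi> i ^ lookup t i) = (\<Prod>i\<in>A. \<xi> i ^ lookup t i)"
  using assms by (intro prod.mono_neutral_left) (auto simp: in_keys_iff)

lemma prod_keys_add:
  fixes \<xi> :: "'i \<Rightarrow> 'r::comm_ring_1"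
  shows "(\<Prod>i\<in>keys (s + t). \<xi> i ^ lookup (s + t) i)
    = (\<Prod>i\<in>keys s. \<xi> i ^ lookup s i)
      * (\<Prod>i\<in>keys t. \<xi> i ^ lookup t i)"
proof -
  let ?A = "keys s \<union> keys t"
  have "keys (s + t) \<subseteq> ?A" by (rule Poly_Mapping.keys_add)
  then have "(\<Prod>i\<in>keys (s + t). \<xi> i ^ lookup (s + t) i)
      = (\<Prod>i\<in>?A. \<xi> i ^ lookup (s + t) i)"
    by (intro prod_keys_superset) auto
  moreover have "(\<Prod>i\<in>keys s. \<xi> i ^ lookup s i) = (\<Prod>i\<in>?A. \<xi> i ^ lookup s i)"
    by (intro prod_keys_superset) auto
  moreover have "(\<Prod>i\<in>keys t. \<xi> i ^ lookup t i) = (\<Prod>i\<in>?A. \<xi> i ^ lookup t i)"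
    by (intro prod_keys_superset) auto
  ultimately show ?thesis by (simp add: lookup_add power_add prod.distrib)
qed

context coeff_hom
begin

lemma mp_eval_superset:
  assumes "finite A" "keys f \<subseteq> A"
  shows "mp_eval \<kappa> \<xi> f = (\<Sum>t\<in>A.
    \<kappa> (lookup f t) * (\<Prod>i\<in>keys t. \<xi> i ^ lookup t i))"
  unfolding mp_eval_def using assms
  by (intro sum.mono_neutral_left) (auto simp: in_keys_iff coeff_hom_zero)

lemma mp_eval_single: "mp_eval \<kappa> \<xi> (single t c)
  = \<kappa> c * (\<Prod>i\<in>keys t. \<xi> i ^ lookup t i)"
  by (subst mp_eval_superset[of "{t}"]) auto

lemma mp_eval_zero: "mp_eval \<kappa> \<xi> 0 = 0"
  by (simp add: mp_eval_def)

lemma mp_eval_add: "mp_eval \<kappa> \<xi> (f + g) = mp_eval \<kappa> \<xi> f + mp_eval \<kappa> \<xi> g"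
proof -
  let ?A = "keys f \<union> keys g"
  have "keys (f + g) \<subseteq> ?A" by (rule Poly_Mapping.keys_add)
  then show ?thesis
    by (simp add: mp_eval_superset[of ?A] lookup_add coeff_hom_add distrib_right sum.distrib)
qed

lemma mp_eval_sum: "mp_eval \<kappa> \<xi> (\<Sum>a\<in>A. f a) = (\<Sum>a\<in>A. mp_eval \<kappa> \<xi> (f a))"
  by (induction A rule: infinite_finite_induct) (auto simp: mp_eval_zero mp_eval_add)

lemma mp_eval_mult: "mp_eval \<kappa> \<xi> (f * g) = mp_eval \<kappa> \<xi> f * mp_eval \<kappa> \<xi> g"
proof -
  have single: "mp_eval \<kappa> \<xi> (single s a * single t b)
    = mp_eval \<kappa> \<xi> (single s a) * mp_eval \<kappa> \<xi> (single t b)" for s t a b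
    unfolding mult_single mp_eval_single prod_keys_add coeff_hom_mult by (simp add: mult_ac)
  have f: "f = (\<Sum>t\<in>keys f. single t (lookup f t))"
    and g: "g = (\<Sum>t\<in>keys g. single t (lookup g t))"
    by (simp_all add: poly_mapping_sum_monomials)
  show ?thesis
    by (subst f, subst g, subst (2) f, subst (2) g) (simp only: sum_product mp_eval_sum single)
qed

lemma mp_eval_const: "mp_eval \<kappa> \<xi> (mpoly_const c) = \<kappa> c"
  by (simp add: mpoly_const_def mp_eval_single)

lemma mp_eval_var: "mp_eval \<kappa> \<xi> (mpoly_var i) = \<xi> i"
  by (simp add: mpoly_var_def mp_eval_single coeff_hom_one)

lemma mp_eval_one: "mp_eval \<kappa> \<xi> 1 = 1"
  using mp_eval_const[of \<xi> 1] by (simp add: mpoly_const_def coeff_hom_one)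

lemma mp_eval_diff: "mp_eval \<kappa> \<xi> (f - g) = mp_eval \<kappa> \<xi> f - mp_eval \<kappa> \<xi> g"
  using mp_eval_add[of \<xi> "f - g" g] by (simp add: algebra_simps)

lemma mp_eval_power: "mp_eval \<kappa> \<xi> (f ^ k) = mp_eval \<kappa> \<xi> f ^ k"
  by (induction k) (auto simp: mp_eval_one mp_eval_mult)

lemmas mp_eval_simps = mp_eval_zero mp_eval_one mp_eval_add mp_eval_diff mp_eval_mult mp_eval_power
  mp_eval_sum mp_eval_const mp_eval_var

lemma mp_eval_closed:
  assumes "subring_of R" "f \<in> polys V" "\<And>c. \<kappa> c \<in> R" "\<And>i. i \<in> V \<Longrightarrow> \<xi> i \<in> R"
  shows "mp_eval \<kappa> \<xi> f \<in> R"
  unfolding mp_eval_def using assms(2-4)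
  by (intro subring_of.closed[OF assms(1)]) (auto simp: polys_iff)

end

lemma mpoly_const_add: "mpoly_const (a + b) = mpoly_const a + mpoly_const b"
  and mpoly_const_mult: "mpoly_const (a * b) = mpoly_const a * mpoly_const b"
  and mpoly_const_zero: "mpoly_const 0 = 0" and mpoly_const_one: "mpoly_const 1 = 1"
  by (simp_all add: mpoly_const_def single_add mult_single)

lemma mpoly_const_eq_0_iff: "mpoly_const c = 0 \<longleftrightarrow> c = 0"
  by (metis lookup_single_eq mpoly_const_def mpoly_const_zero)

interpretation const: coeff_hom mpoly_const
  by unfold_locales (simp_all add: mpoly_const_add mpoly_const_mult mpoly_const_zero mpoly_const_one)

interpretation constp: coeff_hom "\<lambda>c. [:mpoly_const c:]"
  by unfold_locales (simp_all add: mpoly_const_add mpoly_const_mult mpoly_const_zero mpoly_const_one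
    one_pCons)

interpretation field_id: coeff_hom "\<lambda>c::'k::field. c"
  by unfold_locales simp_all

lemma mpoly_var_power: "mpoly_var i ^ k = single (single i k) 1"
  by (induction k) (simp_all add: mpoly_var_def mult_single single_add[symmetric])

lemma single_eq_prod:
  fixes c :: "'k::field"
  shows "single t c
  = mpoly_const c * (\<Prod>i\<in>keys t. mpoly_var i ^ lookup t i)"
proof -
  have "(\<Prod>i\<in>A. mpoly_var i ^ lookup t i :: 'k mpoly)
    = single (\<Sum>i\<in>A. single i (lookup t i)) 1" for A
    by (induction A rule: infinite_finite_induct)
      (auto simp: mpoly_var_power mult_single)
  from this[of "keys t"] show ?thesis
    by (simp add: poly_mapping_sum_monomials mpoly_const_def mult_single)
qed

text \<open>Identities between homomorphisms and membership in subrings are thereby reduced to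
  constants and indeterminates, without a decomposition into monomials each time.\<close>

lemma polys_induct [consumes 1, case_names const var add mult]:
  assumes "f \<in> polys V"
    and const: "\<And>c. Q (mpoly_const c)"
    and var: "\<And>i. i \<in> V \<Longrightarrow> Q (mpoly_var i)"
    and add: "\<And>f g. \<lbrakk>f \<in> polys V; g \<in> polys V; Q f; Q g\<rbrakk> \<Longrightarrow> Q (f + g)"
    and mult: "\<And>f g. \<lbrakk>f \<in> polys V; g \<in> polys V; Q f; Q g\<rbrakk> \<Longrightarrow> Q (f * g)"
  shows "Q f"
proof -
  have Q1: "Q 1" using const[of 1] by (simp add: mpoly_const_one)
  have Q0: "Q 0" using const[of 0] by (simp add: mpoly_const_zero)
  have pow: "Q (mpoly_var i ^ k)" if "i \<in> V" for i k
    by (induction k) (use that Q1 var in \<open>auto intro!: mult polys_closed\<close>)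
  have prod: "Q (\<Prod>i\<in>A. mpoly_var i ^ lookup t i)" if "A \<subseteq> V" for A t
    using that
  proof (induction A rule: infinite_finite_induct)
    case (insert i A)
    then show ?case by (auto intro!: mult pow polys_closed)
  qed (use Q1 in auto)
  have "Q (\<Sum>t\<in>A. single t (lookup f t))" if "A \<subseteq> keys f" for A
    using that
  proof (induction A rule: infinite_finite_induct)
    case (insert t A)
    have t: "keys t \<subseteq> V" using insert assms(1) by (auto simp: polys_iff)
    have "Q (single t (lookup f t))"
      unfolding single_eq_prod using t by (intro mult const prod) (auto intro!: polys_closed)
    moreover have "(\<Sum>t\<in>A. single t (lookup f t)) \<in> polys V"
      using insert assms(1) by (intro polys_closed single_in_polys) (auto simp: polys_iff)
    ultimately show ?case using insert t by (auto intro!: add single_in_polys)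
  qed (use Q0 in auto)
  from this[OF order_refl] show ?thesis by (simp add: poly_mapping_sum_monomials)
qed

lemma mem_polys_UNIV: "f \<in> polys UNIV"
  by (simp add: polys_iff)

lemmas mpoly_induct = polys_induct[OF mem_polys_UNIV, simplified, case_names const var add mult]

lemma polys_empty: "f \<in> polys {} \<Longrightarrow> \<exists>c. f = mpoly_const c"
  by (induction rule: polys_induct) (auto simp flip: mpoly_const_add mpoly_const_mult)

lemma prime_in_polys_const:
  assumes "prime_in (polys V) p" "mpoly_const c \<in> p"
  shows "c = 0"
proof (rule ccontr)
  assume "c \<noteq> 0"
  interpret prime_in "polys V" p by fact
  have "mpoly_const (inverse c) * mpoly_const c \<in> p" using assms(2) by (intro p_mult) auto
  then show False
    using \<open>c \<noteq> 0\<close> p_one by (simp add: mpoly_const_one flip: mpoly_const_mult)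
qed

lemma prime_in_polys_Int_const:
  assumes "prime_in (polys V) p"
  shows "p \<inter> polys {} \<subseteq> {0}"
  using polys_empty prime_in_polys_const[OF assms] by (fastforce simp: mpoly_const_zero)

lemma mp_eval_const_id:
  assumes "f \<in> polys V" "\<And>i. i \<in> V \<Longrightarrow> \<xi> i = mpoly_var i"
  shows "mp_eval mpoly_const \<xi> f = f"
  using assms(1) by (induction rule: polys_induct) (auto simp: const.mp_eval_simps assms(2))

section \<open>Polynomials in one distinguished indeterminate\<close>

definition univariate :: "nat \<Rightarrow> 'k::field mpoly \<Rightarrow> 'k mpoly poly"
  where "univariate z = mp_eval (\<lambda>c. [:mpoly_const c:]) (\<lambda>i. if i = z then [:0, 1:] else [:mpoly_var i:])"

lemma univariate_simps:
  "univariate z 0 = 0" "univariate z 1 = 1" "univariate z (f + g) = univariate z f + univariate z g"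
  "univariate z (f - g) = univariate z f - univariate z g"
  "univariate z (f * g) = univariate z f * univariate z g"
  "univariate z (f ^ k) = univariate z f ^ k"
  "univariate z (\<Sum>a\<in>A. F a) = (\<Sum>a\<in>A. univariate z (F a))"
  "univariate z (mpoly_const c) = [:mpoly_const c:]"
  "univariate z (mpoly_var i) = (if i = z then [:0, 1:] else [:mpoly_var i:])"
  by (simp_all add: univariate_def constp.mp_eval_simps)

lemma univariate_const:
  assumes "f \<in> polys V" "z \<notin> V"
  shows "univariate z f = [:f:]"
  using assms(1)
  by (induction rule: polys_induct)
    (use assms(2) in \<open>auto simp: univariate_simps\<close>)

lemma poly_univariate: "poly (univariate z f) (mpoly_var z) = f"
  by (induction f rule: mpoly_induct) (auto simp: univariate_simps)

lemma univariate_eq_0_iff: "univariate z f = 0 \<longleftrightarrow> f = 0"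
  using poly_univariate[of z f] by (auto simp: univariate_simps)

lemma coeff_univariate:
  assumes "f \<in> polys (insert z V)" "z \<notin> V"
  shows "coeff (univariate z f) k \<in> polys V"
proof -
  interpret subring_of "polys V" by (rule subring_of_polys)
  have "\<forall>k. coeff (univariate z f) k \<in> polys V" using assms(1)
  proof (induction rule: polys_induct)
    case (var i)
    then show ?case using closed(1,2)
      by (auto simp: univariate_simps coeff_pCons split: nat.splits)
  qed (auto simp: univariate_simps coeff_pCons closed(1,4) coeff_mult_closed split: nat.splits)
  then show ?thesis by blast
qed

lemma poly_in_polys:
  assumes "\<And>k. coeff F k \<in> polys V" "z \<in> V"
  shows "poly F (mpoly_var z) \<in> polys V"
  unfolding poly_altdef using assms by (intro polys_closed) auto

section \<open>Chains of prime ideals in polynomial rings\<close>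

text \<open>Exponents are bounded one by one, not in total: the number of these power products is
  then exactly a power of \<open>k + 1\<close>, and the bounds add up under multiplication of
  polynomials.\<close>

definition box :: "nat set \<Rightarrow> nat \<Rightarrow> (nat \<Rightarrow>\<^sub>0 nat) set"
  where "box V k = {t. keys t \<subseteq> V \<and> (\<forall>i. lookup t i \<le> k)}"

lemma bij_betw_box:
  assumes "finite V"
  shows "bij_betw (\<lambda>t. restrict (lookup t) V) (box V k) (PiE V (\<lambda>_. {..k}))"
proof (rule bij_betwI[where g = "\<lambda>g. Abs_poly_mapping (\<lambda>i. if i \<in> V then g i else 0)"])
  have lookup: "lookup (Abs_poly_mapping (\<lambda>i. if i \<in> V then g i else 0))
      = (\<lambda>i. if i \<in> V then g i else 0)" for g :: "nat \<Rightarrow> nat"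
    using assms by (intro lookup_Abs_poly_mapping) (auto elim: rev_finite_subset)
  show "(\<lambda>t. restrict (lookup t) V) \<in> box V k \<rightarrow> PiE V (\<lambda>_. {..k})"
    by (auto simp: box_def)
  show "(\<lambda>g. Abs_poly_mapping (\<lambda>i. if i \<in> V then g i else 0)) \<in> PiE V (\<lambda>_. {..k}) \<rightarrow> box V k"
    by (auto simp: box_def lookup in_keys_iff split: if_splits)
  show "Abs_poly_mapping (\<lambda>i. if i \<in> V then restrict (lookup t) V i else 0) = t"
    if "t \<in> box V k" for t
    using that by (intro poly_mapping_eqI) (auto simp: lookup box_def in_keys_iff)
  show "restrict (lookup (Abs_poly_mapping (\<lambda>i. if i \<in> V then g i else 0))) V = g"
    if "g \<in> PiE V (\<lambda>_. {..k})" for g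
    using that by (auto simp: lookup fun_eq_iff PiE_def extensional_def)
qed

lemma finite_box: "finite V \<Longrightarrow> finite (box V k)"
  and card_box: "finite V \<Longrightarrow> card (box V k) = (k + 1) ^ card V"
  using bij_betw_finite[OF bij_betw_box] bij_betw_same_card[OF bij_betw_box, of V k]
  by (simp_all add: finite_PiE card_PiE)

definition box_polys :: "nat set \<Rightarrow> nat \<Rightarrow> 'k::field mpoly set"
  where "box_polys V k = {f. keys f \<subseteq> box V k}"

lemma box_polys_mono: "k \<le> l \<Longrightarrow> box_polys V k \<subseteq> box_polys V l"
  unfolding box_polys_def box_def subset_iff mem_Collect_eq by (meson order_trans)

lemma box_polys_one: "1 \<in> box_polys V k"
  by (auto simp: box_polys_def box_def)

lemma box_polys_mult:
  assumes "f \<in> box_polys V k" "g \<in> box_polys V l"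
  shows "f * g \<in> box_polys V (k + l)"
  unfolding box_polys_def
proof clarify
  fix t assume "t \<in> keys (f * g)"
  then obtain u v where t: "t = u + v" and "u \<in> keys f" "v \<in> keys g"
    using keys_mult[of f g] by blast
  then have uv: "u \<in> box V k" "v \<in> box V l" using assms by (auto simp: box_polys_def)
  then show "t \<in> box V (k + l)"
    unfolding t box_def using Poly_Mapping.keys_add[of u v]
    by (auto simp: box_def lookup_add intro: add_mono)
qed

lemma box_polys_power: "f \<in> box_polys V k \<Longrightarrow> f ^ n \<in> box_polys V (n * k)"
  by (induction n) (auto simp: box_polys_one intro: box_polys_mult)

lemma box_polys_prod:
  assumes "finite A" "\<And>a. a \<in> A \<Longrightarrow> f a \<in> box_polys V k"
  shows "(\<Prod>a\<in>A. f a) \<in> box_polys V (card A * k)"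
  using assms by (induction A rule: finite_induct) (auto simp: box_polys_one intro: box_polys_mult)

lemma ex_box_polys:
  assumes "f \<in> polys V"
  shows "\<exists>k. f \<in> box_polys V k"
proof -
  define k where "k = Max (insert 0 (\<Union>t\<in>keys f. lookup t ` keys t))"
  have "lookup t i \<le> k" if "t \<in> keys f" for t i
  proof (cases "i \<in> keys t")
    case True
    then show ?thesis unfolding k_def using that by (intro Max_ge) auto
  qed (simp add: in_keys_iff)
  then show ?thesis using assms by (intro exI[of _ k]) (auto simp: box_polys_def box_def polys_iff)
qed

lemma prime_in_zero: "prime_in UNIV {0 :: 'r::idom}"
  by unfold_locales auto

lemma lookup_const_mult: "lookup (mpoly_const c * f) t = c * lookup f t"
proof -
  have "mpoly_const c * f = Poly_Mapping.map ((*) c) f"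
    by (simp add: mpoly_const_def mult_map_scale_conv_mult)
  then show ?thesis by (simp add: map.rep_eq when_def)
qed

text \<open>The quotients \<open>b i / g\<close> are algebraically dependent because, for large \<open>k\<close>, there are more monomials
  of degree at most \<open>k\<close> in each quotient than possible exponents of the resulting numerators.\<close>

lemma algebraic_dependence:
  fixes b :: "nat \<Rightarrow> 'k::field mpoly"
  assumes "finite V" "finite A" "card V < card A"
    and "\<And>i. i \<in> A \<Longrightarrow> b i \<in> polys V" "g \<in> polys V"
  shows "\<exists>k q. q \<noteq> 0 \<and> q \<in> polys A \<and> (\<forall>t\<in>keys q. \<forall>i. lookup t i \<le> k) \<and>
    (\<Sum>t\<in>keys q. mpoly_const (lookup q t)
      * (\<Prod>i\<in>A. b i ^ lookup t i * g ^ (k - lookup t i))) = 0"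
proof -
  have "\<exists>D. \<forall>i\<in>insert g (b ` A). i \<in> box_polys V D"
  proof -
    have "\<forall>i\<in>insert g (b ` A). \<exists>k. i \<in> box_polys V k" using assms ex_box_polys by blast
    from bchoice[OF this] obtain K where K: "\<forall>i\<in>insert g (b ` A). i \<in> box_polys V (K i)" ..
    have "i \<in> box_polys V (Max (K ` insert g (b ` A)))" if "i \<in> insert g (b ` A)" for i
    proof -
      have "K i \<le> Max (K ` insert g (b ` A))" using assms(2) that by (intro Max_ge) auto
      then show ?thesis using K that box_polys_mono by blast
    qed
    then show ?thesis by blast
  qed
  then obtain D where D: "g \<in> box_polys V D" "\<And>i. i \<in> A \<Longrightarrow> b i \<in> box_polys V D" by auto
  \<comment> \<open>A product over \<open>A\<close> of factors with exponents at most
    \<open>k * D\<close> has exponents at most \<open>k * C\<close>. The choice of \<open>k\<close>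
    makes \<open>((C + 1) * (k + 1)) ^ card V\<close> equal to \<open>k * (k + 1) ^ card V\<close>,
    which is less than \<open>(k + 1) ^ card A\<close>: fewer equations than unknowns.\<close>
  define C where "C = card A * D"
  define k where "k = (C + 1) ^ card V"
  define y where "y t = (\<Prod>i\<in>A. b i ^ lookup t i * g ^ (k - lookup t i))"
    for t :: "nat \<Rightarrow>\<^sub>0 nat"
  have y: "y t \<in> box_polys V (k * C)" if "t \<in> box A k" for t
  proof -
    have "b i ^ lookup t i * g ^ (k - lookup t i) \<in> box_polys V (k * D)"
      if "i \<in> A" for i
    proof -
      have "lookup t i \<le> k" using \<open>t \<in> box A k\<close> by (simp add: box_def)
      then have "k * D = lookup t i * D + (k - lookup t i) * D"
        by (simp add: add_mult_distrib[symmetric])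
      then show ?thesis using D that by (auto intro!: box_polys_mult box_polys_power)
    qed
    from box_polys_prod[OF assms(2) this] show ?thesis
      unfolding y_def C_def by (simp add: mult.left_commute)
  qed
  have "(k * C + 1) ^ card V \<le> ((C + 1) * (k + 1)) ^ card V"
    by (intro power_mono) auto
  also have "\<dots> = k * (k + 1) ^ card V" by (simp only: power_mult_distrib k_def)
  also have "\<dots> < (k + 1) ^ Suc (card V)" by simp
  also have "\<dots> \<le> (k + 1) ^ card A" using assms(3) by (intro power_increasing) auto
  finally have "card (box V (k * C)) < card (box A k)" using assms by (simp add: card_box)
  \<comment> \<open>The domain is the coefficient field with the prime \<open>{0}\<close>. The
    unknowns are the coefficients \<open>w t\<close> of the relation, and every power product
    \<open>s\<close> that can occur in the numerators \<open>y t\<close> gives one equation.\<close>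
  from prime_in.linear_system[OF prime_in_zero finite_box[OF assms(1)] finite_box[OF assms(2)] this,
      of "\<lambda>t. lookup (y t)"]
  obtain w where w: "\<exists>t\<in>box A k. w t \<noteq> 0"
    "\<And>s. s \<in> box V (k * C) \<Longrightarrow> (\<Sum>t\<in>box A k. w t * lookup (y t) s) = 0"
    by auto
  define q where "q = (\<Sum>t\<in>box A k. single t (w t))"
  have lookup_q: "lookup q t = (if t \<in> box A k then w t else 0)" for t
    unfolding q_def lookup_sum lookup_single when_def using finite_box[OF assms(2)] by simp
  have keys_q: "keys q \<subseteq> box A k"
    by (auto simp: in_keys_iff lookup_q split: if_splits)
  have "(\<Sum>t\<in>keys q. mpoly_const (lookup q t) * y t)
      = (\<Sum>t\<in>box A k. mpoly_const (w t) * y t)"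
    using keys_q finite_box[OF assms(2)]
    by (intro sum.mono_neutral_cong_left) (auto simp: in_keys_iff lookup_q mpoly_const_zero)
  also have "\<dots> = 0"
  proof (rule poly_mapping_eqI)
    fix s
    have "lookup (\<Sum>t\<in>box A k. mpoly_const (w t) * y t) s
        = (\<Sum>t\<in>box A k. w t * lookup (y t) s)"
      by (simp add: lookup_sum lookup_const_mult)
    also have "\<dots> = 0"
    proof (cases "s \<in> box V (k * C)")
      case False
      then have "lookup (y t) s = 0" if "t \<in> box A k" for t
        using y[OF that] by (auto simp: box_polys_def in_keys_iff)
      then show ?thesis by simp
    qed (rule w(2))
    finally show "lookup (\<Sum>t\<in>box A k. mpoly_const (w t) * y t) s
      = lookup 0 s" by simp
  qed
  finally have "(\<Sum>t\<in>keys q. mpoly_const (lookup q t) * y t) = 0" .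
  moreover have "q \<noteq> 0" using w(1) lookup_q by (metis lookup_zero)
  moreover have "q \<in> polys A" using keys_q by (auto simp: polys_iff box_def)
  ultimately show ?thesis
    using keys_q unfolding y_def by (intro exI[of _ k] exI[of _ q]) (auto simp: box_def)
qed

definition prime_chain :: "'r::comm_ring_1 set \<Rightarrow> (nat \<Rightarrow> 'r set) \<Rightarrow> nat \<Rightarrow> bool"
  where "prime_chain R p l \<longleftrightarrow> (\<forall>i\<le>l. prime_in R (p i)) \<and> (\<forall>i<l. p i \<subset> p (Suc i))"

text \<open>Every step of the chain eliminates one indeterminate: divide \<open>q\<close> by the largest possible power
  of \<open>x i\<close>, which is not in \<open>p i\<close>, and then drop the multiples of \<open>x i\<close>, which is in \<open>p (Suc i)\<close>.\<close>

lemma chain_relation: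
  fixes q :: "'k::field mpoly" and x :: "nat \<Rightarrow> 'k mpoly"
  assumes "prime_chain R p l" "\<And>i. i < l \<Longrightarrow> x i \<in> p (Suc i) - p i" "\<And>i. i < N \<Longrightarrow> x i \<in> R"
    and const_R: "\<And>c. mpoly_const c \<in> R" and "l \<le> N"
    and "q \<in> polys {0..<N}" "q \<noteq> 0" "mp_eval mpoly_const x q \<in> p 0"
  shows "\<exists>q'\<in>polys {l..<N}. q' \<noteq> 0 \<and> mp_eval mpoly_const x q' \<in> p l"
  using assms(1,2,5)
proof (induction l)
  case 0
  then show ?case using assms by auto
next
  case (Suc l)
  then obtain q' where q': "q' \<in> polys {l..<N}" "q' \<noteq> 0" "mp_eval mpoly_const x q' \<in> p l"
    by (auto simp: prime_chain_def)
  interpret p: prime_in R "p l" using Suc.prems by (simp add: prime_chain_def)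
  interpret p': prime_in R "p (Suc l)" using Suc.prems by (simp add: prime_chain_def)
  have sub: "p l \<subseteq> p (Suc l)" using Suc.prems(1) by (auto simp: prime_chain_def)
  let ?e = "mp_eval mpoly_const x"
  have "insert l {Suc l..<N} = {l..<N}" using Suc.prems by auto
  then have coeffs: "coeff (univariate l q') k \<in> polys {Suc l..<N}" for k
    using coeff_univariate[of q' l "{Suc l..<N}"] q'(1) by simp
  \<comment> \<open>\<open>F\<close> is a relation read as a polynomial in the indeterminate
    \<open>l\<close>. If its constant coefficient \<open>a\<close> is zero, it can be divided by
    this indeterminate; otherwise \<open>a\<close> is the relation sought. The induction over
    \<open>pCons\<close> runs through these divisions.\<close>
  have "\<exists>q'\<in>polys {Suc l..<N}. q' \<noteq> 0 \<and> ?e q' \<in> p (Suc l)"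
    if "F \<noteq> 0" "\<And>k. coeff F k \<in> polys {Suc l..<N}" "?e (poly F (mpoly_var l)) \<in> p l" for F
    using that
  proof (induction F)
    case 0
    then show ?case by simp
  next
    case (pCons a F)
    have a: "a \<in> polys {Suc l..<N}" using pCons.prems(2)[of 0] by simp
    have F: "coeff F k \<in> polys {Suc l..<N}" for k using pCons.prems(2)[of "Suc k"] by simp
    have e: "?e a + x l * ?e (poly F (mpoly_var l)) \<in> p l"
      using pCons.prems(3) by (simp add: const.mp_eval_simps)
    have "poly F (mpoly_var l) \<in> polys {0..<N}"
      using F polys_mono[of "{Suc l..<N}" "{0..<N}"] Suc.prems(3) by (intro poly_in_polys) auto
    then have FR: "?e (poly F (mpoly_var l)) \<in> R"
      using assms(3) const_R by (intro const.mp_eval_closed[OF p.subring_of_axioms]) auto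
    show ?case
    proof (cases "a = 0")
      case True
      then have "?e (poly F (mpoly_var l)) \<in> p l"
        using e Suc.prems(2)[of l] p.p_prime[of "x l"] FR p'.in_R by (auto simp: const.mp_eval_simps)
      then show ?thesis using pCons True F by auto
    next
      case False
      have "x l * ?e (poly F (mpoly_var l)) \<in> p (Suc l)"
        using Suc.prems(2)[of l] FR by (intro p'.p_mult_right) auto
      then have "?e a \<in> p (Suc l)" using e sub p'.p_add_iff by blast
      then show ?thesis using a False by blast
    qed
  qed
  from this[of "univariate l q'"] show ?case
    using q' coeffs by (simp add: univariate_eq_0_iff poly_univariate)
qed

lemma prime_chain_choose:
  assumes "prime_chain R p l"
  obtains x where "\<And>i. i < l \<Longrightarrow> x i \<in> p (Suc i) - p i"
proof -
  have "\<forall>i. \<exists>x. i < l \<longrightarrow> x \<in> p (Suc i) - p i" using assms unfolding prime_chain_def by blast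
  from choice[OF this] show ?thesis using that by blast
qed

lemma mp_eval_eq_sum:
  assumes "finite A" "q \<in> polys A"
  shows "mp_eval \<kappa> x q = (\<Sum>t\<in>keys q. \<kappa> (lookup q t)
    * (\<Prod>i\<in>A. x i ^ lookup t i))"
  unfolding mp_eval_def using assms
  by (intro sum.cong refl arg_cong2[of _ _ _ _ "(*)"] prod_keys_superset) (auto simp: polys_iff)

text \<open>Elements \<open>x i\<close> of \<open>p (Suc i) - p i\<close> and the indeterminates in
  \<open>T\<close> together satisfy no nontrivial polynomial relation: eliminating the
  \<open>x i\<close> along the chain would leave a nonzero element of \<open>p l\<close> in the
  indeterminates \<open>T\<close> alone. More than \<open>card V\<close> polynomials in
  \<open>V\<close> are always dependent. For \<open>T = {}\<close> this bounds the dimension, in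
  general the height in terms of the residue field.\<close>

theorem prime_chain_length:
  fixes p :: "nat \<Rightarrow> 'k::field mpoly set"
  assumes "finite V" "T \<subseteq> V" "prime_chain (polys V) p l" "p l \<inter> polys T \<subseteq> {0}"
  shows "l + card T \<le> card V"
proof (rule ccontr)
  assume neg: "\<not> ?thesis"
  define N where "N = l + card T"
  have T: "finite T" using assms finite_subset by blast
  obtain y where y: "\<And>i. i < l \<Longrightarrow> y i \<in> p (Suc i) - p i"
    using prime_chain_choose[OF assms(3)] by blast
  obtain e where e: "bij_betw e {0..<card T} T" using ex_bij_betw_nat_finite[OF T] by blast
  define x where "x i = (if i < l then y i else mpoly_var (e (i - l)))" for i
  have p_sub: "p i \<subseteq> polys V" if "i \<le> l" for i
    using assms(3) that prime_in.p_subset by (auto simp: prime_chain_def)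
  have e_T: "e (i - l) \<in> T" if "l \<le> i" "i < N" for i
    using e that by (auto simp: bij_betw_def N_def)
  have x: "x i \<in> polys V" if "i < N" for i
    unfolding x_def using y[of i] p_sub[of "Suc i"] e_T[OF _ that] assms(2) by auto
  have "card V < card {0..<N}" using neg by (simp add: N_def)
  from algebraic_dependence[OF assms(1) _ this, of x 1]
  obtain q :: "'k mpoly" where q: "q \<noteq> 0" "q \<in> polys {0..<N}" "mp_eval mpoly_const x q = 0"
    using x by (auto simp: mp_eval_eq_sum[of "{0..<N}"] polys_closed)
  have "\<exists>q'\<in>polys {l..<N}. q' \<noteq> 0 \<and> mp_eval mpoly_const x q' \<in> p l"
  proof (rule chain_relation[OF assms(3)])
    show "mp_eval mpoly_const x q \<in> p 0"
      using q(3) assms(3) prime_in.p_zero by (auto simp: prime_chain_def)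
  qed (use q y x in \<open>auto simp: x_def N_def\<close>)
  then obtain q' where q': "q' \<in> polys {l..<N}" "q' \<noteq> 0" "mp_eval mpoly_const x q' \<in> p l" by blast
  have "mp_eval mpoly_const x q' \<in> polys T"
    using q'(1) e_T by (intro const.mp_eval_closed[OF subring_of_polys]) (auto simp: x_def)
  then have 0: "mp_eval mpoly_const x q' = 0" using q'(3) assms(4) by blast
  define e' where "e' = inv_into {0..<card T} e"
  \<comment> \<open>Renaming the indeterminates in \<open>T\<close> back to \<open>l..<N\<close>
    recovers \<open>q'\<close> from its value, which is 0.\<close>
  have "mp_eval mpoly_const (\<lambda>j. mpoly_var (l + e' j)) (mp_eval mpoly_const x q') = q'"
    using q'(1)
  proof (induction rule: polys_induct)
    case (var i)
    then have "e' (e (i - l)) = i - l"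
      unfolding e'_def using e by (intro bij_betw_inv_into_left[OF e]) (auto simp: N_def)
    then show ?case using var by (simp add: const.mp_eval_simps x_def)
  qed (simp_all add: const.mp_eval_simps)
  then show False using 0 q'(2) by (simp add: const.mp_eval_simps)
qed

section \<open>Local parameters\<close>

context prime_in
begin

text \<open>The contraction to \<open>R\<close> of the ideal generated by \<open>h\<close> in the
  localization at \<open>p\<close>, with denominators cleared.\<close>

definition loc_span :: "'i set \<Rightarrow> ('i \<Rightarrow> 'r) \<Rightarrow> 'r set"
  where "loc_span A h = {f \<in> R. \<exists>u\<in>R - p. \<exists>g. (\<forall>a\<in>A. g a \<in> R) \<and> u * f = (\<Sum>a\<in>A. g a * h a)}"

lemma loc_spanI:
  assumes "f \<in> R" "u \<in> R - p" "\<And>a. a \<in> A \<Longrightarrow> g a \<in> R" "u * f = (\<Sum>a\<in>A. g a * h a)"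
  shows "f \<in> loc_span A h"
  using assms unfolding loc_span_def by blast

lemma loc_spanE:
  assumes "f \<in> loc_span A h"
  obtains u g where "f \<in> R" "u \<in> R - p" "\<forall>a\<in>A. g a \<in> R" "u * f = (\<Sum>a\<in>A. g a * h a)"
  using assms unfolding loc_span_def by blast

lemma loc_span_zero: "0 \<in> loc_span A h"
  by (rule loc_spanI[of _ 1 _ "\<lambda>_. 0"]) (use notin_one in \<open>auto simp: zero_closed\<close>)

lemma loc_span_base:
  assumes "finite A" "a \<in> A" "h a \<in> R"
  shows "h a \<in> loc_span A h"
  by (rule loc_spanI[of _ 1 _ "\<lambda>b. if b = a then 1 else 0"])
    (use assms notin_one in \<open>auto simp: closed(1,2) if_distrib[of "\<lambda>x. x * _"] cong: if_cong\<close>)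

lemma loc_span_add:
  assumes "x \<in> loc_span A h" "y \<in> loc_span A h"
  shows "x + y \<in> loc_span A h"
proof -
  obtain u g where x: "x \<in> R" "u \<in> R - p" "\<forall>a\<in>A. g a \<in> R" "u * x = (\<Sum>a\<in>A. g a * h a)"
    using assms(1) by (rule loc_spanE)
  obtain v k where y: "y \<in> R" "v \<in> R - p" "\<forall>a\<in>A. k a \<in> R" "v * y = (\<Sum>a\<in>A. k a * h a)"
    using assms(2) by (rule loc_spanE)
  have "u * v * (x + y) = v * (u * x) + u * (v * y)" by (simp add: algebra_simps)
  also have "\<dots> = (\<Sum>a\<in>A. (v * g a + u * k a) * h a)"
    unfolding x(4) y(4) by (simp add: sum_distrib_left sum.distrib algebra_simps)
  finally show ?thesis
    using x y notin_mult[of u v] by (intro loc_spanI[of _ "u * v"]) (auto intro!: closed)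
qed

lemma loc_span_mult:
  assumes "r \<in> R" "x \<in> loc_span A h"
  shows "r * x \<in> loc_span A h"
proof -
  obtain u g where x: "x \<in> R" "u \<in> R - p" "\<forall>a\<in>A. g a \<in> R" "u * x = (\<Sum>a\<in>A. g a * h a)"
    using assms(2) by (rule loc_spanE)
  have "u * (r * x) = (\<Sum>a\<in>A. (r * g a) * h a)"
    using arg_cong[OF x(4), of "(*) r"] by (simp add: sum_distrib_left mult_ac)
  then show ?thesis
    using x assms(1) by (intro loc_spanI[of _ u]) (auto intro!: closed)
qed

lemma loc_span_sum:
  "(\<And>i. i \<in> I \<Longrightarrow> f i \<in> loc_span A h) \<Longrightarrow> (\<Sum>i\<in>I. f i) \<in> loc_span A h"
  by (induction I rule: infinite_finite_induct) (auto intro: loc_span_zero loc_span_add)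

lemma loc_span_cancel:
  assumes "v \<in> R - p" "x \<in> R" "v * x \<in> loc_span A h"
  shows "x \<in> loc_span A h"
proof -
  obtain u g where x: "u \<in> R - p" "\<forall>a\<in>A. g a \<in> R" "u * (v * x) = (\<Sum>a\<in>A. g a * h a)"
    using assms(3) by (rule loc_spanE)
  show ?thesis
    by (rule loc_spanI[of _ "u * v"]) (use assms x notin_mult[of u v] in \<open>auto simp: mult.assoc\<close>)
qed

lemma loc_span_superset:
  assumes "x \<in> loc_span A h" "A \<subseteq> B" "finite B" "\<And>a. a \<in> A \<Longrightarrow> h a = h' a"
  shows "x \<in> loc_span B h'"
proof -
  obtain u g where x: "x \<in> R" "u \<in> R - p" "\<forall>a\<in>A. g a \<in> R" "u * x = (\<Sum>a\<in>A. g a * h a)"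
    using assms(1) by (rule loc_spanE)
  have "u * x = (\<Sum>a\<in>B. (if a \<in> A then g a else 0) * h' a)"
    unfolding x(4) using assms(2-4) by (intro sum.mono_neutral_cong_left) auto
  then show ?thesis using x by (intro loc_spanI[of _ u]) (auto simp: zero_closed)
qed

text \<open>In the localization at \<open>p\<close> this is the product of \<open>p\<close> with the
  ideal generated by \<open>h\<close>. When \<open>h\<close> generates \<open>p\<close> locally, it
  is the square of the maximal ideal.\<close>

definition loc_span_p :: "'i set \<Rightarrow> ('i \<Rightarrow> 'r) \<Rightarrow> 'r set"
  where "loc_span_p A h = {f. \<exists>u\<in>R - p. \<exists>e. (\<forall>a\<in>A. e a \<in> p) \<and> u * f = (\<Sum>a\<in>A. e a * h a)}"

lemma loc_span_pI:
  assumes "u \<in> R - p" "\<forall>a\<in>A. e a \<in> p" "u * f = (\<Sum>a\<in>A. e a * h a)"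
  shows "f \<in> loc_span_p A h"
  using assms unfolding loc_span_p_def by blast

lemma loc_span_pE:
  assumes "f \<in> loc_span_p A h"
  obtains u e where "u \<in> R - p" "\<forall>a\<in>A. e a \<in> p" "u * f = (\<Sum>a\<in>A. e a * h a)"
  using assms unfolding loc_span_p_def by blast

lemma loc_span_p_add:
  assumes "x \<in> loc_span_p A h" "y \<in> loc_span_p A h"
  shows "x + y \<in> loc_span_p A h"
proof -
  obtain u g where x: "u \<in> R - p" "\<forall>a\<in>A. g a \<in> p" "u * x = (\<Sum>a\<in>A. g a * h a)"
    using assms(1) by (rule loc_span_pE)
  obtain v k where y: "v \<in> R - p" "\<forall>a\<in>A. k a \<in> p" "v * y = (\<Sum>a\<in>A. k a * h a)"
    using assms(2) by (rule loc_span_pE)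
  have "u * v * (x + y) = v * (u * x) + u * (v * y)" by (simp add: algebra_simps)
  also have "\<dots> = (\<Sum>a\<in>A. (v * g a + u * k a) * h a)"
    unfolding x(3) y(3) by (simp add: sum_distrib_left sum.distrib algebra_simps)
  finally show ?thesis
    using x y notin_mult[of u v] by (intro loc_span_pI[of "u * v"]) (auto intro!: p_add p_mult)
qed

lemma loc_span_p_mult:
  assumes "q \<in> p" "x \<in> loc_span A h"
  shows "q * x \<in> loc_span_p A h"
proof -
  obtain u g where x: "u \<in> R - p" "\<forall>a\<in>A. g a \<in> R" "u * x = (\<Sum>a\<in>A. g a * h a)"
    using assms(2) by (rule loc_spanE)
  have "u * (q * x) = (\<Sum>a\<in>A. (q * g a) * h a)"
    using arg_cong[OF x(3), of "(*) q"] by (simp add: sum_distrib_left mult_ac)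
  then show ?thesis
    using x assms(1) by (intro loc_span_pI[of u]) (auto intro!: p_mult_right)
qed

lemma loc_span_p_sum:
  "(\<And>i. i \<in> I \<Longrightarrow> f i \<in> loc_span_p A h) \<Longrightarrow> (\<Sum>i\<in>I. f i) \<in> loc_span_p A h"
proof (induction I rule: infinite_finite_induct)
  case (insert i I)
  then show ?case by (auto intro: loc_span_p_add)
qed (use loc_span_pI[of 1 A "\<lambda>_. 0" 0 h] notin_one p_zero in auto)

end

text \<open>Since \<open>card (V - T)\<close> bounds the height of \<open>Q\<close> by \<open>prime_chain_length\<close>, this replaces Krull's height
  theorem.\<close>

theorem prime_local_parameters:
  fixes Q :: "'k::field mpoly set"
  assumes "finite V" "prime_in (polys V) Q"
  shows "\<exists>T h. T \<subseteq> V \<and> Q \<inter> polys T \<subseteq> {0} \<and> (\<forall>v\<in>V - T. h v \<in> Q) \<and>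
    (\<forall>f\<in>Q. f \<in> prime_in.loc_span (polys V) Q (V - T) h) \<and>
    (\<forall>g. (\<forall>v\<in>V - T. g v \<in> polys V) \<longrightarrow> (\<Sum>v\<in>V - T. g v * h v) = 0 \<longrightarrow> (\<forall>v\<in>V - T. g v \<in> Q))"
  using assms
proof (induction V arbitrary: Q rule: finite_induct)
  case empty
  interpret prime_in "polys {}" Q by fact
  have "Q \<subseteq> {0}"
    using prime_in_polys_Int_const[OF prime_in_axioms] p_subset by blast
  then show ?case using loc_span_zero by (intro exI[of _ "{}"]) auto
next
  case (insert z V)
  interpret Q: prime_in "polys (insert z V)" Q by fact
  define Q' where "Q' = Q \<inter> polys V"
  have "prime_in (polys V) Q'"
    unfolding Q'_def using insert.prems subring_of_polys polys_mono by (rule prime_in_Int) auto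
  then interpret Q': prime_in "polys V" Q' .
  from insert.IH[OF Q'.prime_in_axioms]
  obtain T h where T: "T \<subseteq> V" "Q' \<inter> polys T \<subseteq> {0}" and h': "\<forall>v\<in>V - T. h v \<in> Q'"
    and span': "\<forall>f\<in>Q'. f \<in> Q'.loc_span (V - T) h"
    and indep': "\<forall>g. (\<forall>v\<in>V - T. g v \<in> polys V) \<longrightarrow> (\<Sum>v\<in>V - T. g v * h v) = 0
      \<longrightarrow> (\<forall>v\<in>V - T. g v \<in> Q')"
    by (elim exE conjE) (rule that; assumption)
  note h = h'[rule_format] and span = span'[rule_format]
  have indep: "\<forall>v\<in>V - T. g v \<in> Q'"
    if "\<And>v. v \<in> V - T \<Longrightarrow> g v \<in> polys V" "(\<Sum>v\<in>V - T. g v * h v) = 0" for g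
    using indep' that by blast
  have V_sub: "polys V \<subseteq> polys (insert z V)" by (rule polys_mono) blast
  note V_mem = subsetD[OF V_sub]
  have z: "mpoly_var z \<in> polys (insert z V)" by simp
  let ?uni = "univariate z"
  \<comment> \<open>\<open>E\<close> is the extension of \<open>Q'\<close> to polynomials in
    \<open>z\<close>, the smallest prime lying over \<open>Q'\<close>. Over the fraction field of
    \<open>polys V\<close> modulo \<open>Q'\<close>, the prime \<open>Q\<close> becomes a prime
    ideal of a polynomial ring in one indeterminate: either zero, which means \<open>Q = E\<close>,
    or generated by a single polynomial.\<close>
  define E where "E = {f \<in> polys (insert z V). ?uni f \<in> {F. \<forall>k. coeff F k \<in> Q'}}"
  have "prime_in (polys (insert z V)) E"
    unfolding E_def
    by (rule prime_in_vimage[OF Q'.prime_in_poly subring_of_polys])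
      (auto simp: univariate_simps coeff_univariate insert.hyps)
  then interpret E: prime_in "polys (insert z V)" E .
  have E_iff: "f \<in> E \<longleftrightarrow> f \<in> polys (insert z V) \<and> (\<forall>k. coeff (?uni f) k \<in> Q')" for f
    by (auto simp: E_def)
  have expand: "f = (\<Sum>k\<le>degree (?uni f). coeff (?uni f) k * mpoly_var z ^ k)" for f :: "'k mpoly"
    using poly_univariate[of z f] by (simp add: poly_altdef)
  have uni_V: "?uni f = [:f:]" if "f \<in> polys V" for f :: "'k mpoly"
    using that insert.hyps(2) by (rule univariate_const)
  have uni_monom: "?uni (c * mpoly_var z ^ k) = monom c k" if "c \<in> polys V" for c :: "'k mpoly" and k
    by (simp add: univariate_simps uni_V[OF that] monom_altdef)
  have mem_E_V: "c * mpoly_var z ^ k \<in> E" if "c \<in> Q'" for c k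
    using V_mem[OF Q'.in_R[OF that]] z that Q'.p_zero
    by (auto simp: E_iff uni_monom[OF Q'.in_R[OF that]] intro!: polys_closed)
  have E_Q: "E \<subseteq> Q"
  proof
    fix f assume f: "f \<in> E"
    show "f \<in> Q"
      by (subst expand, intro Q.p_sum Q.p_mult_right polys_closed z) (use f in \<open>auto simp: E_iff Q'_def\<close>)
  qed
  have Q'_span: "f \<in> Q.loc_span (V - T) h" if f: "f \<in> Q'" for f
  proof -
    obtain u g where "f \<in> polys V" "u \<in> polys V - Q'" "\<forall>v\<in>V - T. g v \<in> polys V"
      "u * f = (\<Sum>v\<in>V - T. g v * h v)"
      using span[OF f] by (rule Q'.loc_spanE)
    then show ?thesis using V_mem by (intro Q.loc_spanI[of _ u _ g]) (auto simp: Q'_def)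
  qed
  have E_span: "f \<in> Q.loc_span (V - T) h" if f: "f \<in> E" for f
  proof -
    have "mpoly_var z ^ k * coeff (?uni f) k \<in> Q.loc_span (V - T) h" for k
      using f by (intro Q.loc_span_mult Q'_span polys_closed z) (auto simp: E_iff)
    then show ?thesis by (subst expand, intro Q.loc_span_sum) (simp add: mult.commute)
  qed
  have E_indep: "\<forall>v\<in>V - T. g v \<in> E"
    if g: "\<And>v. v \<in> V - T \<Longrightarrow> g v \<in> polys (insert z V)" and sum: "(\<Sum>v\<in>V - T. g v * h v) = 0" for g
  proof -
    have "\<forall>v\<in>V - T. coeff (?uni (g v)) k \<in> Q'" for k
    proof (rule indep)
      show "coeff (?uni (g v)) k \<in> polys V" if "v \<in> V - T" for v
        using coeff_univariate[OF g[OF that] insert.hyps(2)] .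
      have "0 = coeff (?uni (\<Sum>v\<in>V - T. g v * h v)) k"
        by (simp add: sum univariate_simps)
      also have "\<dots> = (\<Sum>v\<in>V - T. coeff (?uni (g v)) k * h v)"
        unfolding univariate_simps coeff_sum
      proof (rule sum.cong)
        fix v assume "v \<in> V - T"
        then show "coeff (?uni (g v) * ?uni (h v)) k = coeff (?uni (g v)) k * h v"
          using uni_V[OF Q'.in_R[OF h]] by simp
      qed simp
      finally show "(\<Sum>v\<in>V - T. coeff (?uni (g v)) k * h v) = 0" ..
    qed
    then show ?thesis using g by (simp add: E_iff)
  qed
  show ?case
  proof (cases "Q \<subseteq> E")
    \<comment> \<open>The residue class of \<open>z\<close> is transcendental: \<open>z\<close>
      joins \<open>T\<close>, and the parameters stay the same.\<close>
    case True
    have VT: "insert z V - insert z T = V - T" using insert.hyps by blast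
    have "Q \<inter> polys (insert z T) \<subseteq> {0}"
    proof
      fix f assume f: "f \<in> Q \<inter> polys (insert z T)"
      have "coeff (?uni f) k = 0" for k
      proof -
        have "coeff (?uni f) k \<in> polys T"
          using f T(1) insert.hyps(2) by (intro coeff_univariate) auto
        moreover have "coeff (?uni f) k \<in> Q'" using f True by (auto simp: E_iff)
        ultimately show ?thesis using T(2) by blast
      qed
      then have "?uni f = 0" by (simp add: poly_eq_iff)
      then show "f \<in> {0}" by (simp add: univariate_eq_0_iff)
    qed
    then show ?thesis
      using True T(1) h E_span E_indep E_Q
      by (intro exI[of _ "insert z T"] exI[of _ h]) (auto simp: VT Q'_def)
  next
    case False
    \<comment> \<open>The residue class of \<open>z\<close> is algebraic, and the least degree in
      \<open>z\<close> makes \<open>hz\<close> play the role of its minimal polynomial. The leading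
      coefficient \<open>c\<close> is outside \<open>Q'\<close>, as otherwise dropping the leading
      term would leave an element of \<open>Q - E\<close> of smaller degree.\<close>
    obtain hz where hz: "hz \<in> Q - E"
      and least: "\<And>f. f \<in> Q - E \<Longrightarrow> degree (?uni hz) \<le> degree (?uni f)"
      using ex_has_least_nat[of "\<lambda>f. f \<in> Q - E" _ "\<lambda>f. degree (?uni f)"] False by blast
    define d where "d = degree (?uni hz)"
    define c where "c = coeff (?uni hz) d"
    have hzV: "hz \<in> polys (insert z V)" using hz Q.in_R by blast
    have degree_less: "degree (?uni f) < e" if "f \<notin> E" "degree (?uni f) \<le> e" "coeff (?uni f) e = 0" for f e
    proof (rule ccontr)
      assume "\<not> degree (?uni f) < e"
      then have "lead_coeff (?uni f) = 0" using that(2,3) by simp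
      then have "f = 0" using univariate_eq_0_iff by auto
      then show False using that(1) E.p_zero by simp
    qed
    have cV: "c \<in> polys V" unfolding c_def by (rule coeff_univariate[OF hzV insert.hyps(2)])
    have c: "c \<notin> Q'"
    proof
      assume cQ: "c \<in> Q'"
      define f where "f = hz - c * mpoly_var z ^ d"
      have uni_f: "?uni f = ?uni hz - monom c d"
        unfolding f_def univariate_simps(4) uni_monom[OF cV] ..
      have "f \<in> Q" unfolding f_def using hz mem_E_V[OF cQ] E_Q by (intro Q.p_diff) auto
      moreover have "f \<notin> E"
        using hz E.p_add[OF _ mem_E_V[OF cQ, of d], of f] by (auto simp: f_def)
      moreover have "degree (?uni f) < d"
        using \<open>f \<notin> E\<close>
        by (rule degree_less) (auto simp: uni_f c_def d_def intro!: degree_diff_le degree_monom_le)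
      ultimately show False using least[of f] by (simp add: d_def)
    qed
    then have cQ: "c \<in> polys (insert z V) - Q" using cV V_mem by (auto simp: Q'_def)
    have zT: "z \<notin> T" using T(1) insert.hyps(2) by blast
    have VT: "insert z V - T = insert z (V - T)" using zT by blast
    define h' where "h' = h(z := hz)"
    have h': "h' v = h v" if "v \<in> V - T" for v using that insert.hyps(2) by (auto simp: h'_def)
    have fin: "finite (insert z (V - T))" using insert.hyps(1) by simp
    have hz_span: "hz \<in> Q.loc_span (insert z (V - T)) h'"
      using Q.loc_span_base[OF fin, of z h'] hzV by (simp add: h'_def)
    have E_span': "f \<in> Q.loc_span (insert z (V - T)) h'" if "f \<in> E" for f
      by (rule Q.loc_span_superset[OF E_span[OF that] _ fin]) (use h' in auto)
    have Q_span: "f \<in> Q.loc_span (insert z (V - T)) h'" if "f \<in> Q" for f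
      using that
    proof (induction "degree (?uni f)" arbitrary: f rule: less_induct)
      case less
      show ?case
      proof (cases "f \<in> E")
        case True
        then show ?thesis by (rule E_span')
      next
        case False
        define e where "e = degree (?uni f)"
        define b where "b = coeff (?uni f) e"
        have fV: "f \<in> polys (insert z V)" using less.prems Q.in_R by blast
        have de: "d \<le> e" unfolding d_def e_def using least False less.prems by blast
        have bV: "b \<in> polys V" unfolding b_def by (rule coeff_univariate[OF fV insert.hyps(2)])
        \<comment> \<open>Pseudo-division by \<open>hz\<close> lowers the degree in \<open>z\<close>
          until an element of \<open>E\<close> is reached. The factor \<open>c\<close> it introduces
          is outside \<open>Q\<close> and can be cancelled.\<close>
        define f' where "f' = c * f - b * mpoly_var z ^ (e - d) * hz"
        have uni_f': "?uni f' = smult c (?uni f) - monom b (e - d) * ?uni hz"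
          by (simp add: f'_def univariate_simps uni_V[OF cV] uni_V[OF bV] monom_altdef)
        have bz: "b * mpoly_var z ^ (e - d) \<in> polys (insert z V)"
          using bV V_mem z by (intro polys_closed) auto
        have f'Q: "f' \<in> Q"
          unfolding f'_def using less.prems hz cQ bz by (intro Q.p_diff Q.p_mult) auto
        have "f' \<in> Q.loc_span (insert z (V - T)) h'"
        proof (cases "f' \<in> E")
          case True
          then show ?thesis by (rule E_span')
        next
          case False
          have "degree (monom b (e - d) * ?uni hz) \<le> e"
            using degree_mult_le[of "monom b (e - d)" "?uni hz"] degree_monom_le[of b "e - d"] de
            by (simp add: d_def)
          then have "degree (?uni f') \<le> e"
            unfolding uni_f' e_def by (intro degree_diff_le degree_smult_le) auto
          moreover have "coeff (?uni f') e = 0"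
            using de by (simp add: uni_f' coeff_monom_mult b_def c_def)
          ultimately have "degree (?uni f') < degree (?uni f)"
            using degree_less[OF False] by (simp add: e_def)
          then show ?thesis using less.hyps f'Q by blast
        qed
        then have "f' + b * mpoly_var z ^ (e - d) * hz \<in> Q.loc_span (insert z (V - T)) h'"
          using bz hz_span by (intro Q.loc_span_add Q.loc_span_mult)
        then show ?thesis using Q.loc_span_cancel[OF cQ fV] by (simp add: f'_def)
      qed
    qed
    have "\<forall>v\<in>insert z (V - T). g v \<in> Q"
      if g: "\<And>v. v \<in> insert z (V - T) \<Longrightarrow> g v \<in> polys (insert z V)"
        and sum: "(\<Sum>v\<in>insert z (V - T). g v * h' v) = 0" for g
    proof -
      have "(\<Sum>v\<in>V - T. g v * h' v) = (\<Sum>v\<in>V - T. g v * h v)"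
        using h' by (intro sum.cong) auto
      then have sum': "g z * hz + (\<Sum>v\<in>V - T. g v * h v) = 0"
        using sum insert.hyps by (simp add: h'_def)
      have "h v \<in> E" if "v \<in> V - T" for v
        using mem_E_V[OF h[OF that], of 0] by simp
      then have "(\<Sum>v\<in>V - T. g v * h v) \<in> E" using g by (intro E.p_sum E.p_mult) auto
      then have "g z * hz \<in> E" using E.p_add_iff[of _ "g z * hz"] sum' E.p_zero by metis
      then have gz: "g z \<in> E" using E.p_prime[OF g[of z] hzV] hz by auto
      obtain u q where u: "u \<in> polys (insert z V) - Q"
        and q: "\<forall>v\<in>V - T. q v \<in> polys (insert z V)" and uq: "u * g z = (\<Sum>v\<in>V - T. q v * h v)"
        using E_span[OF gz] by (rule Q.loc_spanE)
      \<comment> \<open>Since \<open>g z\<close> lies in \<open>E\<close>, it is locally a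
        combination of the \<open>h v\<close>. Substituting this combination leaves a relation
        between the \<open>h v\<close> alone, whose coefficients agree with \<open>u * g v\<close>
        modulo \<open>Q\<close>.\<close>
      have "(\<Sum>v\<in>V - T. (u * g v + q v * hz) * h v)
          = u * (\<Sum>v\<in>V - T. g v * h v) + hz * (\<Sum>v\<in>V - T. q v * h v)"
        by (simp add: sum_distrib_left sum.distrib algebra_simps)
      also have "\<dots> = u * (g z * hz + (\<Sum>v\<in>V - T. g v * h v))"
        by (simp only: uq[symmetric]) (simp add: algebra_simps)
      also have "\<dots> = 0" by (simp add: sum')
      finally have "\<forall>v\<in>V - T. u * g v + q v * hz \<in> E"
        using g q u hzV by (intro E_indep) (auto intro!: polys_closed)
      moreover have "q v * hz \<in> Q" if "v \<in> V - T" for v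
        using q that hz by (intro Q.p_mult) auto
      ultimately have "\<forall>v\<in>V - T. u * g v \<in> Q" using E_Q Q.p_add_iff by blast
      then have "\<forall>v\<in>V - T. g v \<in> Q" using Q.p_prime u g by blast
      then show ?thesis using gz E_Q by blast
    qed
    moreover have "Q \<inter> polys T \<subseteq> {0}"
      using T polys_mono[OF T(1)] by (auto simp: Q'_def)
    moreover have "h' v \<in> Q" if "v \<in> insert z (V - T)" for v
      using that h h' hz by (auto simp: h'_def Q'_def)
    ultimately show ?thesis
      using T(1) Q_span unfolding VT[symmetric] by (intro exI[of _ T] exI[of _ h']) blast
  qed
qed

section \<open>Localizations and quotients\<close>

lemma (in ring_hom_cring) primeideal_vimage:
  assumes "primeideal q S"
  shows "primeideal {r \<in> carrier R. h r \<in> q} R"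
proof -
  interpret q: primeideal q S by fact
  show ?thesis
  proof (rule primeidealI)
    show "ideal {r \<in> carrier R. h r \<in> q} R" 
      by (rule ring_hom_ring.ideal_vimage[OF ring_hom_ringI2[OF R.ring_axioms S.ring_axioms homh] q.ideal_axioms])
    show "cring R" by (rule R.cring_axioms)
    show "carrier R \<noteq> {r \<in> carrier R. h r \<in> q}"
      using q.one_imp_carrier q.I_notcarr hom_one R.one_closed by (metis (no_types, lifting) mem_Collect_eq)
    show "a \<in> {r \<in> carrier R. h r \<in> q} \<or> b \<in> {r \<in> carrier R. h r \<in> q}"
      if "a \<in> carrier R" "b \<in> carrier R" "a \<otimes> b \<in> {r \<in> carrier R. h r \<in> q}" for a b
      using that q.I_prime[of "h a" "h b"] by auto
  qed
qed

lemma (in cring) ideal_by_closure: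
  assumes "J \<subseteq> carrier R" "J \<noteq> {}" "\<And>x y. \<lbrakk>x \<in> J; y \<in> J\<rbrakk> \<Longrightarrow> x \<oplus> y \<in> J"
    and mult: "\<And>r x. \<lbrakk>r \<in> carrier R; x \<in> J\<rbrakk> \<Longrightarrow> r \<otimes> x \<in> J"
  shows "ideal J R"
proof (rule idealI)
  show "ring R" by (rule ring_axioms)
  show "subgroup J (add_monoid R)"
  proof (rule add.subgroupI)
    show "\<ominus> x \<in> J" if "x \<in> J" for x
    proof -
      have "\<ominus> x = \<ominus> \<one> \<otimes> x" using that assms(1) by (simp add: subset_iff l_minus)
      then show ?thesis using mult[of "\<ominus> \<one>" x] that by simp
    qed
  qed (use assms in auto)
  show "r \<otimes> x \<in> J" "x \<otimes> r \<in> J" if "x \<in> J" "r \<in> carrier R" for x r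
    using that assms(1) mult by (auto simp: subset_iff m_comm[of x r])
qed

context mult_subset
begin

lemma carrier_localization: "carrier (localization R S) = {loc_frac R S r s | r s. r \<in> carrier R \<and> s \<in> S}"
  and one_localization: "\<one>\<^bsub>localization R S\<^esub> = loc_frac R S \<one> \<one>"
  by (simp_all add: localization_def)

lemma loc_frac_closed: "\<lbrakk>r \<in> carrier R; s \<in> S\<rbrakk> \<Longrightarrow> loc_frac R S r s \<in> carrier (localization R S)"
  unfolding carrier_localization by blast

lemma ring_hom_localization: "ring_hom_cring R (localization R S) (\<lambda>r. loc_frac R S r \<one>)"
proof -
  interpret L: cring "localization R S" by (rule cring_localization)
  have "(\<lambda>r. loc_frac R S r \<one>) \<in> ring_hom R (localization R S)"
    by (rule ring_hom_memI)
      (simp_all add: loc_frac_closed S_one mult_loc_frac add_loc_frac one_localization)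
  then show ?thesis
    by (intro ring_hom_cringI ring_hom_ringI2 ring_axioms L.ring_axioms cring_axioms L.cring_axioms)
qed

lemma loc_frac_eq_mult:
  assumes "r \<in> carrier R" "s \<in> S"
  shows "loc_frac R S r s = loc_frac R S \<one> s \<otimes>\<^bsub>localization R S\<^esub> loc_frac R S r \<one>"
  using assms by (simp add: mult_loc_frac S_one)

lemma loc_frac_numerator:
  assumes "r \<in> carrier R" "s \<in> S"
  shows "loc_frac R S r \<one> = loc_frac R S s \<one> \<otimes>\<^bsub>localization R S\<^esub> loc_frac R S r s"
  using assms S_one by (simp add: mult_loc_frac) (rule loc_frac_eqI; simp)

lemma ideal_localization:
  assumes "ideal b R"
  shows "ideal {loc_frac R S r s | r s. r \<in> b \<and> s \<in> S} (localization R S)" (is "ideal ?B _")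
proof -
  interpret b: ideal b R by fact
  interpret L: cring "localization R S" by (rule cring_localization)
  show ?thesis
  proof (rule L.ideal_by_closure)
    show "?B \<subseteq> carrier (localization R S)" 
      using b.Icarr unfolding carrier_localization by blast
    have "\<zero> \<in> b" by (rule additive_subgroup.zero_closed[OF b.additive_subgroup_axioms])
    then show "?B \<noteq> {}" using S_one by blast
  next
    fix x y assume "x \<in> ?B" "y \<in> ?B"
    then obtain a s c t where xy: "x = loc_frac R S a s" "y = loc_frac R S c t"
      and *: "a \<in> b" "s \<in> S" "c \<in> b" "t \<in> S" by blast
    have "t \<otimes> a \<oplus> s \<otimes> c \<in> b"
      using * by (intro additive_subgroup.a_closed b.additive_subgroup_axioms b.I_l_closed) auto
    then show "x \<oplus>\<^bsub>localization R S\<^esub> y \<in> ?B"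
      using * b.Icarr S_mult by (auto simp: xy add_loc_frac)
  next
    fix r x assume "r \<in> carrier (localization R S)" "x \<in> ?B"
    then obtain a s c t where xy: "x = loc_frac R S a s" "r = loc_frac R S c t"
      and *: "a \<in> b" "s \<in> S" "c \<in> carrier R" "t \<in> S" unfolding carrier_localization by blast
    have "c \<otimes> a \<in> b" using * b.I_l_closed by auto
    then show "r \<otimes>\<^bsub>localization R S\<^esub> x \<in> ?B"
      using * b.Icarr S_mult by (auto simp: xy mult_loc_frac)
  qed
qed

lemma mem_ideal_localization:
  assumes "ideal b R" "r \<in> carrier R" "s \<in> S"
    and "loc_frac R S r s \<in> {loc_frac R S r s | r s. r \<in> b \<and> s \<in> S}"
  shows "\<exists>t\<in>S. t \<otimes> r \<in> b"
proof -
  interpret b: ideal b R by fact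
  obtain r' s' where r': "r' \<in> b" "s' \<in> S" "loc_frac R S r s = loc_frac R S r' s'" using assms(4) by blast
  then obtain t where t: "t \<in> S" "t \<otimes> (s' \<otimes> r) = t \<otimes> (s \<otimes> r')"
    using assms(2,3) b.Icarr by (auto simp: loc_frac_eq_iff)
  have "t \<otimes> (s \<otimes> r') \<in> b" using t r' assms by (intro b.I_l_closed) auto
  then have "(t \<otimes> s') \<otimes> r \<in> b" using t r' assms(2) by (simp add: m_assoc)
  then show ?thesis using S_mult t r' by blast
qed

lemma contraction_strict:
  assumes "primeideal q (localization R S)" "primeideal q' (localization R S)" "q \<subset> q'"
  shows "{r \<in> carrier R. loc_frac R S r \<one> \<in> q} \<subset> {r \<in> carrier R. loc_frac R S r \<one> \<in> q'}"
proof -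
  interpret q: primeideal q "localization R S" by fact
  interpret q': primeideal q' "localization R S" by fact
  obtain x where x: "x \<in> q'" "x \<notin> q" using assms(3) by blast
  then obtain r s where rs: "r \<in> carrier R" "s \<in> S" "x = loc_frac R S r s"
    using q'.Icarr unfolding carrier_localization by blast
  have "loc_frac R S r \<one> \<in> q'"
    using x rs q'.I_l_closed[of x] by (simp add: loc_frac_numerator[of r s] loc_frac_closed S_one)
  moreover have "loc_frac R S r \<one> \<notin> q"
    using x rs q.I_l_closed[of "loc_frac R S r \<one>" "loc_frac R S \<one> s"] loc_frac_eq_mult[of r s]
    by (auto simp: loc_frac_closed)
  ultimately show ?thesis using assms(3) rs by blast
qed

lemma contraction_disjoint:
  assumes "primeideal q (localization R S)" "s \<in> S"
  shows "loc_frac R S s \<one> \<notin> q"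
proof
  interpret q: primeideal q "localization R S" by fact
  assume "loc_frac R S s \<one> \<in> q"
  then have "loc_frac R S \<one> s \<otimes>\<^bsub>localization R S\<^esub> loc_frac R S s \<one> \<in> q"
    using assms(2) by (intro q.I_l_closed) (auto simp: loc_frac_closed)
  moreover have "loc_frac R S \<one> s \<otimes>\<^bsub>localization R S\<^esub> loc_frac R S s \<one> = \<one>\<^bsub>localization R S\<^esub>"
    using assms(2) S_one by (simp add: mult_loc_frac one_localization) (rule loc_frac_eqI; simp)
  ultimately show False using q.one_imp_carrier q.I_notcarr by simp
qed

end

section \<open>Krull dimension by chains, and regularity at one prime\<close>

definition spec_chain :: "('a, 'b) ring_scheme \<Rightarrow> (nat \<Rightarrow> 'a set) \<Rightarrow> nat \<Rightarrow> bool"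
  where "spec_chain R p l \<longleftrightarrow> (\<forall>i\<le>l. p i \<in> Spec R) \<and> (\<forall>i<l. p i \<subset> p (Suc i))"

lemma krull_dim_alt: "krull_dim R = Sup {ereal (real l) | l. \<exists>p. spec_chain R p l}"
  by (simp add: krull_dim_def spec_chain_def)

lemma krull_dim_eqI:
  assumes "spec_chain R p d" "\<And>p l. spec_chain R p l \<Longrightarrow> l \<le> d"
  shows "krull_dim R = ereal (real d)"
  unfolding krull_dim_alt using assms by (intro antisym Sup_least Sup_upper) auto

text \<open>If all chains were shorter than \<open>d\<close>, the supremum would be at most
  \<open>real d - 1\<close>; the subtraction takes place in the reals, so the case
  \<open>d = 0\<close> is covered.\<close>

lemma ex_spec_chain_krull_dim:
  assumes "krull_dim R = ereal (real d)"
  shows "\<exists>p l. d \<le> l \<and> spec_chain R p l"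
proof (rule ccontr)
  assume neg: "\<not> ?thesis"
  have "krull_dim R \<le> ereal (real d - 1)"
    unfolding krull_dim_alt
  proof (rule Sup_least)
    fix x assume "x \<in> {ereal (real l) | l. \<exists>p. spec_chain R p l}"
    then obtain l where "x = ereal (real l)" "l < d" using neg by force
    then show "x \<le> ereal (real d - 1)" by simp
  qed
  then show False using assms by simp
qed

text \<open>Regularity at \<open>p\<close> read in \<open>R\<close> itself: generators of the
  maximal ideal are replaced by their numerators, and a chain of primes of the localization is
  contracted. Distinct generators may share a numerator and the chain may be chosen with at least
  the dimension as its length, hence \<open>card Y \<le> l\<close>.\<close>

lemma regular_localization_at:
  assumes "primeideal p R" "regular_local_ring (localization_at R p)"
  shows "\<exists>Y c l. finite Y \<and> Y \<subseteq> p \<and> spec_chain R c l \<and> c l \<subseteq> p \<and> card Y \<le> l \<and>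
    (\<forall>f\<in>p. \<exists>u\<in>carrier R - p. u \<otimes>\<^bsub>R\<^esub> f \<in> Idl\<^bsub>R\<^esub> Y)"
proof -
  interpret p: primeideal p R by fact
  define S where "S = carrier R - p"
  interpret mult_subset R S unfolding S_def by (rule mult_subset_prime_complement[OF assms(1)])
  let ?L = "localization R S"
  interpret L: cring ?L by (rule cring_localization)
  interpret hom: ring_hom_cring R ?L "\<lambda>r. loc_frac R S r \<one>\<^bsub>R\<^esub>" by (rule ring_hom_localization)
  from assms(2) obtain A where A: "A \<subseteq> carrier ?L" "finite A" "krull_dim ?L = ereal (real (card A))"
    and max: "maximalideal (Idl\<^bsub>?L\<^esub> A) ?L"
    unfolding regular_local_ring_def localization_at_def S_def by metis
  interpret M: maximalideal "Idl\<^bsub>?L\<^esub> A" ?L by (rule max)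
  \<comment> \<open>\<open>pL\<close> turns out to be the maximal ideal generated by
    \<open>A\<close>: fractions with numerator outside \<open>p\<close> are units, so that ideal is
    contained in \<open>pL\<close>, and maximality gives equality.\<close>
  define pL where "pL = {loc_frac R S r s | r s. r \<in> p \<and> s \<in> S}"
  interpret pL: ideal pL ?L unfolding pL_def by (rule ideal_localization[OF p.ideal_axioms])
  have pL_mem: "r \<in> p" if "r \<in> carrier R" "s \<in> S" "loc_frac R S r s \<in> pL" for r s
    using mem_ideal_localization[OF p.ideal_axioms that(1,2)] that(3) p.I_prime that(1)
    unfolding pL_def S_def by blast
  have "Idl\<^bsub>?L\<^esub> A \<subseteq> pL"
  proof
    fix x assume x: "x \<in> Idl\<^bsub>?L\<^esub> A"
    then obtain r s where rs: "r \<in> carrier R" "s \<in> S" "x = loc_frac R S r s"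
      using M.Icarr unfolding carrier_localization by blast
    have "r \<in> p"
    proof (rule ccontr)
      assume "r \<notin> p"
      then have r: "r \<in> S" using rs by (simp add: S_def)
      have "loc_frac R S s r \<otimes>\<^bsub>?L\<^esub> x \<in> Idl\<^bsub>?L\<^esub> A"
        using x rs r by (intro M.I_l_closed) (auto simp: loc_frac_closed)
      moreover have "loc_frac R S s r \<otimes>\<^bsub>?L\<^esub> x = \<one>\<^bsub>?L\<^esub>"
        unfolding rs(3) mult_loc_frac[OF S_closed[OF rs(2)] r rs(1,2)] one_localization
        by (rule loc_frac_eqI) (use rs r S_one S_mult in \<open>auto simp: p.m_comm\<close>)
      ultimately show False using M.one_imp_carrier M.I_notcarr by simp
    qed
    then show "x \<in> pL" using rs unfolding pL_def by blast
  qed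
  moreover have "pL \<noteq> carrier ?L"
  proof
    assume "pL = carrier ?L"
    then have "loc_frac R S \<one>\<^bsub>R\<^esub> \<one>\<^bsub>R\<^esub> \<in> pL" 
      using loc_frac_closed[OF p.one_closed S_one] by simp
    then show False using pL_mem[OF p.one_closed S_one] S_one by (simp add: S_def)
  qed
  ultimately have Idl: "Idl\<^bsub>?L\<^esub> A = pL"
    using M.I_maximal[OF pL.ideal_axioms] pL.a_subset by blast
  have "\<forall>a\<in>A. \<exists>r. r \<in> p \<and> (\<exists>s\<in>S. a = loc_frac R S r s)"
    using L.genideal_self[OF A(1)] Idl by (auto simp: pL_def)
  from bchoice[OF this] obtain y where y: "\<forall>a\<in>A. y a \<in> p \<and> (\<exists>s\<in>S. a = loc_frac R S (y a) s)" ..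
  define Y where "Y = y ` A"
  have Y: "finite Y" "Y \<subseteq> p" "card Y \<le> card A"
    using A(2) y by (auto simp: Y_def card_image_le)
  have YR: "Y \<subseteq> carrier R" using Y(2) p.Icarr by blast
  have ideal_Y: "ideal (Idl\<^bsub>R\<^esub> Y) R" by (rule p.genideal_ideal[OF YR])
  have "A \<subseteq> {loc_frac R S r s | r s. r \<in> Idl\<^bsub>R\<^esub> Y \<and> s \<in> S}"
  proof
    fix a assume a: "a \<in> A"
    then obtain s where "s \<in> S" "a = loc_frac R S (y a) s" using y by blast
    moreover have "y a \<in> Idl\<^bsub>R\<^esub> Y" using a p.genideal_self[OF YR] by (auto simp: Y_def)
    ultimately show "a \<in> {loc_frac R S r s | r s. r \<in> Idl\<^bsub>R\<^esub> Y \<and> s \<in> S}" by blast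
  qed
  then have "pL \<subseteq> {loc_frac R S r s | r s. r \<in> Idl\<^bsub>R\<^esub> Y \<and> s \<in> S}"
    using L.genideal_minimal[OF ideal_localization[OF ideal_Y]] Idl by auto
  then have gen: "\<exists>u\<in>carrier R - p. u \<otimes>\<^bsub>R\<^esub> f \<in> Idl\<^bsub>R\<^esub> Y" if "f \<in> p" for f
    using mem_ideal_localization[OF ideal_Y p.Icarr[OF that] S_one] that S_one
    unfolding S_def[symmetric] by (auto simp: pL_def)
  obtain c l where l: "card A \<le> l" and c: "spec_chain ?L c l"
    using ex_spec_chain_krull_dim[OF A(3)] by blast
  define c' where "c' i = {r \<in> carrier R. loc_frac R S r \<one>\<^bsub>R\<^esub> \<in> c i}" for i
  have "spec_chain R c' l"
    using c hom.primeideal_vimage contraction_strict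
    by (auto simp: spec_chain_def Spec_def c'_def)
  moreover have "c' l \<subseteq> p"
    using contraction_disjoint c by (force simp: spec_chain_def Spec_def c'_def S_def)
  ultimately show ?thesis
    using Y l gen by (intro exI[of _ Y] exI[of _ c'] exI[of _ l]) auto
qed

section \<open>Primes and chains of primes in a quotient ring\<close>

lemma (in ring) quot_carrierE:
  assumes "x \<in> carrier (R Quot I)"
  obtains r where "r \<in> carrier R" "x = I +> r"
  using assms unfolding FactRing_def by (auto simp: A_RCOSETS_def')

lemma (in cring) primeideal_quot_vimage:
  assumes "ideal I R" "primeideal p (R Quot I)"
  shows "primeideal {r \<in> carrier R. I +> r \<in> p} R" "I \<subseteq> {r \<in> carrier R. I +> r \<in> p}"
proof -
  interpret I: ideal I R by fact
  interpret p: primeideal p "R Quot I" by fact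
  show "primeideal {r \<in> carrier R. I +> r \<in> p} R"
    by (rule ring_hom_cring.primeideal_vimage[OF I.rcos_ring_hom_cring[OF cring_axioms] assms(2)])
  have "I \<in> p"
    using additive_subgroup.zero_closed[OF p.additive_subgroup_axioms] by (simp add: FactRing_def)
  then show "I \<subseteq> {r \<in> carrier R. I +> r \<in> p}"
    using I.Icarr a_rcos_zero[OF assms(1)] by auto
qed

lemma (in cring) quot_vimage_strict:
  assumes "ideal I R" "primeideal p (R Quot I)" "primeideal p' (R Quot I)" "p \<subset> p'"
  shows "{r \<in> carrier R. I +> r \<in> p} \<subset> {r \<in> carrier R. I +> r \<in> p'}"
proof -
  obtain x where x: "x \<in> p'" "x \<notin> p" using assms(4) by blast
  have "x \<in> carrier (R Quot I)"
    using x(1) ideal.Icarr[OF primeideal.axioms(1)[OF assms(3)]] by blast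
  then obtain r where "r \<in> carrier R" "x = I +> r" by (rule quot_carrierE)
  then show ?thesis using x assms(4) by blast
qed

lemma (in cring) rcos_image_mem_iff:
  assumes "ideal I R" "ideal q R" "I \<subseteq> q" "r \<in> carrier R"
  shows "I +> r \<in> (+>) I ` q \<longleftrightarrow> r \<in> q"
proof
  interpret q: ideal q R by fact
  assume "I +> r \<in> (+>) I ` q"
  then obtain r' where r': "r' \<in> q" "I +> r = I +> r'" by blast
  then have "r \<ominus> r' \<in> I"
    using quotient_eq_iff_same_a_r_cos[OF assms(1,4)] q.Icarr by blast
  then have "r \<ominus> r' \<oplus> r' \<in> q"
    using r'(1) assms(3) by (intro additive_subgroup.a_closed q.additive_subgroup_axioms) auto
  moreover have "r \<ominus> r' \<oplus> r' = r" using assms(4) q.Icarr[OF r'(1)] by algebra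
  ultimately show "r \<in> q" by simp
qed blast

lemma (in cring) primeideal_quot_image:
  assumes "ideal I R" "primeideal q R" "I \<subseteq> q"
  shows "primeideal ((+>) I ` q) (R Quot I)"
proof -
  interpret I: ideal I R by fact
  interpret q: primeideal q R by fact
  note mem = rcos_image_mem_iff[OF assms(1) q.ideal_axioms assms(3)]
  show ?thesis
  proof (rule primeidealI)
    show "ideal ((+>) I ` q) (R Quot I)" by (rule ring_ideal_imp_quot_ideal[OF assms(1) q.ideal_axioms])
    show "cring (R Quot I)" by (rule I.quotient_is_cring[OF cring_axioms])
    have "I +> \<one> \<notin> (+>) I ` q" using mem[OF one_closed] q.one_imp_carrier q.I_notcarr by blast
    moreover have "I +> \<one> \<in> carrier (R Quot I)"
      using ring_hom_closed[OF I.rcos_ring_hom one_closed] .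
    ultimately show "carrier (R Quot I) \<noteq> (+>) I ` q" by blast
    fix a b assume ab: "a \<in> carrier (R Quot I)" "b \<in> carrier (R Quot I)"
      "a \<otimes>\<^bsub>R Quot I\<^esub> b \<in> (+>) I ` q"
    obtain r where r: "r \<in> carrier R" "a = I +> r" using ab(1) by (rule quot_carrierE)
    obtain s where s: "s \<in> carrier R" "b = I +> s" using ab(2) by (rule quot_carrierE)
    have "I +> (r \<otimes> s) \<in> (+>) I ` q"
      using ab(3) r s ring_hom_mult[OF I.rcos_ring_hom, of r s] by simp
    then have "r \<in> q \<or> s \<in> q" using mem[of "r \<otimes> s"] q.I_prime r s by auto
    then show "a \<in> (+>) I ` q \<or> b \<in> (+>) I ` q" using r s by blast
  qed
qed

lemma (in cring) spec_chain_quot_vimage: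
  assumes "ideal I R" "spec_chain (R Quot I) p l"
  shows "spec_chain R (\<lambda>i. {r \<in> carrier R. I +> r \<in> p i}) l"
  using assms(2) primeideal_quot_vimage[OF assms(1)] quot_vimage_strict[OF assms(1)]
  unfolding spec_chain_def Spec_def by auto

lemma (in cring) spec_chain_quot_image:
  assumes "ideal I R" "spec_chain R q l" "I \<subseteq> q 0"
  shows "spec_chain (R Quot I) (\<lambda>i. (+>) I ` q i) l"
proof -
  have sub: "I \<subseteq> q i" if "i \<le> l" for i
    using that
  proof (induction i)
    case (Suc i)
    then have "q i \<subset> q (Suc i)" using assms(2) by (simp add: spec_chain_def)
    then show ?case using Suc by auto
  qed (rule assms(3))
  have prime: "primeideal (q i) R" if "i \<le> l" for i
    using that assms(2) by (auto simp: spec_chain_def Spec_def)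
  have "(+>) I ` q i \<subset> (+>) I ` q (Suc i)" if "i < l" for i
  proof -
    have less: "q i \<subset> q (Suc i)" using that assms(2) by (auto simp: spec_chain_def)
    then obtain r where r: "r \<in> q (Suc i)" "r \<notin> q i" by blast
    have "primeideal (q (Suc i)) R" using prime that by simp
    then have "r \<in> carrier R" using ideal.Icarr[OF primeideal.axioms(1) r(1)] by blast
    then have "I +> r \<notin> (+>) I ` q i"
      using rcos_image_mem_iff[OF assms(1) primeideal.axioms(1)[OF prime] sub, of i r] that r by auto
    then show ?thesis using less r by blast
  qed
  then show ?thesis
    using primeideal_quot_image[OF assms(1) prime sub] by (auto simp: spec_chain_def Spec_def)
qed

lemma spec_chain_mpoly_ring: "spec_chain (mpoly_ring V) = prime_chain (polys V)"
  by (intro ext) (simp add: spec_chain_def prime_chain_def Spec_def prime_in_polys_iff)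

lemma ideal_in_polys_iff: "ideal_in (polys V) I \<longleftrightarrow> ideal I (mpoly_ring V)"
proof
  assume "ideal I (mpoly_ring V)"
  then interpret ideal I "mpoly_ring V" .
  interpret subring_of "polys V" by (rule subring_of_polys)
  show "ideal_in (polys V) I"
  proof
    show "I \<subseteq> polys V" by (rule a_subset)
    show "0 \<in> I" using additive_subgroup.zero_closed[OF additive_subgroup_axioms] by (simp add: mpoly_ring_simps)
    show "x - y \<in> I" if "x \<in> I" "y \<in> I" for x y
    proof -
      have "x \<ominus>\<^bsub>mpoly_ring V\<^esub> y \<in> I"
        using that unfolding a_minus_def
        by (intro additive_subgroup.a_closed additive_subgroup.a_inv_closed additive_subgroup_axioms)
      then show ?thesis using mpoly_ring_diff[OF a_Hcarr[OF that(1)] a_Hcarr[OF that(2)]] by simp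
    qed
    show "r * x \<in> I" if "r \<in> polys V" "x \<in> I" for r x
      using I_l_closed[OF that(2,1)] by (simp add: mpoly_ring_simps)
  qed
next
  assume "ideal_in (polys V) I"
  then interpret ideal_in "polys V" I .
  interpret P: cring "mpoly_ring V" by (rule cring_mpoly_ring)
  show "ideal I (mpoly_ring V)"
    by (rule P.ideal_by_closure)
      (use I_subset I_zero in \<open>auto simp: mpoly_ring_simps intro: I_add I_mult\<close>)
qed

text \<open>Lifting cosets to representatives turns regularity of the quotient at \<open>Q\<close>
  into equations between polynomials modulo \<open>I\<close>. This is the only form in which
  regularity enters the arguments below.\<close>

lemma regular_quot_polys:
  fixes I Q :: "'k::field mpoly set"
  assumes I: "ideal_in (polys V) I" and Q: "prime_in (polys V) Q" "I \<subseteq> Q"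
    and "regular_ring (mpoly_ring V Quot I)"
  shows "\<exists>Y c l. finite Y \<and> Y \<subseteq> Q \<and> prime_chain (polys V) c l \<and> I \<subseteq> c 0 \<and> c l \<subseteq> Q \<and> card Y \<le> l \<and>
    (\<forall>f\<in>Q. \<exists>u\<in>polys V - Q. \<exists>g. (\<forall>y\<in>Y. g y \<in> polys V) \<and> u * f - (\<Sum>y\<in>Y. g y * y) \<in> I)"
proof -
  let ?P = "mpoly_ring V :: 'k mpoly ring"
  interpret P: cring ?P by (rule cring_mpoly_ring)
  interpret I: ideal_in "polys V" I by fact
  interpret Q: prime_in "polys V" Q by fact
  have ideal_I: "ideal I ?P" using I by (simp add: ideal_in_polys_iff)
  have prime_Q: "primeideal Q ?P" using Q by (simp add: prime_in_polys_iff)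
  define QI where "QI = (+>\<^bsub>?P\<^esub>) I ` Q"
  have QI: "primeideal QI (?P Quot I)"
    unfolding QI_def by (rule P.primeideal_quot_image[OF ideal_I prime_Q Q(2)])
  have mem_QI: "I +>\<^bsub>?P\<^esub> r \<in> QI \<longleftrightarrow> r \<in> Q" if "r \<in> polys V" for r
    unfolding QI_def by (rule P.rcos_image_mem_iff[OF ideal_I primeideal.axioms(1)[OF prime_Q] Q(2) that])
  from assms(4) QI have "regular_local_ring (localization_at (?P Quot I) QI)"
    by (simp add: regular_ring_def)
  from regular_localization_at[OF QI this]
  obtain Y c l where Y: "finite Y" "Y \<subseteq> QI" "card Y \<le> l" and c: "spec_chain (?P Quot I) c l" "c l \<subseteq> QI"
    and gen: "\<forall>f\<in>QI. \<exists>u\<in>carrier (?P Quot I) - QI. u \<otimes>\<^bsub>?P Quot I\<^esub> f \<in> Idl\<^bsub>?P Quot I\<^esub> Y"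
    by (elim exE conjE) (rule that; assumption)
  have "\<forall>x\<in>Y. \<exists>y. y \<in> Q \<and> x = I +>\<^bsub>?P\<^esub> y" using Y(2) by (auto simp: QI_def)
  from bchoice[OF this] obtain y where y: "\<forall>x\<in>Y. y x \<in> Q \<and> x = I +>\<^bsub>?P\<^esub> y x" ..
  define Y' where "Y' = y ` Y"
  have Y': "finite Y'" "Y' \<subseteq> Q" "card Y' \<le> l"
    using Y y card_image_le[OF Y(1), of y] by (auto simp: Y'_def)
  \<comment> \<open>\<open>J\<close> is the preimage of the ideal generated by the cosets in
    \<open>Y\<close>, described by explicit coefficients. Minimality of the generated ideal places
    it in the image of \<open>J\<close>, so that the coefficients \<open>g\<close> can be read
    off.\<close>
  define J where "J = {f \<in> polys V. \<exists>g. (\<forall>y\<in>Y'. g y \<in> polys V) \<and> f - (\<Sum>y\<in>Y'. g y * y) \<in> I}"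
  have J: "ideal J ?P"
  proof (rule P.ideal_by_closure)
    show "J \<subseteq> polys V" by (auto simp: J_def)
    have "0 \<in> J"
      unfolding J_def using I.zero_closed I.I_zero by (auto intro!: exI[of _ "\<lambda>_. 0"])
    then show "J \<noteq> {}" by blast
    show "f \<oplus>\<^bsub>?P\<^esub> f' \<in> J" if ff': "f \<in> J" "f' \<in> J" for f f'
    proof -
      obtain g g' where g: "\<forall>y\<in>Y'. g y \<in> polys V" "f - (\<Sum>y\<in>Y'. g y * y) \<in> I"
        and g': "\<forall>y\<in>Y'. g' y \<in> polys V" "f' - (\<Sum>y\<in>Y'. g' y * y) \<in> I"
        using ff' by (auto simp: J_def)
      have "f + f' - (\<Sum>y\<in>Y'. (g y + g' y) * y) = (f - (\<Sum>y\<in>Y'. g y * y)) + (f' - (\<Sum>y\<in>Y'. g' y * y))"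
        by (simp add: distrib_right sum.distrib)
      then have "f + f' - (\<Sum>y\<in>Y'. (g y + g' y) * y) \<in> I"
        using I.I_add[OF g(2) g'(2)] by (simp only:)
      then show ?thesis
        using ff' g g' unfolding J_def mpoly_ring_simps
        by (auto intro!: I.add_closed exI[of _ "\<lambda>y. g y + g' y"])
    qed
    show "r \<otimes>\<^bsub>?P\<^esub> f \<in> J" if rf: "r \<in> polys V" "f \<in> J" for r f
    proof -
      obtain g where g: "\<forall>y\<in>Y'. g y \<in> polys V" "f - (\<Sum>y\<in>Y'. g y * y) \<in> I"
        using rf by (auto simp: J_def)
      have "r * f - (\<Sum>y\<in>Y'. (r * g y) * y) = r * (f - (\<Sum>y\<in>Y'. g y * y))"
        by (simp add: right_diff_distrib sum_distrib_left mult.assoc)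
      then have "r * f - (\<Sum>y\<in>Y'. (r * g y) * y) \<in> I" using I.I_mult[OF rf(1) g(2)] by (simp only:)
      then show ?thesis
        using rf g unfolding J_def mpoly_ring_simps
        by (auto intro!: I.mult_closed exI[of _ "\<lambda>y. r * g y"])
    qed
  qed
  have I_J: "I \<subseteq> J"
    unfolding J_def using I.I_subset I.zero_closed by (auto intro!: exI[of _ "\<lambda>_. 0"])
  have "Y' \<subseteq> J"
  proof
    fix x assume x: "x \<in> Y'"
    have "(\<Sum>y\<in>Y'. (if y = x then 1 else 0) * y) = x"
      using x Y'(1) by (simp add: if_distrib[of "\<lambda>x. x * _"] cong: if_cong)
    then show "x \<in> J"
      using x Y'(2) Q.in_R unfolding J_def
      by (auto simp: I.I_zero I.closed(1,2) intro!: exI[of _ "\<lambda>y. if y = x then 1 else 0"])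
  qed
  then have "Y \<subseteq> (+>\<^bsub>?P\<^esub>) I ` J" using y by (force simp: Y'_def)
  then have Idl_Y: "Idl\<^bsub>?P Quot I\<^esub> Y \<subseteq> (+>\<^bsub>?P\<^esub>) I ` J"
    by (intro ring.genideal_minimal ideal.quotient_is_ring[OF ideal_I] P.ring_ideal_imp_quot_ideal[OF ideal_I J])
  have "\<exists>u\<in>polys V - Q. \<exists>g. (\<forall>y\<in>Y'. g y \<in> polys V) \<and> u * f - (\<Sum>y\<in>Y'. g y * y) \<in> I"
    if f: "f \<in> Q" for f
  proof -
    obtain w where w: "w \<in> carrier (?P Quot I) - QI"
        "w \<otimes>\<^bsub>?P Quot I\<^esub> (I +>\<^bsub>?P\<^esub> f) \<in> Idl\<^bsub>?P Quot I\<^esub> Y"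
      using gen f by (auto simp: QI_def)
    then obtain u where u: "u \<in> polys V" "w = I +>\<^bsub>?P\<^esub> u" by (auto elim: P.quot_carrierE)
    have "I +>\<^bsub>?P\<^esub> (u * f) \<in> (+>\<^bsub>?P\<^esub>) I ` J"
      using w(2) u f Idl_Y ring_hom_mult[OF ideal.rcos_ring_hom[OF ideal_I], of u f] Q.in_R
      by (auto simp: mpoly_ring_simps)
    then have "u * f \<in> J"
      using P.rcos_image_mem_iff[OF ideal_I J I_J, of "u * f"] I.mult_closed u f Q.in_R by blast
    moreover have "u \<notin> Q" using w(1) u mem_QI by blast
    ultimately show ?thesis using u by (auto simp: J_def)
  qed
  moreover have "prime_chain (polys V) (\<lambda>i. {r \<in> polys V. I +>\<^bsub>?P\<^esub> r \<in> c i}) l"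
    using P.spec_chain_quot_vimage[OF ideal_I c(1)] by (simp add: spec_chain_mpoly_ring)
  moreover have "I \<subseteq> {r \<in> polys V. I +>\<^bsub>?P\<^esub> r \<in> c 0}"
    using c(1) by (intro P.primeideal_quot_vimage[OF ideal_I]) (auto simp: spec_chain_def Spec_def)
  moreover have "{r \<in> polys V. I +>\<^bsub>?P\<^esub> r \<in> c l} \<subseteq> Q"
    using c(2) mem_QI by blast
  ultimately show ?thesis
    using Y' by (intro exI[of _ Y'] exI[of _ "\<lambda>i. {r \<in> polys V. I +>\<^bsub>?P\<^esub> r \<in> c i}"] exI[of _ l]) auto
qed

section \<open>Weights\<close>

text \<open>An indeterminate \<open>x\<close> of weight \<open>w\<close> is replaced by
  \<open>x * t ^ w\<close>, which makes the grading a ring homomorphism: the homogeneous components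
  are the coefficients at the powers of \<open>t\<close>, and the homogeneous part of a prime is a
  preimage.\<close>

definition weight_poly :: "(nat \<Rightarrow> int) \<Rightarrow> 'k::field mpoly \<Rightarrow> 'k mpoly poly"
  where "weight_poly W = mp_eval (\<lambda>c. [:mpoly_const c:]) (\<lambda>i. monom (mpoly_var i) (nat (W i)))"

text \<open>Regarding \<open>f\<close> as a polynomial over \<open>K[a]\<close>, these are its constant term and, for \<open>l \<ge> m\<close>, the
  coefficient of its linear term in the indeterminate \<open>l\<close>.\<close>

definition const_part :: "nat \<Rightarrow> 'k::field mpoly \<Rightarrow> 'k mpoly"
  where "const_part m = mp_eval mpoly_const (\<lambda>i. if i < m then mpoly_var i else 0)"

definition linear_poly :: "nat \<Rightarrow> nat \<Rightarrow> 'k::field mpoly \<Rightarrow> 'k mpoly poly"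
  where "linear_poly m l = mp_eval (\<lambda>c. [:mpoly_const c:])
    (\<lambda>i. if i < m then [:mpoly_var i:] else if i = l then [:0, 1:] else 0)"

definition linear_coeff :: "nat \<Rightarrow> nat \<Rightarrow> 'k::field mpoly \<Rightarrow> 'k mpoly"
  where "linear_coeff m l f = coeff (linear_poly m l f) 1"

lemma weight_poly_simps:
  "weight_poly W 0 = 0" "weight_poly W 1 = 1"
  "weight_poly W (f + g) = weight_poly W f + weight_poly W g"
  "weight_poly W (f - g) = weight_poly W f - weight_poly W g"
  "weight_poly W (f * g) = weight_poly W f * weight_poly W g"
  "weight_poly W (\<Sum>a\<in>A. F a) = (\<Sum>a\<in>A. weight_poly W (F a))"
  "weight_poly W (mpoly_const c) = [:mpoly_const c:]"
  "weight_poly W (mpoly_var i) = monom (mpoly_var i) (nat (W i))"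
  by (simp_all add: weight_poly_def constp.mp_eval_simps)

lemma const_part_simps:
  "const_part m 0 = 0" "const_part m 1 = 1"
  "const_part m (f + g) = const_part m f + const_part m g"
  "const_part m (f - g) = const_part m f - const_part m g"
  "const_part m (f * g) = const_part m f * const_part m g"
  "const_part m (\<Sum>a\<in>A. F a) = (\<Sum>a\<in>A. const_part m (F a))"
  "const_part m (mpoly_const c) = mpoly_const c"
  "const_part m (mpoly_var i) = (if i < m then mpoly_var i else 0)"
  by (simp_all add: const_part_def const.mp_eval_simps)

lemma linear_poly_simps:
  "linear_poly m l 0 = 0" "linear_poly m l 1 = 1"
  "linear_poly m l (f + g) = linear_poly m l f + linear_poly m l g"
  "linear_poly m l (f - g) = linear_poly m l f - linear_poly m l g"
  "linear_poly m l (f * g) = linear_poly m l f * linear_poly m l g"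
  "linear_poly m l (\<Sum>a\<in>A. F a) = (\<Sum>a\<in>A. linear_poly m l (F a))"
  "linear_poly m l (mpoly_const c) = [:mpoly_const c:]"
  "linear_poly m l (mpoly_var i) = (if i < m then [:mpoly_var i:] else if i = l then [:0, 1:] else 0)"
  by (simp_all add: linear_poly_def constp.mp_eval_simps)

lemma const_part_in_polys: "const_part m f \<in> polys {0..<m}"
  by (induction f rule: mpoly_induct) (auto simp: const_part_simps intro!: polys_closed)

lemma const_part_id:
  assumes "f \<in> polys {0..<m}"
  shows "const_part m f = f"
  using assms by (induction rule: polys_induct) (auto simp: const_part_simps)

lemma coeff_linear_poly_0: "m \<le> l \<Longrightarrow> coeff (linear_poly m l f) 0 = const_part m f"
  by (induction f rule: mpoly_induct)
    (auto simp: linear_poly_simps const_part_simps coeff_mult_0)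

lemma linear_coeff_simps:
  "linear_coeff m l 0 = 0"
  "linear_coeff m l (f + g) = linear_coeff m l f + linear_coeff m l g"
  "linear_coeff m l (f - g) = linear_coeff m l f - linear_coeff m l g"
  "linear_coeff m l (\<Sum>a\<in>A. F a) = (\<Sum>a\<in>A. linear_coeff m l (F a))"
  "linear_coeff m l (mpoly_const c) = 0"
  by (simp_all add: linear_coeff_def linear_poly_simps coeff_sum)

lemma linear_coeff_var: "linear_coeff m l (mpoly_var i) = (if m \<le> i \<and> i = l then 1 else 0)"
  by (simp add: linear_coeff_def linear_poly_simps)

text \<open>\<open>linear_coeff\<close> is a derivation along \<open>const_part\<close>. On elements
  with zero \<open>const_part\<close> it is therefore linear over \<open>K[a]\<close>, and it
  vanishes on products of two such elements.\<close>

lemma linear_coeff_mult: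
  "m \<le> l \<Longrightarrow> linear_coeff m l (f * g) = const_part m f * linear_coeff m l g + const_part m g * linear_coeff m l f"
  by (simp add: linear_coeff_def linear_poly_simps coeff_mult coeff_linear_poly_0 mult.commute)

lemma linear_coeff_in_polys: "m \<le> l \<Longrightarrow> linear_coeff m l f \<in> polys {0..<m}"
  by (induction f rule: mpoly_induct)
    (auto simp: linear_coeff_simps linear_coeff_var linear_coeff_mult const_part_in_polys intro!: polys_closed)

lemma linear_coeff_eq_0:
  assumes "f \<in> polys V" "l \<notin> V" "m \<le> l"
  shows "linear_coeff m l f = 0"
  using assms(1)
  by (induction rule: polys_induct) (use assms(2,3) in \<open>auto simp: linear_coeff_simps linear_coeff_var linear_coeff_mult\<close>)

lemma const_part_decompose:
  assumes "f \<in> polys V" "finite V"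
  shows "\<exists>k. (\<forall>l\<in>V - {0..<m}. k l \<in> polys V) \<and> f = const_part m f + (\<Sum>l\<in>V - {0..<m}. mpoly_var l * k l)"
  using assms(1)
proof (induction rule: polys_induct)
  case (const c)
  then show ?case by (intro exI[of _ "\<lambda>_. 0"]) (simp add: const_part_simps polys_closed(1))
next
  case (var i)
  show ?case
  proof (cases "i < m")
    case True
    then show ?thesis by (intro exI[of _ "\<lambda>_. 0"]) (simp add: const_part_simps polys_closed(1))
  next
    case False
    then show ?thesis using var assms(2)
      by (intro exI[of _ "\<lambda>l. if l = i then 1 else 0"])
        (auto simp: const_part_simps polys_closed(1,2) if_distrib[of "\<lambda>x. _ * x"] cong: if_cong)
  qed
next
  case (add f g)
  then obtain k k' where "\<forall>l\<in>V - {0..<m}. k l \<in> polys V" "\<forall>l\<in>V - {0..<m}. k' l \<in> polys V"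
    and "f - const_part m f = (\<Sum>l\<in>V - {0..<m}. mpoly_var l * k l)"
    and "g - const_part m g = (\<Sum>l\<in>V - {0..<m}. mpoly_var l * k' l)"
    by (metis (no_types, lifting) add_diff_cancel_left')
  moreover from this(3,4) have "f + g = const_part m (f + g) + (\<Sum>l\<in>V - {0..<m}. mpoly_var l * (k l + k' l))"
    by (simp add: const_part_simps distrib_left sum.distrib flip: \<open>f - _ = _\<close> \<open>g - _ = _\<close>)
  ultimately show ?case by (intro exI[of _ "\<lambda>l. k l + k' l"]) (auto intro!: polys_closed)
next
  case (mult f g)
  then obtain k k' where k: "\<forall>l\<in>V - {0..<m}. k l \<in> polys V" "\<forall>l\<in>V - {0..<m}. k' l \<in> polys V"
    and f: "f - const_part m f = (\<Sum>l\<in>V - {0..<m}. mpoly_var l * k l)"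
    and g: "g - const_part m g = (\<Sum>l\<in>V - {0..<m}. mpoly_var l * k' l)"
    by (metis (no_types, lifting) add_diff_cancel_left')
  have "const_part m f = f - (f - const_part m f)" by simp
  also have "\<dots> \<in> polys V"
    unfolding f using mult.hyps k by (intro polys_closed) auto
  finally have cf: "const_part m f \<in> polys V" .
  have "f * g - const_part m (f * g) = (f - const_part m f) * g + const_part m f * (g - const_part m g)"
    by (simp add: const_part_simps algebra_simps)
  also have "\<dots> = (\<Sum>l\<in>V - {0..<m}. mpoly_var l * (k l * g + const_part m f * k' l))"
    unfolding f g by (simp add: sum_distrib_left sum_distrib_right sum.distrib algebra_simps)
  finally have "f * g = const_part m (f * g)
    + (\<Sum>l\<in>V - {0..<m}. mpoly_var l * (k l * g + const_part m f * k' l))"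
    by (simp add: algebra_simps)
  then show ?case
    using k cf mult.hyps by (intro exI[of _ "\<lambda>l. k l * g + const_part m f * k' l"]) (auto intro!: polys_closed)
qed

lemma prod_monom:
  fixes a :: "'i \<Rightarrow> 'r::comm_ring_1"
  shows "(\<Prod>i\<in>A. monom (a i) (e i)) = monom (\<Prod>i\<in>A. a i) (\<Sum>i\<in>A. e i)"
  by (induction A rule: infinite_finite_induct) (auto simp: mult_monom one_pCons monom_0)

locale weights =
  fixes m n :: nat and W :: "nat \<Rightarrow> int"
  assumes m_less_n: "m < n"
    and W_zero: "i < m \<Longrightarrow> W i = 0"
    and W_pos: "\<lbrakk>m \<le> i; i < n\<rbrakk> \<Longrightarrow> W i > 0"
begin

lemma W_nonneg: "i < n \<Longrightarrow> W i \<ge> 0"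
  using W_zero W_pos by (cases "i < m") (auto simp: less_imp_le)

lemma weight_poly_single:
  assumes "keys t \<subseteq> {0..<n}"
  shows "weight_poly W (single t c) = monom (single t c) (nat (weighted_degree W t))"
    and "weighted_degree W t \<ge> 0"
proof -
  have W: "W i \<ge> 0" if "i \<in> keys t" for i using assms W_nonneg that by auto
  then show "weighted_degree W t \<ge> 0" by (auto simp: weighted_degree_def intro!: sum_nonneg)
  have deg: "(\<Sum>i\<in>keys t. nat (W i) * lookup t i) = nat (weighted_degree W t)"
  proof -
    have "int (\<Sum>i\<in>keys t. nat (W i) * lookup t i) = weighted_degree W t"
      unfolding weighted_degree_def using W by (auto intro!: sum.cong)
    then show ?thesis by linarith
  qed
  have "weight_poly W (single t c) = [:mpoly_const c:] *
      (\<Prod>i\<in>keys t. monom (mpoly_var i) (nat (W i)) ^ lookup t i)"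
    unfolding weight_poly_def by (rule constp.mp_eval_single)
  also have "\<dots> = monom (single t c) (nat (weighted_degree W t))"
    by (simp add: monom_power prod_monom deg smult_monom single_eq_prod[symmetric])
  finally show "weight_poly W (single t c)
    = monom (single t c) (nat (weighted_degree W t))" .
qed

lemma coeff_weight_poly:
  assumes "f \<in> polys {0..<n}"
  shows "coeff (weight_poly W f) k = homogeneous_component W (int k) f"
proof -
  have "weight_poly W f = (\<Sum>t\<in>keys f.
      monom (single t (lookup f t)) (nat (weighted_degree W t)))"
    by (subst poly_mapping_sum_monomials[of f, symmetric], unfold weight_poly_simps, rule sum.cong)
      (use assms in \<open>auto simp: polys_iff weight_poly_single\<close>)
  then have "coeff (weight_poly W f) k = (\<Sum>t\<in>keys f.
      if nat (weighted_degree W t) = k then single t (lookup f t) else 0)"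
    by (simp add: coeff_sum)
  also have "\<dots> = (\<Sum>t\<in>keys f.
      if weighted_degree W t = int k then single t (lookup f t) else 0)"
  proof (rule sum.cong)
    fix t assume "t \<in> keys f"
    then have "weighted_degree W t \<ge> 0" using assms by (intro weight_poly_single) (auto simp: polys_iff)
    then show "(if nat (weighted_degree W t) = k then single t (lookup f t) else 0)
      = (if weighted_degree W t = int k then single t (lookup f t) else 0)" by auto
  qed simp
  also have "\<dots> = homogeneous_component W (int k) f"
    unfolding homogeneous_component_def by (rule sum.inter_filter[symmetric]) simp
  finally show ?thesis .
qed

lemma coeff_weight_poly_in_polys:
  assumes "f \<in> polys {0..<n}"
  shows "coeff (weight_poly W f) k \<in> polys {0..<n}"
  unfolding coeff_weight_poly[OF assms] homogeneous_component_def
  using assms by (intro polys_closed single_in_polys) (auto simp: polys_iff)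

lemma sum_coeff_weight_poly: "(\<Sum>k\<le>degree (weight_poly W f). coeff (weight_poly W f) k) = f"
proof -
  have "poly (weight_poly W f) 1 = f"
    by (induction f rule: mpoly_induct) (auto simp: weight_poly_simps poly_monom)
  then show ?thesis by (simp add: poly_altdef)
qed

lemma coeff_weight_poly_0:
  assumes "f \<in> polys {0..<n}"
  shows "coeff (weight_poly W f) 0 = const_part m f"
  using assms
proof (induction rule: polys_induct)
  case (var i)
  then show ?case using W_zero[of i] W_pos[of i] by (auto simp: weight_poly_simps const_part_simps)
qed (auto simp: weight_poly_simps const_part_simps coeff_mult_0)

text \<open>An indeterminate of weight \<open>w\<close> can occur in a term of degree \<open>w\<close> only linearly.\<close>

lemma homogeneous_linear_part:
  assumes "f \<in> polys {0..<n}" "subring_of S" "polys {0..<m} \<subseteq> S" "0 < w"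
    and S_vars: "\<And>i. \<lbrakk>m \<le> i; i < n; W i < int w\<rbrakk> \<Longrightarrow> mpoly_var i \<in> S"
  shows "(\<forall>k<w. coeff (weight_poly W f) k \<in> S) \<and>
    coeff (weight_poly W f) w - (\<Sum>l\<in>{l \<in> {m..<n}. W l = int w}. linear_coeff m l f * mpoly_var l) \<in> S"
    (is "?A f \<and> coeff _ _ - ?L f \<in> S")
proof -
  interpret S: subring_of S by fact
  note mem = subsetD[OF assms(3)]
  show ?thesis using assms(1)
  proof (induction rule: polys_induct)
    case (const c)
    then show ?case using assms(4) mem S.zero_closed
      by (auto simp: weight_poly_simps linear_coeff_simps coeff_pCons split: nat.splits)
  next
    case (var i)
    have "mpoly_var i \<in> S" if "W i < int w"
      using S_vars[of i] mem[of "mpoly_var i"] var that by (cases "i < m") auto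
    then have "?A (mpoly_var i)"
      using S.zero_closed W_nonneg[of i] var by (auto simp: weight_poly_simps)
    moreover have "coeff (weight_poly W (mpoly_var i)) w - ?L (mpoly_var i) = 0"
    proof -
      have "?L (mpoly_var i) = (\<Sum>l\<in>{l \<in> {m..<n}. W l = int w}. if l = i then mpoly_var i else 0)"
        by (rule sum.cong) (auto simp: linear_coeff_var)
      also have "\<dots> = (if m \<le> i \<and> i < n \<and> W i = int w then mpoly_var i else 0)"
        by simp
      also have "\<dots> = coeff (weight_poly W (mpoly_var i)) w"
        using var assms(4) W_zero[of i] W_nonneg[of i] by (auto simp: weight_poly_simps not_le)
      finally show ?thesis by simp
    qed
    ultimately show ?case using S.zero_closed by simp
  next
    case (add f g)
    have "?L (f + g) = ?L f + ?L g"
      by (simp add: linear_coeff_simps distrib_right sum.distrib)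
    then have "coeff (weight_poly W (f + g)) w - ?L (f + g)
        = (coeff (weight_poly W f) w - ?L f) + (coeff (weight_poly W g) w - ?L g)"
      by (simp add: weight_poly_simps)
    then have "coeff (weight_poly W (f + g)) w - ?L (f + g) \<in> S"
      using S.add_closed[OF conjunct2[OF add.IH(1)] conjunct2[OF add.IH(2)]] by (simp only:)
    then show ?case using add.IH S.add_closed by (simp add: weight_poly_simps)
  next
    case (mult f g)
    define a where "a = coeff (weight_poly W f)"
    define b where "b = coeff (weight_poly W g)"
    have ab: "a k \<in> S" "b k \<in> S" if "k < w" for k using mult.IH that by (auto simp: a_def b_def)
    have c: "coeff (weight_poly W (f * g)) k = (\<Sum>i\<le>k. a i * b (k - i))" for k
      by (simp add: weight_poly_simps coeff_mult a_def b_def)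
    have "?A (f * g)" unfolding c using ab by (auto intro!: S.closed)
    moreover have "coeff (weight_poly W (f * g)) w - ?L (f * g) \<in> S"
    proof -
      \<comment> \<open>Only the summands for \<open>i = 0\<close> and \<open>i = w\<close>,
        distinct because \<open>w > 0\<close>, contain a factor of degree \<open>w\<close>. The
        product rule distributes the linear part over these two, and the remaining summands are in
        \<open>S\<close> by the first half of the claim.\<close>
      have "(\<Sum>i\<le>w. a i * b (w - i)) = a 0 * b w + (a w * b 0 + (\<Sum>i\<in>{..w} - {0} - {w}. a i * b (w - i)))"
        using assms(4) by (simp add: sum.remove[of _ 0] sum.remove[of _ w])
      moreover have "?L (f * g) = a 0 * ?L g + b 0 * ?L f"
        by (simp add: linear_coeff_mult sum_distrib_left sum.distrib distrib_right mult.assoc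
            a_def b_def coeff_weight_poly_0 mult.hyps)
      ultimately have "coeff (weight_poly W (f * g)) w - ?L (f * g)
          = a 0 * (b w - ?L g) + b 0 * (a w - ?L f) + (\<Sum>i\<in>{..w} - {0} - {w}. a i * b (w - i))"
        by (simp add: c algebra_simps)
      also have "\<dots> \<in> S"
        using mult.IH ab assms(4) by (intro S.add_closed S.mult_closed S.sum_closed) (auto simp: a_def b_def)
      finally show ?thesis .
    qed
    ultimately show ?case by blast
  qed
qed

end

section \<open>Elimination of indeterminates\<close>

locale graded_ideal = weights m n W + I: ideal_in "polys {0..<n}" I
  for m n :: nat and W :: "nat \<Rightarrow> int" and I :: "'k::field mpoly set" +
  assumes homogeneous: "f \<in> I \<Longrightarrow> homogeneous_component W d f \<in> I"
    and degree_zero: "I \<inter> polys {0..<m} \<subseteq> {0}"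
begin

lemma coeff_in_I: "f \<in> I \<Longrightarrow> coeff (weight_poly W f) k \<in> I"
  using homogeneous I.I_in_R by (simp add: coeff_weight_poly)

text \<open>\<open>const_part\<close> is the component of degree 0, because the other indeterminates
  have positive weight. It lies both in \<open>I\<close> and in \<open>K[a]\<close>.\<close>

lemma const_part_I: "f \<in> I \<Longrightarrow> const_part m f = 0"
  using coeff_in_I[of f 0] I.I_in_R degree_zero const_part_in_polys[of m f]
  by (auto simp: coeff_weight_poly_0)

end

locale graded_ideal_at = graded_ideal m n W I + q: prime_in "polys {0..<m}" q
  for m n :: nat and W :: "nat \<Rightarrow> int" and I q :: "'k::field mpoly set"
begin

definition Q :: "'k mpoly set"
  where "Q = {f \<in> polys {0..<n}. const_part m f \<in> q}"

lemma prime_Q: "prime_in (polys {0..<n}) Q"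
  unfolding Q_def
  by (rule prime_in_vimage[OF q.prime_in_axioms subring_of_polys])
    (auto simp: const_part_simps const_part_in_polys)

lemma I_subset_Q: "I \<subseteq> Q"
  using I.I_in_R const_part_I q.p_zero by (auto simp: Q_def)

lemma linear_coeff_mult_const:
  assumes "f \<in> I" "a \<in> polys {0..<m}" "m \<le> l"
  shows "linear_coeff m l (a * f) = a * linear_coeff m l f"
  using assms by (simp add: linear_coeff_mult const_part_I const_part_id)

definition pivot_family :: "nat set \<Rightarrow> (nat \<Rightarrow> 'k mpoly) \<Rightarrow> bool"
  where "pivot_family J F \<longleftrightarrow> J \<subseteq> {m..<n} \<and> (\<forall>j\<in>J. F j \<in> I \<and> linear_coeff m j (F j) \<notin> q \<and>
    (\<forall>k\<in>J - {j}. linear_coeff m k (F j) \<in> q))"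

text \<open>The new equation \<open>f\<close> has its coefficients at \<open>J\<close> in
  \<open>q\<close>. Subtracting multiples of it clears the column \<open>l\<close> of the old
  equations and changes their columns \<open>J\<close> modulo \<open>q\<close> only by the factor
  \<open>linear_coeff m l f\<close>, which is outside \<open>q\<close>.\<close>

lemma pivot_family_extend:
  assumes "pivot_family J F" "f \<in> I" "\<forall>j\<in>J. linear_coeff m j f \<in> q" "l \<in> {m..<n}" "linear_coeff m l f \<notin> q"
  shows "\<exists>F'. pivot_family (insert l J) F'"
proof -
  let ?D = "linear_coeff m"
  have l: "l \<notin> J" "m \<le> l" "l < n" using assms by auto
  have J: "m \<le> j" "F j \<in> I" "?D j (F j) \<notin> q" if "j \<in> J" for j
    using assms(1) that by (auto simp: pivot_family_def)
  have off: "?D k (F j) \<in> q" if "j \<in> J" "k \<in> J" "k \<noteq> j" for j k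
    using assms(1) that by (auto simp: pivot_family_def)
  note D_polys = linear_coeff_in_polys
  define F' where "F' j = (if j = l then f else ?D l f * F j - ?D l (F j) * f)" for j
  have fR: "f \<in> polys {0..<n}" using assms(2) I.I_in_R by blast
  have sub: "polys {0..<m} \<subseteq> (polys {0..<n} :: 'k mpoly set)" using m_less_n by (intro polys_mono) auto
  have F': "?D k (F' j) = ?D l f * ?D k (F j) - ?D l (F j) * ?D k f" if "j \<in> J" "m \<le> k" for j k
    using that l linear_coeff_mult_const[OF J(2)[OF that(1)] D_polys[OF l(2), of f] that(2)]
      linear_coeff_mult_const[OF assms(2) D_polys[OF l(2), of "F j"] that(2)]
    by (auto simp: F'_def linear_coeff_simps)
  have "F' j \<in> I" if "j \<in> J" for j
    using that l(1) J(2)[OF that] assms(2) subsetD[OF sub D_polys[OF l(2)]]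
    by (auto simp: F'_def intro!: I.I_diff I.I_mult)
  moreover have "?D j (F' j) \<notin> q" if "j \<in> J" for j
  proof
    assume "?D j (F' j) \<in> q"
    moreover have "?D l (F j) * ?D j f \<in> q"
      using assms(3) that D_polys[OF l(2)] by (intro q.p_mult) auto
    ultimately have "?D l f * ?D j (F j) \<in> q"
      using q.p_add[of "?D j (F' j)" "?D l (F j) * ?D j f"] F'[OF that J(1)[OF that]] by simp
    then show False
      using q.p_prime[OF D_polys[OF l(2)] D_polys[OF J(1)[OF that]]] assms(5) J(3)[OF that] by blast
  qed
  moreover have "?D k (F' j) \<in> q" if "j \<in> J" "k \<in> J" "k \<noteq> j" for j k
    using off[OF that] assms(3) that D_polys[OF l(2)]
    unfolding F'[OF that(1) J(1)[OF that(2)]] by (intro q.p_diff q.p_mult) auto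
  moreover have "?D l (F' j) \<in> q" if "j \<in> J" for j
    unfolding F'[OF that l(2)] using q.p_zero by (simp add: mult.commute)
  moreover have "F' l = f" by (simp add: F'_def)
  ultimately have "pivot_family (insert l J) F'"
    using assms l unfolding pivot_family_def by auto
  then show ?thesis by blast
qed

lemma ex_maximal_pivot_family:
  obtains J F where "pivot_family J F"
    and "\<And>f l. \<lbrakk>f \<in> I; \<forall>j\<in>J. linear_coeff m j f \<in> q; l \<in> {m..<n}\<rbrakk> \<Longrightarrow> linear_coeff m l f \<in> q"
proof -
  have "pivot_family {} (\<lambda>_. 0)" by (simp add: pivot_family_def)
  then have ex: "\<exists>F. pivot_family {} F" by blast
  have bound: "card J < Suc n" if "\<exists>F. pivot_family J F" for J
  proof -
    have "card J \<le> card {m..<n}" using that by (intro card_mono) (auto simp: pivot_family_def)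
    then show ?thesis by simp
  qed
  obtain J where J: "\<exists>F. pivot_family J F" "\<And>J'. \<exists>F. pivot_family J' F \<Longrightarrow> card J' \<le> card J"
    using ex_has_greatest_nat[of "\<lambda>J. \<exists>F. pivot_family J F" "{}" card "Suc n"] ex bound by metis
  then obtain F where F: "pivot_family J F" by blast
  have "linear_coeff m l f \<in> q" if f: "f \<in> I" "\<forall>j\<in>J. linear_coeff m j f \<in> q" "l \<in> {m..<n}" for f l
  proof (rule ccontr)
    assume neg: "linear_coeff m l f \<notin> q"
    then have "l \<notin> J" using f by blast
    moreover have "finite J" using F finite_subset by (auto simp: pivot_family_def)
    ultimately have "card (insert l J) = Suc (card J)" by simp
    with J(2)[OF pivot_family_extend[OF F f neg]] show False by simp
  qed
  with F that show thesis by blast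
qed

end

locale pivots = graded_ideal_at m n W I q
  for m n :: nat and W :: "nat \<Rightarrow> int" and I q :: "'k::field mpoly set" +
  fixes J :: "nat set" and F :: "nat \<Rightarrow> 'k mpoly"
  assumes pivots: "pivot_family J F"
    and maximal: "\<lbrakk>f \<in> I; \<forall>j\<in>J. linear_coeff m j f \<in> q; l \<in> {m..<n}\<rbrakk> \<Longrightarrow> linear_coeff m l f \<in> q"
begin

abbreviation V :: "nat set" where "V \<equiv> {0..<n} - J"

lemma J_subset: "J \<subseteq> {m..<n}"
  and F_I: "j \<in> J \<Longrightarrow> F j \<in> I"
  and F_diag: "j \<in> J \<Longrightarrow> linear_coeff m j (F j) \<notin> q"
  and F_off: "\<lbrakk>j \<in> J; k \<in> J; k \<noteq> j\<rbrakk> \<Longrightarrow> linear_coeff m k (F j) \<in> q"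
  using pivots by (auto simp: pivot_family_def)

lemma polys_m_subset_V: "polys {0..<m} \<subseteq> polys V"
  using J_subset m_less_n by (intro polys_mono) auto

lemma polys_V_subset: "polys V \<subseteq> polys {0..<n}"
  by (intro polys_mono) auto

text \<open>The preimage of the image of \<open>polys V\<close> in the quotient by \<open>I\<close>,
  localized at the elements of \<open>K[a]\<close> outside \<open>q\<close>. It is a subring in
  which such denominators can be cancelled, as \<open>homogeneous_linear_part\<close> and
  \<open>elimination\<close> demand, and in the end it contains all of \<open>P\<close>.\<close>

definition S :: "'k mpoly set"
  where "S = {f. \<exists>g\<in>polys {0..<m} - q. \<exists>b\<in>polys V. g * f - b \<in> I}"

lemma SI: "\<lbrakk>g \<in> polys {0..<m} - q; b \<in> polys V; g * f - b \<in> I\<rbrakk> \<Longrightarrow> f \<in> S"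
  unfolding S_def by blast

lemma polys_V_S: "polys V \<subseteq> S"
  using q.notin_one I.I_zero by (auto intro!: SI[of 1])

lemma I_S: "I \<subseteq> S"
  using q.notin_one by (auto intro!: SI[of 1 0] simp: polys_closed(1))

lemma subring_S: "subring_of S"
proof
  show "1 \<in> S" using polys_V_S polys_closed(2) by blast
  fix x y assume "x \<in> S" "y \<in> S"
  then obtain g b h c where x: "g \<in> polys {0..<m} - q" "b \<in> polys V" "g * x - b \<in> I"
    and y: "h \<in> polys {0..<m} - q" "c \<in> polys V" "h * y - c \<in> I"
    unfolding S_def by blast
  have sub: "polys {0..<m} \<subseteq> (polys {0..<n} :: 'k mpoly set)" using m_less_n by (intro polys_mono) auto
  have gh: "g \<in> polys V" "h \<in> polys V" "g \<in> polys {0..<n}" "h \<in> polys {0..<n}" "b \<in> polys {0..<n}" "c \<in> polys {0..<n}"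
    using x y polys_m_subset_V polys_V_subset sub by blast+
  have "g * h * (x - y) - (h * b - g * c) = h * (g * x - b) - g * (h * y - c)"
    by (simp add: algebra_simps)
  also have "\<dots> \<in> I" by (rule I.I_diff[OF I.I_mult[OF gh(4) x(3)] I.I_mult[OF gh(3) y(3)]])
  finally show "x - y \<in> S"
    using x y gh q.notin_mult by (intro SI[of "g * h" "h * b - g * c"] polys_closed) auto
  have "g * h * (x * y) - b * c = (h * y) * (g * x - b) + b * (h * y - c)"
    by (simp add: algebra_simps)
  also have "\<dots> \<in> I"
  proof -
    \<comment> \<open>The definition of \<open>S\<close> does not place \<open>y\<close> in
      \<open>polys {0..<n}\<close>, but \<open>h * y\<close> is there, being congruent to
      \<open>c\<close> modulo \<open>I\<close>.\<close>
    have "h * y \<in> polys {0..<n}" using I.add_closed[OF I.I_in_R[OF y(3)] gh(6)] by simp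
    then show ?thesis by (rule I.I_add[OF I.I_mult[OF _ x(3)] I.I_mult[OF gh(5) y(3)]])
  qed
  finally show "x * y \<in> S"
    using x y gh q.notin_mult by (intro SI[of "g * h" "b * c"] polys_closed) auto
qed

lemma S_cancel:
  assumes "r \<in> polys {0..<m} - q" "r * x \<in> S"
  shows "x \<in> S"
proof -
  obtain g b where "g \<in> polys {0..<m} - q" "b \<in> polys V" "g * (r * x) - b \<in> I"
    using assms(2) unfolding S_def by blast
  then show ?thesis
    using assms q.notin_mult by (intro SI[of "g * r" b]) (auto simp: mult.assoc)
qed

text \<open>Modulo \<open>I\<close>, the homogeneous linear equations given by the pivots express the indeterminates \<open>J\<close>
  by the others and by indeterminates of smaller weight, once elements outside \<open>q\<close> are inverted.\<close>

lemma var_S: "i < n \<Longrightarrow> mpoly_var i \<in> S"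
proof (induction "nat (W i)" arbitrary: i rule: less_induct)
  case less
  show ?case
  proof (cases "i \<in> J")
    case False
    then show ?thesis using less.prems polys_V_S by (auto intro!: subsetD[OF polys_V_S])
  next
    case True
    interpret S: subring_of S by (rule subring_S)
    define w where "w = nat (W i)"
    have w: "int w = W i" "0 < w" using True J_subset W_pos[of i] by (auto simp: w_def)
    define L where "L = {l \<in> {m..<n}. W l = int w}"
    define Jw where "Jw = {j \<in> J. W j = int w}"
    have Jw: "finite Jw" "Jw \<subseteq> L" "i \<in> Jw" "Jw \<subseteq> J"
      using J_subset True w finite_subset[of Jw "{m..<n}"] by (auto simp: Jw_def L_def)
    have fin_L: "finite L" by (simp add: L_def)
    have m_S: "polys {0..<m} \<subseteq> S" using polys_m_subset_V polys_V_S by blast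
    have D_S: "linear_coeff m l f \<in> S" if "l \<in> L" for l f
      using that linear_coeff_in_polys[of m l f] m_S by (auto simp: L_def)
    \<comment> \<open>The component of weight \<open>w\<close> of \<open>F j\<close> is in
      \<open>I\<close>, hence in \<open>S\<close>, and it equals its linear terms up to an element
      of \<open>S\<close>. The linear terms at indeterminates outside \<open>J\<close> are in
      \<open>S\<close> as well. What remains is one equation modulo \<open>S\<close> for each pivot
      of weight \<open>w\<close>: a square system.\<close>
    have lin: "(\<Sum>k\<in>Jw. linear_coeff m k (F j) * mpoly_var k) \<in> S" if "j \<in> Jw" for j
    proof -
      have j: "F j \<in> I" using that F_I Jw by blast
      have "coeff (weight_poly W (F j)) w - (\<Sum>l\<in>L. linear_coeff m l (F j) * mpoly_var l) \<in> S"
        unfolding L_def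
      proof (rule conjunct2[OF homogeneous_linear_part[OF I.I_in_R[OF j] subring_S m_S w(2)]])
        fix k assume "m \<le> k" "k < n" "W k < int w"
        then show "mpoly_var k \<in> S" using w W_nonneg[of k] by (intro less.hyps) auto
      qed
      moreover have "coeff (weight_poly W (F j)) w \<in> S" using I_S coeff_in_I[OF j] by blast
      ultimately have "(\<Sum>l\<in>L. linear_coeff m l (F j) * mpoly_var l) \<in> S"
        using S.diff_closed by fastforce
      moreover have "(\<Sum>l\<in>L - Jw. linear_coeff m l (F j) * mpoly_var l) \<in> S"
      proof (intro S.sum_closed S.mult_closed D_S)
        fix l assume "l \<in> L - Jw"
        then show "l \<in> L" "mpoly_var l \<in> S" by (auto simp: L_def Jw_def intro!: subsetD[OF polys_V_S])
      qed
      ultimately have "(\<Sum>l\<in>L. linear_coeff m l (F j) * mpoly_var l)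
          - (\<Sum>l\<in>L - Jw. linear_coeff m l (F j) * mpoly_var l) \<in> S"
        by (rule S.diff_closed)
      then show ?thesis
        by (simp add: sum.subset_diff[OF Jw(2) fin_L, of "\<lambda>l. linear_coeff m l (F j) * mpoly_var l"])
    qed
    show ?thesis
    proof (rule q.elimination[where J = Jw and c = "\<lambda>j k. linear_coeff m k (F j)" and S = S and x = mpoly_var])
      show "linear_coeff m k (F j) \<in> polys {0..<m}" if "k \<in> Jw" for j k
        using that J_subset Jw by (intro linear_coeff_in_polys) auto
      show "linear_coeff m k (F j) \<in> q" if "j \<in> Jw" "k \<in> Jw" "j \<noteq> k" for j k
        using F_off[of j k] that Jw by auto
    qed (use Jw F_diag lin S_cancel m_S in \<open>auto intro: S.closed\<close>)
  qed
qed

lemma denominator: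
  assumes "f \<in> polys {0..<n}"
  shows "\<exists>g\<in>polys {0..<m} - q. \<exists>b\<in>polys V. g * f - b \<in> I"
proof -
  have "f \<in> S"
    using assms
  proof (induction rule: polys_induct)
    case (const c)
    then show ?case using polys_V_S by auto
  qed (auto intro: var_S subring_of.closed[OF subring_S])
  then show ?thesis by (simp add: S_def)
qed

lemma common_denominator:
  assumes "finite Z" "Z \<subseteq> polys {0..<n}"
  shows "\<exists>g\<in>polys {0..<m} - q. \<forall>x\<in>Z. \<exists>b\<in>polys V. g * x - b \<in> I"
  using assms
proof (induction Z rule: finite_induct)
  case empty
  then show ?case using q.notin_one by blast
next
  case (insert x Z)
  then obtain g where g: "g \<in> polys {0..<m} - q" "\<forall>x\<in>Z. \<exists>b\<in>polys V. g * x - b \<in> I" by auto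
  obtain h b where h: "h \<in> polys {0..<m} - q" "b \<in> polys V" "h * x - b \<in> I"
    using denominator[of x] insert.prems by blast
  have gh: "g \<in> polys V" "h \<in> polys V" using g h polys_m_subset_V by auto
  have step: "\<exists>b\<in>polys V. a * c * y - b \<in> I"
    if "a \<in> polys V" "b \<in> polys V" "c * y - b \<in> I" for a b c y
  proof -
    have "a * c * y - a * b = a * (c * y - b)" by (simp add: algebra_simps)
    also have "\<dots> \<in> I" using that polys_V_subset by (intro I.I_mult) auto
    finally show ?thesis using that by (intro bexI[of _ "a * b"] polys_closed)
  qed
  have "\<exists>b\<in>polys V. g * h * y - b \<in> I" if "y \<in> insert x Z" for y
  proof (cases "y = x")
    case True
    have "\<exists>b\<in>polys V. g * h * x - b \<in> I" by (rule step[OF gh(1) h(2,3)])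
    then show ?thesis by (simp only: True)
  next
    case False
    then have "y \<in> Z" using that by simp
    from bspec[OF g(2) this] obtain c where c: "c \<in> polys V" "g * y - c \<in> I" ..
    have "\<exists>b\<in>polys V. h * g * y - b \<in> I" by (rule step[OF gh(2) c])
    then show ?thesis by (simp only: mult.commute[of g h])
  qed
  then show ?case using q.notin_mult[OF g(1) h(1)] by blast
qed

definition QV :: "'k mpoly set"
  where "QV = Q \<inter> polys V"

lemma prime_QV: "prime_in (polys V) QV"
  unfolding QV_def by (rule prime_in_Int[OF prime_Q subring_of_polys polys_V_subset])

text \<open>An element \<open>f\<close> that separates two primes between \<open>I\<close> and
  \<open>Q\<close> can be moved into \<open>polys V\<close>: \<open>g * f\<close> still separates
  them because \<open>g\<close> is outside \<open>Q\<close>, and so does the element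
  \<open>b\<close> congruent to it modulo \<open>I\<close>.\<close>

lemma contraction_strict:
  assumes "prime_in (polys {0..<n}) c" "prime_in (polys {0..<n}) c'" "c \<subset> c'" "I \<subseteq> c" "c' \<subseteq> Q"
  shows "c \<inter> polys V \<subset> c' \<inter> polys V"
proof -
  interpret c: prime_in "polys {0..<n}" c by fact
  interpret c': prime_in "polys {0..<n}" c' by fact
  obtain f where f: "f \<in> c'" "f \<notin> c" using assms(3) by blast
  obtain g b where g: "g \<in> polys {0..<m} - q" "b \<in> polys V" "g * f - b \<in> I"
    using denominator[OF c'.in_R[OF f(1)]] by blast
  have gR: "g \<in> polys {0..<n}" using g polys_m_subset_V polys_V_subset by blast
  have "g \<notin> Q" using g by (auto simp: Q_def const_part_id)
  then have "g \<notin> c" using assms(3,5) by blast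
  then have "g * f \<notin> c" using c.p_prime[OF gR c'.in_R[OF f(1)]] f(2) by blast
  moreover have "g * f - b \<in> c" "g * f - b \<in> c'" using g(3) assms(3,4) by auto
  ultimately have "b \<notin> c" using c.p_add[of "g * f - b" b] by auto
  moreover have "b \<in> c'"
    using c'.p_diff[OF c'.p_mult[OF gR f(1)] \<open>g * f - b \<in> c'\<close>] by simp
  ultimately show ?thesis using g(2) assms(3) by blast
qed

text \<open>Elements of \<open>I\<close> in the indeterminates \<open>V\<close> have no linear terms
  in \<open>J\<close>, so maximality of the pivots puts all their linear coefficients into
  \<open>q\<close>. Written as a sum of multiples \<open>k l * mpoly_var l\<close>, such an element
  has cofactors \<open>k l\<close> whose constant parts are these coefficients. Hence both factors
  of each summand lie in \<open>QV\<close>.\<close>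

lemma I_Int_loc_span_p:
  assumes span: "\<And>f. f \<in> QV \<Longrightarrow> f \<in> prime_in.loc_span (polys V) QV A h"
    and f: "f \<in> I" "f \<in> polys V"
  shows "f \<in> prime_in.loc_span_p (polys V) QV A h"
proof -
  interpret QV: prime_in "polys V" QV by (rule prime_QV)
  have q_f: "linear_coeff m l f \<in> q" if l: "l \<in> {m..<n}" for l
  proof (rule maximal[OF f(1) _ l])
    show "\<forall>j\<in>J. linear_coeff m j f \<in> q"
      using linear_coeff_eq_0[OF f(2)] J_subset q.p_zero by auto
  qed
  obtain k where k: "\<forall>l\<in>V - {0..<m}. k l \<in> polys V"
    and eq: "f = const_part m f + (\<Sum>l\<in>V - {0..<m}. mpoly_var l * k l)"
    using const_part_decompose[OF f(2)] by auto
  have f_sum: "f = (\<Sum>l\<in>V - {0..<m}. k l * mpoly_var l)"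
    using eq const_part_I[OF f(1)] by (simp add: mult.commute)
  have "k l * mpoly_var l \<in> QV.loc_span_p A h" if l: "l \<in> V - {0..<m}" for l
  proof (rule QV.loc_span_p_mult)
    have "linear_coeff m l f = (\<Sum>l'\<in>V - {0..<m}. if l' = l then const_part m (k l) else 0)"
      unfolding f_sum linear_coeff_simps
    proof (rule sum.cong)
      fix l' assume "l' \<in> V - {0..<m}"
      then show "linear_coeff m l (k l' * mpoly_var l') = (if l' = l then const_part m (k l) else 0)"
        using l by (auto simp: linear_coeff_mult linear_coeff_var const_part_simps)
    qed simp
    then have "const_part m (k l) = linear_coeff m l f" using l by simp
    then have "const_part m (k l) \<in> q" using q_f l by auto
    then show "k l \<in> QV" using k l polys_V_subset by (auto simp: QV_def Q_def)
    show "mpoly_var l \<in> QV.loc_span A h"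
      using l q.p_zero by (intro span) (auto simp: QV_def Q_def const_part_simps)
  qed
  then show ?thesis by (subst f_sum) (rule QV.loc_span_p_sum)
qed

end

section \<open>Regularity\<close>

lemma prime_in_zero_polys: "prime_in (polys V) {0 :: 'k::field mpoly}"
  using prime_in_Int[OF prime_in_zero subring_of_polys, of V] by (simp add: polys_closed(1))

context pivots
begin

text \<open>With \<open>T\<close> and \<open>h\<close> from \<open>prime_local_parameters\<close>,
  the inequalities \<open>card (V - T) \<le> card Y \<le> l \<le> card (V - T)\<close> close up: the
  first compares generators with independent elements of the cotangent space, the second is
  regularity, the third is \<open>prime_chain_length\<close>. The second conclusion keeps the chain
  for the computation of the dimension.\<close>

theorem regular_structure:
  assumes "regular_ring (mpoly_ring {0..<n} Quot I)"
  shows "I \<inter> polys V \<subseteq> {0}"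
    and "\<exists>T c l. T \<subseteq> V \<and> Q \<inter> polys T \<subseteq> {0} \<and> prime_chain (polys {0..<n}) c l \<and> I \<subseteq> c 0 \<and>
      l + card T = card V"
proof -
  interpret Q: prime_in "polys {0..<n}" Q by (rule prime_Q)
  interpret QV: prime_in "polys V" QV by (rule prime_QV)
  have finV: "finite V" by simp
  have QV_iff: "f \<in> QV \<longleftrightarrow> f \<in> Q" if "f \<in> polys V" for f using that by (simp add: QV_def)
  have m_notin_Q: "g \<notin> Q" if "g \<in> polys {0..<m} - q" for g
    using that by (auto simp: Q_def const_part_id)
  obtain Y c l where Y: "finite Y" "Y \<subseteq> Q" and c: "prime_chain (polys {0..<n}) c l" "I \<subseteq> c 0" "c l \<subseteq> Q"
    and card_Y: "card Y \<le> l"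
    and gen: "\<forall>f\<in>Q. \<exists>u\<in>polys {0..<n} - Q. \<exists>g. (\<forall>y\<in>Y. g y \<in> polys {0..<n}) \<and> u * f - (\<Sum>y\<in>Y. g y * y) \<in> I"
    using regular_quot_polys[OF I.ideal_in_axioms prime_Q I_subset_Q assms]
    by (elim exE conjE) (rule that; assumption)
  obtain T h where T: "T \<subseteq> V" "QV \<inter> polys T \<subseteq> {0}" and h: "\<forall>v\<in>V - T. h v \<in> QV"
    and span: "\<forall>f\<in>QV. f \<in> QV.loc_span (V - T) h"
    and indep: "\<forall>g. (\<forall>v\<in>V - T. g v \<in> polys V) \<longrightarrow> (\<Sum>v\<in>V - T. g v * h v) = 0 \<longrightarrow> (\<forall>v\<in>V - T. g v \<in> QV)"
    using prime_local_parameters[OF finV prime_QV] by (elim exE conjE) (rule that; assumption)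
  have YR: "Y \<subseteq> polys {0..<n}" using Y(2) Q.p_subset by blast
  obtain d where d: "d \<in> polys {0..<m} - q" "\<forall>y\<in>Y. \<exists>b\<in>polys V. d * y - b \<in> I"
    using common_denominator[OF Y(1) YR] by blast
  have dV: "d \<in> polys V" "d \<notin> Q" "d \<in> polys {0..<n}"
    using d(1) polys_m_subset_V m_notin_Q polys_V_subset by auto
  have "\<forall>y\<in>Y. \<exists>b. b \<in> polys V \<and> d * y - b \<in> I" using d(2) by blast
  from bchoice[OF this] obtain b where b: "\<forall>y\<in>Y. b y \<in> polys V \<and> d * y - b y \<in> I" ..
  have bQV: "b y \<in> QV" if "y \<in> Y" for y
  proof -
    have "d * y \<in> Q" using that Y(2) dV by (intro Q.p_mult) auto
    moreover have "d * y - b y \<in> Q" using b that I_subset_Q by blast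
    ultimately have "b y \<in> Q" using Q.p_diff[of "d * y" "d * y - b y"] by simp
    then show ?thesis using b that by (simp add: QV_def)
  qed
  have "card (V - T) \<le> card Y"
  proof (rule QV.card_le_generators[where h = h and y = b])
    show "finite (V - T)" "finite Y" using Y by auto
    show "h a \<in> polys V" if "a \<in> V - T" for a using h that QV.in_R by blast
    show "\<forall>a\<in>V - T. g a \<in> QV"
      if "\<And>a. a \<in> V - T \<Longrightarrow> g a \<in> polys V" "(\<Sum>a\<in>V - T. g a * h a) = 0" for g
      using indep that by blast
    show "\<exists>v\<in>polys V - QV. \<exists>G. (\<forall>a\<in>V - T. G a \<in> polys V) \<and> v * b y = (\<Sum>a\<in>V - T. G a * h a)"
      if "y \<in> Y" for y
      using bspec[OF span bQV[OF that]] unfolding QV.loc_span_def by blast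
    show "\<exists>u\<in>polys V - QV. \<exists>C E. (\<forall>y\<in>Y. C y \<in> polys V) \<and> (\<forall>a\<in>V - T. E a \<in> QV) \<and>
        u * h a = (\<Sum>y\<in>Y. C y * b y) + (\<Sum>a\<in>V - T. E a * h a)" if a: "a \<in> V - T" for a
    proof -
      have ha: "h a \<in> Q" "h a \<in> polys V" using h a by (auto simp: QV_def)
      obtain u g where u: "u \<in> polys {0..<n} - Q" and g: "\<forall>y\<in>Y. g y \<in> polys {0..<n}"
        and ug: "u * h a - (\<Sum>y\<in>Y. g y * y) \<in> I" using gen ha by blast
      have fin: "finite (insert u (g ` Y))" "insert u (g ` Y) \<subseteq> polys {0..<n}" using Y u g by auto
      obtain e where e: "e \<in> polys {0..<m} - q" "\<forall>x\<in>insert u (g ` Y). \<exists>b\<in>polys V. e * x - b \<in> I"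
        using common_denominator[OF fin] by blast
      have eR: "e \<in> polys {0..<n}" "e \<notin> Q"
        using e(1) polys_m_subset_V polys_V_subset m_notin_Q by auto
      obtain u' where u': "u' \<in> polys V" "e * u - u' \<in> I" using e(2) by blast
      have "\<forall>y\<in>Y. \<exists>b. b \<in> polys V \<and> e * g y - b \<in> I" using e(2) by blast
      from bchoice[OF this] obtain g' where g': "\<forall>y\<in>Y. g' y \<in> polys V \<and> e * g y - g' y \<in> I" ..
      \<comment> \<open>The equation for \<open>h a\<close> modulo \<open>I\<close> is rewritten
        with all entries in \<open>polys V\<close>, at the cost of the denominators \<open>d\<close>
        and \<open>e\<close>. The error \<open>\<epsilon>\<close> lies in \<open>I\<close> and in
        \<open>polys V\<close>, so it is locally a combination of \<open>h\<close> with coefficients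
        in \<open>QV\<close>.\<close>
      define \<epsilon> where "\<epsilon> = d * u' * h a - (\<Sum>y\<in>Y. g' y * b y)"
      have V_R: "x \<in> polys {0..<n}" if "x \<in> polys V" for x :: "'k mpoly" using that polys_V_subset by blast
      have "\<epsilon> = d * e * (u * h a - (\<Sum>y\<in>Y. g y * y)) - d * h a * (e * u - u')
          + (\<Sum>y\<in>Y. d * y * (e * g y - g' y) + g' y * (d * y - b y))"
        by (simp add: \<epsilon>_def sum_distrib_left sum.distrib sum_subtractf algebra_simps)
      also have "\<dots> \<in> I"
      proof (intro I.I_add[OF I.I_diff I.I_sum] I.I_add I.I_mult[OF _ ug] I.I_mult[OF _ u'(2)])
        show "d * e \<in> polys {0..<n}" "d * h a \<in> polys {0..<n}"
          using dV eR V_R[OF ha(2)] by (auto intro!: polys_closed)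
        fix y assume y: "y \<in> Y"
        show "d * y * (e * g y - g' y) \<in> I" "g' y * (d * y - b y) \<in> I"
          using y g' b dV YR V_R by (auto intro!: I.I_mult polys_closed(6))
      qed
      finally have \<epsilon>I: "\<epsilon> \<in> I" .
      have \<epsilon>V: "\<epsilon> \<in> polys V"
        unfolding \<epsilon>_def using dV u' ha g' b by (intro polys_closed) auto
      from I_Int_loc_span_p[OF bspec[OF span] \<epsilon>I \<epsilon>V]
      obtain v E where v: "v \<in> polys V - QV" "\<forall>a\<in>V - T. E a \<in> QV" "v * \<epsilon> = (\<Sum>a\<in>V - T. E a * h a)"
        by (rule QV.loc_span_pE)
      have "u' \<notin> Q"
      proof
        assume "u' \<in> Q"
        then have "e * u \<in> Q" using Q.p_add[of "e * u - u'" u'] I_subset_Q u'(2) by auto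
        then show False using Q.p_prime[of e u] eR u by blast
      qed
      then have "v * (d * u') \<in> polys V - QV"
        using v(1) dV u' QV_iff by (intro QV.notin_mult) auto
      moreover have "v * (d * u') * h a = (\<Sum>y\<in>Y. (v * g' y) * b y) + (\<Sum>a\<in>V - T. E a * h a)"
        by (simp add: v(3)[symmetric] \<epsilon>_def sum_distrib_left algebra_simps)
      moreover have "\<forall>y\<in>Y. v * g' y \<in> polys V" using v(1) g' by (auto intro!: polys_closed)
      ultimately show ?thesis
        using v(2) by (intro bexI[of _ "v * (d * u')"] exI[of _ "\<lambda>y. v * g' y"] exI[of _ E]) auto
    qed
  qed
  then have card: "card V \<le> l + card T"
    using card_Y card_Diff_subset[OF finite_subset[OF T(1) finV] T(1)] by simp
  define c' where "c' i = c i \<inter> polys V" for i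
  have c_Q: "c i \<subseteq> Q" "I \<subseteq> c i" if "i \<le> l" for i
  proof -
    have mono: "c i \<subseteq> c (i + k)" if "i + k \<le> l" for i k
      using that
    proof (induction k)
      case (Suc k)
      then have "c (i + k) \<subset> c (Suc (i + k))" using c(1) by (auto simp: prime_chain_def)
      then show ?case using Suc by auto
    qed simp
    show "c i \<subseteq> Q" using mono[of i "l - i"] that c(3) by simp
    show "I \<subseteq> c i" using mono[of 0 i] that c(2) by simp
  qed
  have c': "prime_chain (polys V) c' l"
    unfolding prime_chain_def c'_def
  proof (intro conjI allI impI)
    show "prime_in (polys V) (c i \<inter> polys V)" if "i \<le> l" for i
      using that c(1) by (intro prime_in_Int[OF _ subring_of_polys polys_V_subset]) (auto simp: prime_chain_def)
    show "c i \<inter> polys V \<subset> c (Suc i) \<inter> polys V" if "i < l" for i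
      using that c(1) c_Q by (intro contraction_strict) (auto simp: prime_chain_def)
  qed
  have c'_T: "c' l \<inter> polys T \<subseteq> {0}"
    using T c_Q[of l] by (auto simp: c'_def QV_def)
  show "I \<inter> polys V \<subseteq> {0}"
  proof (rule ccontr)
    assume neg: "\<not> I \<inter> polys V \<subseteq> {0}"
    \<comment> \<open>A nonzero element of \<open>I\<close> in \<open>polys V\<close> also lies in
      \<open>c' 0\<close>, so \<open>{0}\<close> can be put strictly below the chain, which then
      exceeds its bound by one.\<close>
    define c'' where "c'' i = (case i of 0 \<Rightarrow> {0} | Suc j \<Rightarrow> c' j)" for i
    have "{0} \<subset> c' 0"
      using neg c(2) prime_in.p_zero[of "polys V" "c' 0"] c' by (auto simp: c'_def prime_chain_def)
    then have "prime_chain (polys V) c'' (Suc l)"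
      using c' prime_in_zero_polys by (auto simp: prime_chain_def c''_def split: nat.splits)
    from prime_chain_length[OF finV T(1) this] c'_T card show False by (simp add: c''_def)
  qed
  have "l + card T = card V"
    using prime_chain_length[OF finV T(1) c' c'_T] card by simp
  moreover have "Q \<inter> polys T \<subseteq> {0}"
    using T(2) polys_mono[OF T(1)] by (auto simp: QV_def)
  ultimately show "\<exists>T c l. T \<subseteq> V \<and> Q \<inter> polys T \<subseteq> {0} \<and> prime_chain (polys {0..<n}) c l \<and> I \<subseteq> c 0 \<and>
      l + card T = card V"
    using T(1) c by blast
qed

end

section \<open>Torsion-freeness over the part of degree 0, and primality\<close>

context graded_ideal
begin

lemma one_notin_I: "1 \<notin> I"
  using const_part_I[of 1] by (auto simp: const_part_simps)

lemma polys_m_subset: "polys {0..<m} \<subseteq> polys {0..<n}"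
  using m_less_n by (intro polys_mono) auto

lemma ex_pivots:
  assumes "prime_in (polys {0..<m}) q"
  obtains J F where "pivots m n W I q J F"
proof -
  interpret q: prime_in "polys {0..<m}" q by fact
  interpret graded_ideal_at m n W I q ..
  obtain J F where "pivot_family J F"
    "\<And>f l. \<lbrakk>f \<in> I; \<forall>j\<in>J. linear_coeff m j f \<in> q; l \<in> {m..<n}\<rbrakk> \<Longrightarrow> linear_coeff m l f \<in> q"
    using ex_maximal_pivot_family by blast
  then have "pivots m n W I q J F" by unfold_locales
  then show thesis by (rule that)
qed

text \<open>From local to global: if \<open>f\<close> were not in \<open>I\<close>, its annihilator
  \<open>a\<close> modulo \<open>I\<close> would lie in a prime \<open>q\<close>. At
  \<open>q\<close> a multiple \<open>g * f\<close> is congruent to some \<open>b\<close> in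
  \<open>polys V\<close>. Then \<open>h * b\<close> is in \<open>I \<inter> polys V\<close>, hence
  zero, so \<open>b = 0\<close> and \<open>g\<close> is in the annihilator, although
  \<open>g\<close> is outside \<open>q\<close>.\<close>

lemma regular_torsion_free:
  assumes regular: "regular_ring (mpoly_ring {0..<n} Quot I)"
    and h: "h \<in> polys {0..<m}" "h \<noteq> 0" and f: "f \<in> polys {0..<n}" "h * f \<in> I"
  shows "f \<in> I"
proof (rule ccontr)
  assume neg: "f \<notin> I"
  define a where "a = {g \<in> polys {0..<m}. g * f \<in> I}"
  interpret a: ideal_in "polys {0..<m}" a
  proof (rule ideal_in.intro[OF subring_of_polys], unfold_locales)
    show "a \<subseteq> polys {0..<m}" by (auto simp: a_def)
    show "0 \<in> a" using I.I_zero by (simp add: a_def polys_closed(1))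
    show "x - y \<in> a" if "x \<in> a" "y \<in> a" for x y
      using that by (auto simp: a_def left_diff_distrib intro!: polys_closed I.I_diff)
    show "r * x \<in> a" if "r \<in> polys {0..<m}" "x \<in> a" for r x
      using that polys_m_subset by (auto simp: a_def mult.assoc intro!: polys_closed I.I_mult)
  qed
  have "1 \<notin> a" using neg by (simp add: a_def)
  then obtain q where q: "prime_in (polys {0..<m}) q" "a \<subseteq> q" using a.ex_prime_in by blast
  obtain J F where "pivots m n W I q J F" using ex_pivots[OF q(1)] by blast
  then interpret pivots m n W I q J F .
  obtain g b where g: "g \<in> polys {0..<m} - q" and b: "b \<in> polys V" "g * f - b \<in> I"
    using denominator[OF f(1)] by blast
  have "h * b = g * (h * f) - h * (g * f - b)" by (simp add: algebra_simps)
  also have "\<dots> \<in> I" using f g h polys_m_subset by (intro I.I_diff[OF I.I_mult I.I_mult[OF _ b(2)]]) auto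
  finally have "h * b \<in> I" .
  moreover have "h * b \<in> polys V" using h b polys_m_subset_V by (intro polys_closed) auto
  ultimately have "h * b = 0" using regular_structure(1)[OF regular] by blast
  then have "g * f \<in> I" using h b by auto
  then show False using g q(2) by (auto simp: a_def)
qed

text \<open>Over the fraction field of \<open>K[a]\<close>, that is for the prime
  \<open>{0}\<close>, the quotient is a polynomial ring and thus a domain.
  \<open>regular_torsion_free\<close> then removes the denominators \<open>g\<close> and
  \<open>h\<close>.\<close>

theorem regular_prime:
  assumes regular: "regular_ring (mpoly_ring {0..<n} Quot I)"
  shows "prime_in (polys {0..<n}) I"
proof (intro prime_in.intro ideal_in.intro subring_of_polys, unfold_locales)
  show "I \<subseteq> polys {0..<n}" "0 \<in> I" "1 \<notin> I" using I.I_subset I.I_zero one_notin_I by auto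
  show "x - y \<in> I" if "x \<in> I" "y \<in> I" for x y using that by (rule I.I_diff)
  show "r * x \<in> I" if "r \<in> polys {0..<n}" "x \<in> I" for r x using that by (rule I.I_mult)
  fix x y assume x: "x \<in> polys {0..<n}" and y: "y \<in> polys {0..<n}" and xy: "x * y \<in> I"
  obtain J F where "pivots m n W I {0} J F" using ex_pivots[OF prime_in_zero_polys] by blast
  then interpret pivots m n W I "{0}" J F .
  obtain g b where g: "g \<in> polys {0..<m}" "g \<noteq> 0" and b: "b \<in> polys V" "g * x - b \<in> I"
    using denominator[OF x] by blast
  obtain h c where h: "h \<in> polys {0..<m}" "h \<noteq> 0" and c: "c \<in> polys V" "h * y - c \<in> I"
    using denominator[OF y] by blast
  have "b * c = (g * h) * (x * y) - (h * y) * (g * x - b) - b * (h * y - c)"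
    by (simp add: algebra_simps)
  also have "\<dots> \<in> I"
  proof (intro I.I_diff[OF I.I_diff[OF I.I_mult[OF _ xy] I.I_mult[OF _ b(2)]] I.I_mult[OF _ c(2)]])
    show "g * h \<in> polys {0..<n}" "h * y \<in> polys {0..<n}" "b \<in> polys {0..<n}"
      using g h b y polys_m_subset polys_V_subset by (auto intro!: polys_closed)
  qed
  finally have "b * c \<in> I" .
  moreover have "b * c \<in> polys V" using b c by (intro polys_closed)
  ultimately have "b * c = 0" using regular_structure(1)[OF regular] by blast
  then have "g * x \<in> I \<or> h * y \<in> I" using b c by auto
  then show "x \<in> I \<or> y \<in> I"
    using regular_torsion_free[OF regular] g h x y by blast
qed

end

section \<open>Fibers\<close>

context pivots
begin

text \<open>The primes of the chain may lie outside \<open>Q\<close>, where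
  \<open>contraction_strict\<close> says nothing. Instead, the elements \<open>x i\<close> become
  members of \<open>polys V\<close> modulo \<open>I\<close> over a common denominator
  \<open>g\<close>. More than \<open>card V\<close> of them satisfy a relation modulo the prime
  \<open>I\<close>, from which \<open>chain_relation\<close> produces a nonzero constant in
  \<open>p l\<close>.\<close>

lemma quot_chain_length:
  assumes regular: "regular_ring (mpoly_ring {0..<n} Quot I)"
    and chain: "prime_chain (polys {0..<n}) p l" "I \<subseteq> p 0"
  shows "l \<le> card V"
proof (rule ccontr)
  assume "\<not> l \<le> card V"
  then have card: "card V < card {0..<l}" by simp
  interpret PI: prime_in "polys {0..<n}" I by (rule regular_prime[OF regular])
  obtain x where x: "\<And>i. i < l \<Longrightarrow> x i \<in> p (Suc i) - p i" using prime_chain_choose[OF chain(1)] by blast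
  have xR: "x i \<in> polys {0..<n}" if "i < l" for i
    using x[OF that] chain(1) that prime_in.in_R[of "polys {0..<n}" "p (Suc i)"] by (auto simp: prime_chain_def)
  have fin: "finite (x ` {0..<l})" "x ` {0..<l} \<subseteq> polys {0..<n}" using xR by auto
  obtain g where g: "g \<in> polys {0..<m} - q" "\<forall>y\<in>x ` {0..<l}. \<exists>b\<in>polys V. g * y - b \<in> I"
    using common_denominator[OF fin] by blast
  have gR: "g \<in> polys V" "g \<in> polys {0..<n}" "g \<notin> I"
    using g(1) polys_m_subset_V polys_m_subset degree_zero q.p_zero by auto
  have "\<forall>i\<in>{0..<l}. \<exists>b. b \<in> polys V \<and> g * x i - b \<in> I" using g(2) by blast
  from bchoice[OF this] obtain b where b: "\<forall>i\<in>{0..<l}. b i \<in> polys V \<and> g * x i - b i \<in> I" ..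
  have bR: "b i \<in> polys {0..<n}" if "i < l" for i using b that polys_V_subset by auto
  obtain k f where f: "f \<noteq> 0" "f \<in> polys {0..<l}"
    and le: "\<forall>t\<in>keys f. \<forall>i. lookup t i \<le> k"
    and dep: "(\<Sum>t\<in>keys f. mpoly_const (lookup f t)
      * (\<Prod>i\<in>{0..<l}. b i ^ lookup t i * g ^ (k - lookup t i))) = 0"
    using algebraic_dependence[of V "{0..<l}" b g] card b gR(1) by auto
  \<comment> \<open>Each of the \<open>l\<close> factors is filled up with \<open>g\<close> to the
    exponent \<open>k\<close>, so all terms share the denominator \<open>g ^ (l * k)\<close>. As
    \<open>g\<close> is outside the prime \<open>I\<close>, this power can be cancelled.\<close>
  have "g ^ (l * k) * mp_eval mpoly_const x f
      = (\<Sum>t\<in>keys f. mpoly_const (lookup f t)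
        * (\<Prod>i\<in>{0..<l}. (g * x i) ^ lookup t i * g ^ (k - lookup t i)))"
  proof -
    have "g ^ (l * k) * (\<Prod>i\<in>{0..<l}. x i ^ lookup t i)
        = (\<Prod>i\<in>{0..<l}. (g * x i) ^ lookup t i * g ^ (k - lookup t i))"
      if t: "t \<in> keys f" for t
    proof -
      have "g ^ k * x i ^ lookup t i
          = (g * x i) ^ lookup t i * g ^ (k - lookup t i)" for i
      proof -
        have "g ^ k = g ^ lookup t i * g ^ (k - lookup t i)"
          using le t by (simp flip: power_add)
        then show ?thesis by (simp add: power_mult_distrib mult_ac)
      qed
      then have "(\<Prod>i\<in>{0..<l}. (g * x i) ^ lookup t i * g ^ (k - lookup t i))
          = (\<Prod>i\<in>{0..<l}. g ^ k * x i ^ lookup t i)" by simp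
      also have "\<dots> = g ^ (l * k) * (\<Prod>i\<in>{0..<l}. x i ^ lookup t i)"
        by (simp add: prod.distrib mult.commute[of l] power_mult)
      finally show ?thesis ..
    qed
    then show ?thesis
      unfolding mp_eval_eq_sum[OF finite_atLeastLessThan f(2)] sum_distrib_left
      by (intro sum.cong refl) (simp only: mult.left_commute[of "g ^ (l * k)"])
  qed
  also have "\<dots> = \<dots> - (\<Sum>t\<in>keys f. mpoly_const (lookup f t)
      * (\<Prod>i\<in>{0..<l}. b i ^ lookup t i * g ^ (k - lookup t i)))"
    by (simp add: dep)
  also have "\<dots> \<in> I"
    unfolding sum_subtractf[symmetric] right_diff_distrib[symmetric]
    using xR bR gR b
    by (intro I.I_sum I.I_mult[OF const_in_polys] I.cong_prod I.cong_mult I.cong_power)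
      (auto simp: I.I_zero intro!: I.closed)
  finally have "g ^ (l * k) * mp_eval mpoly_const x f \<in> I" .
  moreover have "g ^ (l * k) \<notin> I" using PI.notin_power[of g] gR by auto
  moreover have "mp_eval mpoly_const x f \<in> polys {0..<n}"
    using f(2) xR by (intro const.mp_eval_closed[OF subring_of_polys]) auto
  ultimately have "mp_eval mpoly_const x f \<in> I" using PI.p_prime gR I.power_closed by blast
  then obtain f' where f': "f' \<in> polys {l..<l}" "f' \<noteq> 0" "mp_eval mpoly_const x f' \<in> p l"
    using chain_relation[OF chain(1), of x l f] x xR f chain(2) by auto
  then obtain c where c: "f' = mpoly_const c" using polys_empty by auto
  have "prime_in (polys {0..<n}) (p l)" using chain(1) by (simp add: prime_chain_def)
  moreover have "mpoly_const c \<in> p l" using f'(3) by (simp add: c const.mp_eval_simps)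
  ultimately have "c = 0" by (rule prime_in_polys_const)
  then show False using f'(2) by (simp add: c mpoly_const_zero)
qed

end

locale fiber = graded_ideal m n W I
  for m n :: nat and W :: "nat \<Rightarrow> int" and I :: "'k::field mpoly set" +
  fixes \<Gamma> :: "nat \<Rightarrow> 'k"
begin

definition at_point :: "'k mpoly \<Rightarrow> 'k"
  where "at_point = mp_eval (\<lambda>c. c) \<Gamma>"

definition specialize :: "'k mpoly \<Rightarrow> 'k mpoly"
  where "specialize = mp_eval mpoly_const (\<lambda>i. if i < m then mpoly_const (\<Gamma> i) else mpoly_var i)"

lemma fiber_ideal_eq: "fiber_ideal m \<Gamma> I = specialize ` I"
  by (simp add: fiber_ideal_def specialize_def mpoly_subst_eq_mp_eval)

lemma specialize_simps:
  "specialize 0 = 0" "specialize 1 = 1" "specialize (f + g) = specialize f + specialize g"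
  "specialize (f - g) = specialize f - specialize g" "specialize (f * g) = specialize f * specialize g"
  "specialize (\<Sum>a\<in>A. F a) = (\<Sum>a\<in>A. specialize (F a))"
  "specialize (mpoly_const c) = mpoly_const c"
  "specialize (mpoly_var i) = (if i < m then mpoly_const (\<Gamma> i) else mpoly_var i)"
  by (simp_all add: specialize_def const.mp_eval_simps)

lemma specialize_polys: "f \<in> polys U \<Longrightarrow> specialize f \<in> polys (U - {0..<m})"
  unfolding specialize_def by (rule const.mp_eval_closed[OF subring_of_polys]) auto

lemma specialize_id: "\<lbrakk>f \<in> polys U; U \<inter> {0..<m} = {}\<rbrakk> \<Longrightarrow> specialize f = f"
  unfolding specialize_def by (rule mp_eval_const_id) auto

lemma specialize_degree_zero: "f \<in> polys {0..<m} \<Longrightarrow> specialize f = mpoly_const (at_point f)"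
  by (induction rule: polys_induct)
    (auto simp: specialize_simps at_point_def field_id.mp_eval_simps mpoly_const_add mpoly_const_mult)

text \<open>The difference lies in the ideal of the point \<open>\<Gamma>\<close>. The coefficients
  \<open>k i\<close> are made explicit because \<open>fiber_Int\<close> replaces them, one by one,
  by elements of \<open>polys V\<close>.\<close>

lemma specialize_diff:
  assumes "f \<in> polys {0..<n}"
  shows "\<exists>k. (\<forall>i<m. k i \<in> polys {0..<n}) \<and>
    f - specialize f = (\<Sum>i<m. (mpoly_var i - mpoly_const (\<Gamma> i)) * k i)"
  using assms
proof (induction rule: polys_induct)
  case (const c)
  then show ?case by (intro exI[of _ "\<lambda>_. 0"]) (simp add: specialize_simps polys_closed(1))
next
  case (var i)
  then show ?case
    by (intro exI[of _ "\<lambda>j. if j = i then 1 else 0"])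
      (auto simp: specialize_simps polys_closed(1,2) if_distrib[of "\<lambda>x. _ * x"] cong: if_cong)
next
  case (add f g)
  then obtain k k' where k: "\<forall>i<m. k i \<in> polys {0..<n}" "\<forall>i<m. k' i \<in> polys {0..<n}"
    and f: "f - specialize f = (\<Sum>i<m. (mpoly_var i - mpoly_const (\<Gamma> i)) * k i)"
    and g: "g - specialize g = (\<Sum>i<m. (mpoly_var i - mpoly_const (\<Gamma> i)) * k' i)" by blast
  have "f + g - specialize (f + g) = (f - specialize f) + (g - specialize g)"
    by (simp add: specialize_simps)
  also have "\<dots> = (\<Sum>i<m. (mpoly_var i - mpoly_const (\<Gamma> i)) * (k i + k' i))"
    unfolding f g by (simp add: sum.distrib distrib_left)
  finally show ?case using k by (intro exI[of _ "\<lambda>i. k i + k' i"]) (auto intro!: polys_closed)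
next
  case (mult f g)
  then obtain k k' where k: "\<forall>i<m. k i \<in> polys {0..<n}" "\<forall>i<m. k' i \<in> polys {0..<n}"
    and f: "f - specialize f = (\<Sum>i<m. (mpoly_var i - mpoly_const (\<Gamma> i)) * k i)"
    and g: "g - specialize g = (\<Sum>i<m. (mpoly_var i - mpoly_const (\<Gamma> i)) * k' i)" by blast
  have sf: "specialize f \<in> polys {0..<n}"
    using specialize_polys[OF mult.hyps(1)] polys_mono[of "{0..<n} - {0..<m}" "{0..<n}"] by auto
  have "f * g - specialize (f * g) = g * (f - specialize f) + specialize f * (g - specialize g)"
    by (simp add: specialize_simps algebra_simps)
  also have "\<dots> = (\<Sum>i<m. (mpoly_var i - mpoly_const (\<Gamma> i)) * (g * k i + specialize f * k' i))"
    unfolding f g by (simp add: sum.distrib distrib_left sum_distrib_left mult.left_commute)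
  finally show ?case
    using k sf mult.hyps by (intro exI[of _ "\<lambda>i. g * k i + specialize f * k' i"]) (auto intro!: polys_closed)
qed

text \<open>The maximal ideal of the point \<open>\<Gamma>\<close> in \<open>K[a]\<close>.
  Denominators outside it specialize to nonzero constants, so the elimination at this prime descends
  to the fiber.\<close>

definition q :: "'k mpoly set"
  where "q = {f \<in> polys {0..<m}. at_point f \<in> {0}}"

lemma prime_q: "prime_in (polys {0..<m}) q"
  unfolding q_def
  by (rule prime_in_vimage[OF prime_in_zero subring_of_polys])
    (auto simp: at_point_def field_id.mp_eval_simps)

text \<open>The image of \<open>I\<close> is again an ideal because \<open>specialize\<close> fixes
  the polynomials in the indeterminates of positive weight, so each multiplier is its own
  preimage.\<close>

lemma ideal_fiber: "ideal_in (polys {m..<n}) (specialize ` I)"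
proof (rule ideal_in.intro[OF subring_of_polys], unfold_locales)
  have "{0..<n} - {0..<m} = {m..<n}" by auto
  then show "specialize ` I \<subseteq> polys {m..<n}" using I.I_in_R specialize_polys[of _ "{0..<n}"] by auto
  show "0 \<in> specialize ` I" using I.I_zero specialize_simps(1) by (metis imageI)
  show "x - y \<in> specialize ` I" if "x \<in> specialize ` I" "y \<in> specialize ` I" for x y
    using that I.I_diff by (auto simp flip: specialize_simps(4))
  show "r * x \<in> specialize ` I" if rx: "r \<in> polys {m..<n}" "x \<in> specialize ` I" for r x
  proof -
    have "specialize r = r" using rx(1) by (rule specialize_id) auto
    moreover have "r \<in> polys {0..<n}" using rx(1) polys_mono[of "{m..<n}" "{0..<n}"] by auto
    moreover obtain y where "y \<in> I" "x = specialize y" using rx(2) by blast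
    ultimately have "r * x = specialize (r * y)" "r * y \<in> I"
      by (simp_all add: specialize_simps I.I_mult)
    then show ?thesis by simp
  qed
qed

end

locale fiber_pivots = fiber m n W I \<Gamma> + pivots m n W I "fiber.q m \<Gamma>" J F
  for m n :: nat and W :: "nat \<Rightarrow> int" and I :: "'k::field mpoly set" and \<Gamma> :: "nat \<Rightarrow> 'k" and J F
begin

abbreviation U :: "nat set" where "U \<equiv> {m..<n} - J"

lemma V_eq: "V = {0..<m} \<union> U"
  using J_subset m_less_n by auto

lemma card_V: "card V = m + card U"
  unfolding V_eq by (subst card_Un_disjoint) auto

lemma polys_U_subset: "polys U \<subseteq> polys {m..<n}" "polys U \<subseteq> polys V"
  using V_eq by (intro polys_mono; auto)+

lemma at_point_nonzero: "g \<in> polys {0..<m} - q \<Longrightarrow> at_point g \<noteq> 0"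
  by (auto simp: q_def)

lemma fiber_decompose:
  assumes "f \<in> polys {m..<n}"
  shows "\<exists>b\<in>polys U. f - b \<in> specialize ` I"
proof -
  interpret I': ideal_in "polys {m..<n}" "specialize ` I" by (rule ideal_fiber)
  have "f \<in> polys {0..<n}" using assms polys_mono[of "{m..<n}" "{0..<n}"] by auto
  then obtain g b where g: "g \<in> polys {0..<m} - q" and b: "b \<in> polys V" "g * f - b \<in> I"
    using denominator by blast
  have "specialize (g * f - b) = mpoly_const (at_point g) * f - specialize b"
    using g assms specialize_id[OF assms] by (auto simp: specialize_simps specialize_degree_zero)
  then have "mpoly_const (at_point g) * f - specialize b \<in> specialize ` I" using b(2) by (metis imageI)
  then have "mpoly_const (inverse (at_point g)) * (mpoly_const (at_point g) * f - specialize b) \<in> specialize ` I"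
    by (intro I'.I_mult) auto
  moreover have "mpoly_const (inverse (at_point g)) * (mpoly_const (at_point g) * f - specialize b)
      = f - mpoly_const (inverse (at_point g)) * specialize b"
    using at_point_nonzero[OF g]
    by (simp add: right_diff_distrib mpoly_const_one flip: mult.assoc mpoly_const_mult)
  moreover have "V - {0..<m} = U" using V_eq by auto
  then have "specialize b \<in> polys U" using specialize_polys[OF b(1)] by simp
  then have "mpoly_const (inverse (at_point g)) * specialize b \<in> polys U" by (intro polys_closed) auto
  ultimately show ?thesis by metis
qed

text \<open>An element \<open>b\<close> of the intersection differs from some \<open>f\<close> in
  \<open>I\<close> by a combination of the \<open>mpoly_var i - mpoly_const (\<Gamma> i)\<close>.
  Moving the coefficients into \<open>polys V\<close>, over a common denominator \<open>g\<close>,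
  gives an element \<open>e\<close> of \<open>I \<inter> polys V\<close>, which is zero.
  Specializing \<open>e\<close> removes the combination and leaves a nonzero constant times
  \<open>b\<close>.\<close>

lemma fiber_Int:
  assumes regular: "regular_ring (mpoly_ring {0..<n} Quot I)"
  shows "specialize ` I \<inter> polys U \<subseteq> {0}"
proof
  fix b assume "b \<in> specialize ` I \<inter> polys U"
  then obtain f where f: "f \<in> I" "b = specialize f" and bU: "b \<in> polys U" by blast
  have bV: "b \<in> polys V" using bU polys_U_subset by blast
  obtain k where k: "\<forall>i<m. k i \<in> polys {0..<n}"
    and fk: "f - specialize f = (\<Sum>i<m. (mpoly_var i - mpoly_const (\<Gamma> i)) * k i)"
    using specialize_diff[OF I.I_in_R[OF f(1)]] by blast
  have fin: "finite (k ` {..<m})" "k ` {..<m} \<subseteq> polys {0..<n}" using k by auto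
  obtain g where g: "g \<in> polys {0..<m} - q" "\<forall>x\<in>k ` {..<m}. \<exists>b\<in>polys V. g * x - b \<in> I"
    using common_denominator[OF fin] by blast
  have gV: "g \<in> polys V" "g \<in> polys {0..<n}" using g(1) polys_m_subset_V polys_m_subset by auto
  have "\<forall>i\<in>{..<m}. \<exists>b. b \<in> polys V \<and> g * k i - b \<in> I" using g(2) by blast
  from bchoice[OF this] obtain c where c: "\<forall>i\<in>{..<m}. c i \<in> polys V \<and> g * k i - c i \<in> I" ..
  let ?a = "\<lambda>i. mpoly_var i - mpoly_const (\<Gamma> i) :: 'k mpoly"
  have aV: "?a i \<in> polys V" "?a i \<in> polys {0..<n}" if "i < m" for i
    using that m_less_n V_eq by (auto intro!: polys_closed)
  define e where "e = g * b + (\<Sum>i<m. ?a i * c i)"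
  have b: "b = f - (\<Sum>i<m. ?a i * k i)" using fk f(2) by (simp add: algebra_simps)
  have "e = g * f - (\<Sum>i<m. ?a i * (g * k i - c i))"
    by (simp add: e_def b right_diff_distrib sum_subtractf sum_distrib_left mult.left_commute)
  also have "\<dots> \<in> I"
    using gV f(1) aV c by (intro I.I_diff[OF I.I_mult I.I_sum[OF I.I_mult]]) auto
  finally have "e \<in> I" .
  moreover have "e \<in> polys V" unfolding e_def using gV bV aV c by (intro polys_closed(4,6,7)) auto
  ultimately have "e = 0" using regular_structure(1)[OF regular] by blast
  then have "0 = specialize e" by (simp add: specialize_simps)
  also have "\<dots> = mpoly_const (at_point g) * b"
  proof -
    have "specialize b = b" using bU by (rule specialize_id) auto
    moreover have "specialize g = mpoly_const (at_point g)"
      using g(1) by (intro specialize_degree_zero) auto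
    ultimately show ?thesis by (simp add: e_def specialize_simps)
  qed
  finally show "b \<in> {0}" using at_point_nonzero[OF g(1)] by (auto simp: mpoly_const_eq_0_iff)
qed

text \<open>By \<open>fiber_decompose\<close> every polynomial is congruent to one in
  \<open>polys U\<close>. Strict inclusions of primes over the fiber ideal therefore survive
  intersection with \<open>polys U\<close>, where \<open>prime_chain_length\<close> applies.\<close>

lemma fiber_chain_length:
  assumes p: "prime_chain (polys {m..<n}) p l" "specialize ` I \<subseteq> p 0"
  shows "l \<le> card U"
proof -
  define p' where "p' i = p i \<inter> polys U" for i
  have prime: "prime_in (polys {m..<n}) (p i)" if "i \<le> l" for i using p that by (simp add: prime_chain_def)
  have prime': "prime_in (polys U) (p' i)" if "i \<le> l" for i
    unfolding p'_def by (rule prime_in_Int[OF prime[OF that] subring_of_polys polys_U_subset(1)])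
  have less: "p i \<subset> p (Suc i)" if "i < l" for i using p that by (simp add: prime_chain_def)
  have I_p: "specialize ` I \<subseteq> p i" if "i \<le> l" for i
    using that
  proof (induction i)
    case (Suc i)
    then show ?case using less[of i] by auto
  qed (rule p(2))
  have "p' i \<subset> p' (Suc i)" if i: "i < l" for i
  proof -
    interpret p1: prime_in "polys {m..<n}" "p i" using i by (intro prime) auto
    interpret p2: prime_in "polys {m..<n}" "p (Suc i)" using i by (intro prime) auto
    obtain f where f: "f \<in> p (Suc i)" "f \<notin> p i" using less[OF i] by blast
    obtain b where b: "b \<in> polys U" "f - b \<in> specialize ` I" using fiber_decompose[OF p2.in_R[OF f(1)]] by blast
    have fb: "f - b \<in> p i" "f - b \<in> p (Suc i)" using I_p[of i] I_p[of "Suc i"] b(2) i by auto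
    have "b \<notin> p i" using p1.p_add[OF fb(1), of b] f(2) by auto
    moreover have "b \<in> p (Suc i)" using p2.p_diff[OF f(1) fb(2)] by simp
    ultimately show ?thesis using b(1) less[OF i] by (auto simp: p'_def)
  qed
  then have chain: "prime_chain (polys U) p' l" using prime' by (simp add: prime_chain_def)
  have "p' l \<inter> polys {} \<subseteq> {0}" using prime_in_polys_Int_const[OF prime'] by simp
  from prime_chain_length[OF _ _ chain this] show ?thesis by simp
qed

text \<open>\<open>fiber_decompose\<close> and \<open>fiber_Int\<close> identify the fiber with the
  polynomial ring in \<open>U\<close>. The chain consists of the preimages of the ideals generated
  by the first \<open>i\<close> of these indeterminates, which are the kernels of the maps
  \<open>\<tau> i\<close> setting them to zero.\<close>

lemma ex_fiber_chain:
  assumes regular: "regular_ring (mpoly_ring {0..<n} Quot I)"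
  shows "\<exists>p. prime_chain (polys {m..<n}) p (card U) \<and> specialize ` I \<subseteq> p 0"
proof -
  interpret I': ideal_in "polys {m..<n}" "specialize ` I" by (rule ideal_fiber)
  note Int = fiber_Int[OF regular]
  obtain e where e: "bij_betw e {0..<card U} U" using ex_bij_betw_nat_finite[of U] by auto
  define \<tau> :: "nat \<Rightarrow> 'k mpoly \<Rightarrow> 'k mpoly" where "\<tau> i = mp_eval mpoly_const (\<lambda>v. if v \<in> e ` {0..<i} then 0 else mpoly_var v)" for i
  have \<tau>: "\<tau> i 0 = 0" "\<tau> i 1 = 1" "\<tau> i (f + g) = \<tau> i f + \<tau> i g" "\<tau> i (f - g) = \<tau> i f - \<tau> i g"
    "\<tau> i (f * g) = \<tau> i f * \<tau> i g" "\<tau> i (mpoly_const c) = mpoly_const c"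
    "\<tau> i (mpoly_var v) = (if v \<in> e ` {0..<i} then 0 else mpoly_var v)" for i f g c v
    by (simp_all add: \<tau>_def const.mp_eval_simps)
  define p where "p i = {f \<in> polys {m..<n}. \<exists>b\<in>polys U. f - b \<in> specialize ` I \<and> \<tau> i b = 0}" for i
  have unique: "b = b'" if "b \<in> polys U" "b' \<in> polys U" "f - b \<in> specialize ` I" "f - b' \<in> specialize ` I" for f b b'
  proof -
    have "b - b' = (f - b') - (f - b)" by simp
    also have "\<dots> \<in> specialize ` I" by (rule I'.I_diff[OF that(4,3)])
    finally show ?thesis using Int polys_closed(5)[OF that(1,2)] by auto
  qed
  have "prime_in (polys {m..<n}) (p i)" for i
  proof (intro prime_in.intro ideal_in.intro subring_of_polys, unfold_locales)
    show "p i \<subseteq> polys {m..<n}" by (auto simp: p_def)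
    show "0 \<in> p i" using I'.I_zero by (auto simp: p_def \<tau> polys_closed(1) intro!: bexI[of _ 0])
    show "1 \<notin> p i"
    proof
      assume "1 \<in> p i"
      then obtain b where b: "b \<in> polys U" "1 - b \<in> specialize ` I" "\<tau> i b = 0" by (auto simp: p_def)
      have "b = 1" using unique[OF b(1) polys_closed(2) b(2)] I'.I_zero by simp
      then show False using b(3) by (simp add: \<tau>)
    qed
    show "x - y \<in> p i" if xy: "x \<in> p i" "y \<in> p i" for x y
    proof -
      obtain b c where bc: "b \<in> polys U" "x - b \<in> specialize ` I" "\<tau> i b = 0"
        "c \<in> polys U" "y - c \<in> specialize ` I" "\<tau> i c = 0" using xy by (auto simp: p_def)
      have "(x - y) - (b - c) = (x - b) - (y - c)" by simp
      also have "\<dots> \<in> specialize ` I" by (rule I'.I_diff[OF bc(2,5)])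
      finally show ?thesis
        using xy bc unfolding p_def by (auto simp: \<tau> intro!: polys_closed bexI[of _ "b - c"])
    qed
    have mult: "x * y - b * c \<in> specialize ` I"
      if "x \<in> polys {m..<n}" "y \<in> polys {m..<n}" "b \<in> polys U" "c \<in> polys U"
        "x - b \<in> specialize ` I" "y - c \<in> specialize ` I" for x y b c
      using that polys_U_subset(1) by (intro I'.cong_mult) auto
    show "r * x \<in> p i" if rx: "r \<in> polys {m..<n}" "x \<in> p i" for r x
    proof -
      obtain b where b: "b \<in> polys U" "x - b \<in> specialize ` I" "\<tau> i b = 0" "x \<in> polys {m..<n}"
        using rx by (auto simp: p_def)
      obtain c where c: "c \<in> polys U" "r - c \<in> specialize ` I" using fiber_decompose[OF rx(1)] by blast
      have "r * x - c * b \<in> specialize ` I" using mult rx(1) b c by blast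
      then show ?thesis
        using rx b c unfolding p_def by (auto simp: \<tau> intro!: polys_closed bexI[of _ "c * b"])
    qed
    show "x \<in> p i \<or> y \<in> p i" if xy: "x \<in> polys {m..<n}" "y \<in> polys {m..<n}" "x * y \<in> p i" for x y
    proof -
      obtain b where b: "b \<in> polys U" "x - b \<in> specialize ` I" using fiber_decompose[OF xy(1)] by blast
      obtain c where c: "c \<in> polys U" "y - c \<in> specialize ` I" using fiber_decompose[OF xy(2)] by blast
      obtain d where d: "d \<in> polys U" "x * y - d \<in> specialize ` I" "\<tau> i d = 0" using xy(3) by (auto simp: p_def)
      have "d = b * c" using d b c mult[OF xy(1,2)] by (intro unique[of d "b * c" "x * y"] polys_closed)
      then have "\<tau> i b = 0 \<or> \<tau> i c = 0" using d(3) by (simp add: \<tau>)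
      then show ?thesis using xy b c by (auto simp: p_def)
    qed
  qed
  moreover have "p i \<subset> p (Suc i)" if i: "i < card U" for i
  proof -
    have comp: "\<tau> (Suc i) (\<tau> i f) = \<tau> (Suc i) f" for f
      by (induction f rule: mpoly_induct) (auto simp: \<tau>)
    have "p i \<subseteq> p (Suc i)"
    proof
      fix f assume "f \<in> p i"
      then obtain b where b: "f \<in> polys {m..<n}" "b \<in> polys U" "f - b \<in> specialize ` I" "\<tau> i b = 0"
        by (auto simp: p_def)
      have "\<tau> (Suc i) b = 0" using comp[of b] b(4) by (simp add: \<tau>)
      then show "f \<in> p (Suc i)" using b by (auto simp: p_def)
    qed
    moreover have ei: "e i \<in> U" "e i \<notin> e ` {0..<i}"
    proof -
      show "e i \<in> U" using e i by (auto simp: bij_betw_def)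
      have "inj_on e {0..<card U}" using e by (simp add: bij_betw_def)
      then show "e i \<notin> e ` {0..<i}" using i by (auto dest: inj_onD)
    qed
    have eiU: "mpoly_var (e i) \<in> polys U" using ei(1) by simp
    have "mpoly_var (e i) \<in> p (Suc i)"
      using ei(1) eiU I'.I_zero unfolding p_def by (auto simp: \<tau> intro!: bexI[of _ "mpoly_var (e i)"])
    moreover have "mpoly_var (e i) \<notin> p i"
    proof
      assume "mpoly_var (e i) \<in> p i"
      then obtain b where b: "b \<in> polys U" "mpoly_var (e i) - b \<in> specialize ` I" "\<tau> i b = 0" by (auto simp: p_def)
      then have "b = mpoly_var (e i)" using unique[OF b(1) eiU b(2)] I'.I_zero by simp
      then have "mpoly_var (e i) = (0 :: 'k mpoly)" using b(3) ei(2) by (simp add: \<tau>)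
      \<comment> \<open>Setting all indeterminates to 1 shows that an indeterminate is not the zero
        polynomial.\<close>
      then have "mp_eval (\<lambda>c. c) (\<lambda>_. 1) (mpoly_var (e i) :: 'k mpoly) = 0"
        by (simp add: field_id.mp_eval_simps)
      then show False by (simp add: field_id.mp_eval_simps)
    qed
    ultimately show ?thesis by blast
  qed
  ultimately have "prime_chain (polys {m..<n}) p (card U)" by (simp add: prime_chain_def)
  moreover have "specialize ` I \<subseteq> p 0"
    using I'.I_in_R by (auto simp: p_def \<tau> polys_closed(1) intro!: bexI[of _ 0])
  ultimately show ?thesis by blast
qed

lemma krull_dim_fiber:
  assumes regular: "regular_ring (mpoly_ring {0..<n} Quot I)"
  shows "krull_dim (mpoly_ring {m..<n} Quot fiber_ideal m \<Gamma> I) = ereal (real (card U))"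
proof -
  interpret KX: cring "mpoly_ring {m..<n} :: 'k mpoly ring" by (rule cring_mpoly_ring)
  have ideal: "ideal (specialize ` I) (mpoly_ring {m..<n})" using ideal_fiber by (simp add: ideal_in_polys_iff)
  obtain p where p: "prime_chain (polys {m..<n}) p (card U)" "specialize ` I \<subseteq> p 0"
    using ex_fiber_chain[OF regular] by blast
  show ?thesis
    unfolding fiber_ideal_eq
  proof (rule krull_dim_eqI)
    show "spec_chain (mpoly_ring {m..<n} Quot specialize ` I)
        (\<lambda>i. (+>\<^bsub>mpoly_ring {m..<n}\<^esub>) (specialize ` I) ` p i) (card U)"
      using p by (intro KX.spec_chain_quot_image[OF ideal]) (simp_all add: spec_chain_mpoly_ring)
    fix p l assume p: "spec_chain (mpoly_ring {m..<n} Quot specialize ` I) p l"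
    have "primeideal (p 0) (mpoly_ring {m..<n} Quot specialize ` I)" using p by (simp add: spec_chain_def Spec_def)
    then show "l \<le> card U"
      using KX.spec_chain_quot_vimage[OF ideal p] KX.primeideal_quot_vimage(2)[OF ideal]
      by (intro fiber_chain_length) (simp_all only: spec_chain_mpoly_ring)
  qed
qed

text \<open>\<open>Q\<close> is here the ideal of a rational point with coordinates
  \<open>\<Gamma>\<close> and 0. Its residue field is \<open>K\<close>, which leaves no
  indeterminate for \<open>T\<close>, so the chain of \<open>regular_structure\<close> has the full
  length \<open>card V\<close>.\<close>

lemma krull_dim_total:
  assumes regular: "regular_ring (mpoly_ring {0..<n} Quot I)"
  shows "krull_dim (mpoly_ring {0..<n} Quot I) = ereal (real (card V))"
proof -
  interpret P: cring "mpoly_ring {0..<n} :: 'k mpoly ring" by (rule cring_mpoly_ring)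
  have ideal: "ideal I (mpoly_ring {0..<n})" using I.ideal_in_axioms by (simp add: ideal_in_polys_iff)
  obtain T c l where T: "T \<subseteq> V" "Q \<inter> polys T \<subseteq> {0}" and c: "prime_chain (polys {0..<n}) c l" "I \<subseteq> c 0"
    and l: "l + card T = card V"
    using regular_structure(2)[OF regular] by blast
  have "T = {}"
  proof (rule ccontr)
    assume "T \<noteq> {}"
    then obtain i where i: "i \<in> T" by blast
    define a where "a = (if i < m then \<Gamma> i else 0)"
    define f :: "'k mpoly" where "f = mpoly_var i - mpoly_const a"
    have "f \<in> polys {0..<n}" using i T(1) by (auto simp: f_def intro!: polys_closed)
    moreover have "const_part m f \<in> q"
      using i T(1) by (auto simp: f_def a_def q_def const_part_simps at_point_def field_id.mp_eval_simps
          mpoly_const_zero intro!: polys_closed)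
    ultimately have "f \<in> Q" by (simp add: Q_def)
    moreover have "f \<in> polys T" using i by (auto simp: f_def intro!: polys_closed)
    ultimately have "f = 0" using T(2) by blast
    \<comment> \<open>The value of \<open>f\<close> at \<open>a + 1\<close> is 1, so
      \<open>f\<close> cannot vanish.\<close>
    then have "mp_eval (\<lambda>c. c) (\<lambda>_. a + 1) f = 0" by (simp add: field_id.mp_eval_simps)
    then show False by (simp add: f_def field_id.mp_eval_simps)
  qed
  then have c: "prime_chain (polys {0..<n}) c (card V)" "I \<subseteq> c 0" using c l by auto
  show ?thesis
  proof (rule krull_dim_eqI)
    show "spec_chain (mpoly_ring {0..<n} Quot I) (\<lambda>i. (+>\<^bsub>mpoly_ring {0..<n}\<^esub>) I ` c i) (card V)"
      using c by (intro P.spec_chain_quot_image[OF ideal]) (simp_all add: spec_chain_mpoly_ring)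
    fix p l assume p: "spec_chain (mpoly_ring {0..<n} Quot I) p l"
    have "primeideal (p 0) (mpoly_ring {0..<n} Quot I)" using p by (simp add: spec_chain_def Spec_def)
    then show "l \<le> card V"
      using P.spec_chain_quot_vimage[OF ideal p] P.primeideal_quot_vimage(2)[OF ideal]
      by (intro quot_chain_length[OF regular]) (simp_all only: spec_chain_mpoly_ring)
  qed
qed

end

section \<open>Connectedness\<close>

lemma openin_zariski_generization:
  assumes "cring R" "openin (zariski_topology R) E" "p' \<in> E" "p \<in> Spec R" "p \<subseteq> p'"
  shows "p \<in> E"
  using assms(2-5) unfolding openin_zariski[OF assms(1)] vanishing_set_def by blast

text \<open>Open sets are stable under generization, so in a separation into two open sets a prime
  and any prime containing it lie on the same side. The path from \<open>a\<close> down to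
  \<open>b\<close>, up to \<open>c\<close> and down to \<open>z\<close> puts every prime on the side
  of \<open>z\<close>.\<close>

lemma connected_space_zariskiI:
  assumes "cring R" "z \<in> Spec R"
    and link: "\<And>a. a \<in> Spec R \<Longrightarrow> \<exists>b\<in>Spec R. \<exists>c\<in>Spec R. b \<subseteq> a \<and> b \<subseteq> c \<and> z \<subseteq> c"
  shows "connected_space (zariski_topology R)"
proof -
  note gen = openin_zariski_generization[OF assms(1)]
  have z: "z \<in> E"
    if E: "openin (zariski_topology R) E" "openin (zariski_topology R) E'" "Spec R \<subseteq> E \<union> E'" "E \<inter> E' = {}"
      "a \<in> E" for E E' a
  proof -
    have "a \<in> Spec R" using E(1,5) openin_subset topspace_zariski[OF assms(1)] by blast
    then obtain b c where bc: "b \<in> Spec R" "c \<in> Spec R" "b \<subseteq> a" "b \<subseteq> c" "z \<subseteq> c" using link by blast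
    have "b \<in> E" using gen[OF E(1) E(5) bc(1,3)] .
    then have "c \<notin> E'" using gen[OF E(2) _ bc(1,4)] E(4) by blast
    then have "c \<in> E" using bc(2) E(3) by blast
    then show ?thesis using gen[OF E(1) _ assms(2) bc(5)] by blast
  qed
  show ?thesis
    unfolding connected_space_def topspace_zariski[OF assms(1)]
  proof (rule notI, elim exE conjE)
    fix E E' assume E: "openin (zariski_topology R) E" "openin (zariski_topology R) E'"
      "Spec R \<subseteq> E \<union> E'" "E \<inter> E' = {}" "E \<noteq> {}" "E' \<noteq> {}"
    obtain a a' where a: "a \<in> E" "a' \<in> E'" using E by blast
    have "z \<in> E" by (rule z[OF E(1-4) a(1)])
    moreover have "z \<in> E'" by (rule z[OF E(2,1) _ _ a(2)]) (use E(3,4) in auto)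
    ultimately show False using E(4) by blast
  qed
qed

context graded_ideal
begin

text \<open>A prime \<open>p\<close> over \<open>I\<close> contains the prime generated by its homogeneous elements, which is also contained
  in the prime generated by the indeterminates of positive weight and the elements of \<open>p\<close> of degree 0.\<close>

lemma connected: "connected_Spec (mpoly_ring {0..<n} Quot I)"
proof -
  let ?P = "mpoly_ring {0..<n} :: 'k mpoly ring"
  interpret P: cring ?P by (rule cring_mpoly_ring)
  have ideal: "ideal I ?P" using I.ideal_in_axioms by (simp add: ideal_in_polys_iff)
  have cring: "cring (?P Quot I)" by (rule ideal.quotient_is_cring[OF ideal P.cring_axioms])
  let ?\<eta> = "\<lambda>p. (+>\<^bsub>?P\<^esub>) I ` p"
  have \<eta>: "?\<eta> p \<in> Spec (?P Quot I)" if "prime_in (polys {0..<n}) p" "I \<subseteq> p" for p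
    using that P.primeideal_quot_image[OF ideal] by (simp add: Spec_def prime_in_polys_iff)
  interpret zero: prime_in "polys {0..<m}" "{0 :: 'k mpoly}" by (rule prime_in_zero_polys)
  \<comment> \<open>For \<open>q = {0}\<close> the prime \<open>Q\<close> is the ideal generated by
    the indeterminates of positive weight. It is contained in the prime \<open>Q\<close> of every
    other \<open>q\<close> and serves as the point to which all primes are linked.\<close>
  interpret z: graded_ideal_at m n W I "{0}" ..
  have z: "?\<eta> z.Q \<in> Spec (?P Quot I)" using z.prime_Q z.I_subset_Q by (rule \<eta>)
  have "\<exists>b\<in>Spec (?P Quot I). \<exists>c\<in>Spec (?P Quot I). b \<subseteq> a \<and> b \<subseteq> c \<and> ?\<eta> z.Q \<subseteq> c"
    if a: "a \<in> Spec (?P Quot I)" for a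
  proof -
    have prime_a: "primeideal a (?P Quot I)" using a by (simp add: Spec_def)
    define p where "p = {f \<in> polys {0..<n}. I +>\<^bsub>?P\<^esub> f \<in> a}"
    have "prime_in (polys {0..<n}) p"
      unfolding p_def prime_in_polys_iff by (rule P.primeideal_quot_vimage(1)[OF ideal prime_a])
    then interpret p: prime_in "polys {0..<n}" p .
    have I_p: "I \<subseteq> p" unfolding p_def by (rule P.primeideal_quot_vimage(2)[OF ideal prime_a])
    define s where "s = {f \<in> polys {0..<n}. weight_poly W f \<in> {F. \<forall>k. coeff F k \<in> p}}"
    have prime_s: "prime_in (polys {0..<n}) s"
      unfolding s_def
      by (rule prime_in_vimage[OF p.prime_in_poly subring_of_polys])
        (auto simp: weight_poly_simps coeff_weight_poly_in_polys)
    have I_s: "I \<subseteq> s" using I.I_in_R coeff_in_I I_p by (auto simp: s_def)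
    have s_p: "s \<subseteq> p"
    proof
      fix f assume f: "f \<in> s"
      show "f \<in> p"
        by (subst sum_coeff_weight_poly[symmetric], rule p.p_sum) (use f in \<open>auto simp: s_def\<close>)
    qed
    interpret q: prime_in "polys {0..<m}" "p \<inter> polys {0..<m}"
      by (rule prime_in_Int[OF p.prime_in_axioms subring_of_polys polys_m_subset])
    interpret q: graded_ideal_at m n W I "p \<inter> polys {0..<m}" ..
    have "const_part m f \<in> p" if "f \<in> s" for f
      using that coeff_weight_poly_0[of f] by (auto simp: s_def dest: spec[of _ 0])
    then have s_Q: "s \<subseteq> q.Q" using const_part_in_polys by (auto simp: q.Q_def s_def)
    have "z.Q \<subseteq> q.Q" using p.p_zero by (auto simp: q.Q_def z.Q_def polys_closed(1))
    moreover have "?\<eta> s \<subseteq> a" using s_p by (auto simp: p_def)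
    ultimately show ?thesis
      using \<eta>[OF prime_s I_s] \<eta>[OF q.prime_Q q.I_subset_Q] s_Q
      by (intro bexI[of _ "?\<eta> s"] bexI[of _ "?\<eta> q.Q"]) auto
  qed
  then have "connected_space (zariski_topology (?P Quot I))"
    by (rule connected_space_zariskiI[OF cring z])
  then show ?thesis using z by (auto simp: connected_Spec_def)
qed

text \<open>Pivots at the ideal of the point \<open>\<Gamma>\<close> serve for both dimensions,
  which become \<open>card U\<close> and \<open>card V = m + card U\<close>.\<close>

lemma krull_dim_fiber_eq:
  assumes regular: "regular_ring (mpoly_ring {0..<n} Quot I)"
  shows "krull_dim (mpoly_ring {m..<n} Quot fiber_ideal m \<Gamma> I)
    = krull_dim (mpoly_ring {0..<n} Quot I) - ereal (real m)"
proof -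
  interpret fiber m n W I \<Gamma> ..
  obtain J F where "pivots m n W I q J F" using ex_pivots[OF prime_q] by blast
  then interpret piv: pivots m n W I q J F .
  interpret fiber_pivots m n W I \<Gamma> J F ..
  show ?thesis
    using krull_dim_fiber[OF regular] krull_dim_total[OF regular] card_V by simp
qed

end

theorem proposition5p10:
  fixes m n :: nat
    and W :: "nat \<Rightarrow> int"
    and I :: "'k::field mpoly set"
  defines "P \<equiv> mpoly_ring {0..<n} :: 'k mpoly ring"
    and "P\<^sub>0 \<equiv> mpoly_ring {0..<m} :: 'k mpoly ring"
    and "KX \<equiv> mpoly_ring {m..<n} :: 'k mpoly ring"
  assumes "m < n"
    and "\<forall>i\<in>{0..<m}. W i = 0"
    and "\<forall>j\<in>{m..<n}. W j > 0"
    and "homogeneous_ideal W P I"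
    and "I \<inter> carrier P\<^sub>0 = {0}"
  shows "connected_Spec (P Quot I)
    \<and> (regular_ring (P Quot I) \<longrightarrow> primeideal I P)
    \<and> (regular_ring (P Quot I) \<longrightarrow>
        (\<forall>\<Gamma> :: nat \<Rightarrow> 'k.
          krull_dim (KX Quot fiber_ideal m \<Gamma> I) = krull_dim (P Quot I) - ereal (real m)))"
proof -
  have "ideal_in (polys {0..<n}) I"
    using assms(7) by (simp add: homogeneous_ideal_def P_def ideal_in_polys_iff)
  then interpret I: ideal_in "polys {0..<n}" I .
  interpret graded_ideal m n W I
    by unfold_locales (use assms in \<open>auto simp: homogeneous_ideal_def P\<^sub>0_def\<close>)
  show ?thesis
    using connected regular_prime krull_dim_fiber_eq
    by (simp add: P_def KX_def prime_in_polys_iff)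
qed

end
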